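(* Let $G=H+J$ be a finite group of triangular type over a finite field $k$, and let $G'=H'+J'$ be a subgroup of triangular type in $G$. Then for every supercharacter $\chi$ of $G$, the restriction $\mathrm{Res}\,\chi$ of $\chi$ to $G'$ is a sum of supercharacters of $G'$ with nonnegative integer coefficients.
   Context: **Finite groups of triangular type.** Let $k=\mathbb F_q$ be a finite field, $J$ a finite-dimensional associative nilpotent $k$-algebra, and $H$ a finite abelian group with $\mathrm{char}\,k\nmid |H|$. Assume $H$ acts $k$-linearly on $J$ on the left, $(h,x)\mapsto hx$, and on the right, $(h,x)\mapsto xh$, the two actions commute ($(hx)h'=h(xh')$), and for all $h\in H$, $x,y\in J$: $h(xy)=(hx)y$, $(xy)h=x(yh)$, $x(hy)=(xh)y$. Then $A=kH\oplus J$ is an associative unital algebra with multiplication extending $(h_1+x_1)(h_2+x_2)=h_1h_2+h_1x_2+x_1h_2+x_1x_2$, and $G=H+J=\{h+x: h\in H,\ x\in J\}\subset A$ is a finite group under this multiplication, called a finite group of triangular type. Put $N=1+J$. **Subgroups of triangular type.** If $H'$ is a subgroup of $H$ and $J'$ is a subalgebra of $J$ invariant under left and right multiplication by $H'$, then $G'=H'+J'$ is a subgroup of $G$, called a subgroup of triangular type. It is itself a finite group of triangular type (with data $H',J'$), and its supercharacters are defined by the construction below with $(H',J')$ in place of $(H,J)$ and the same additive character of $k$. **Orbits.** Let $\widetilde G$ be the set of triples $\tau=(t,a,b)$, $t\in H$, $a,b\in N$, with the group operation $(t_1,a_1,b_1)(t_2,a_2,b_2)=(t_1t_2,\ t_2^{-1}a_1t_2a_2,\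 t_2^{-1}b_1t_2b_2)$. It acts on $J$ by $\rho_\tau(x)=taxb^{-1}t^{-1}$ and on the dual space $J^*$ by $(\rho^*_\tau\lambda)(x)=\lambda(\rho_{\tau^{-1}}(x))$. For an idempotent $e\in kH$ put $e'=1-e$, $J_e=eJe$, $H_e=eHe$ (a group with identity $e$), $G_e=eGe=H_e+J_e$ (again a finite group of triangular type, with $N_e=e+J_e$), and let $\widetilde G_e$ be the corresponding group of triples acting on $J_e$ and $J_e^*$. The space $J_e^*$ is identified with the subspace of $J^*$ of all linear forms vanishing on $eJe'\oplus e'Je\oplus e'Je'$. A $\widetilde G$-orbit in $J^*$ is singular (with respect to $H$) if it meets $J_e^*$ for some idempotent $e\neq 1$ of $kH$, and regular otherwise; regularity of $\widetilde G_e$-orbits in $J_e^*$ with respect to $H_e$ is defined in the same way, i.e. the orbit does not meet $J_f^*$ for any idempotent $f\ne e$ of $kH_e=kHe$. **Supercharacters.** For an idempotent $e\in kH$ let $H(e)=\{h\in H: he=e\}$. Let $\mathfrak A$ be the set of triples $\alpha=(e,\theta,\omega^* )$, where $e$ is an idempotent of $kH$, $\theta:H(e)\to\mathbb C^*$ is a linear character (one-dimensional representation), and $\omega^*$ is a regular (with respect to $H_e$) $\widetilde G_e$-orbit in $J_e^*$. Fix a nontrivial character $t\mapsto\varepsilon^t$ of the additive group $k=\mathbb F_q$ with values in $\mathbb C^*$. For $\alpha\in\mathfrak A$ choose $\lambda\in\omega^*\subset J_e^*\subset J^*$, put $J_{\lambda,\mathrm{right}}=\{x\in J:\lambda(xJ)=0\}$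 and $G_\alpha=H(e)+J_{\lambda,\mathrm{right}}$ (a subgroup of $G$), and define the linear character $\xi_{\theta,\lambda}(h+x)=\theta(h)\varepsilon^{\lambda(x)}$ of $G_\alpha$ ($h\in H(e)$, $x\in J_{\lambda,\mathrm{right}}$). The supercharacter of $G$ attached to $\alpha$ is the induced character $\chi_\alpha=\mathrm{Ind}(\xi_{\theta,\lambda},G_\alpha,G)$; it does not depend on the choice of $\lambda\in\omega^*$. *)

theory Defs
  imports Complex_Main "HOL-Algebra.Algebra"
begin

text \<open>The algebra \<open>J\<close> is a carrier set inside an ambient (non-unital, associative) ring that is
  a vector space over \<open>k\<close>, so that the data of a subgroup of triangular type are again data of
  the same kind, over the same types.  \<open>lact h x\<close> and \<open>ract x h\<close> are the two actions
  \<open>hx\<close> and \<open>xh\<close>; only their values for \<open>h\<close> in \<open>H\<close> and \<open>x\<close> in \<open>J\<close> matter.\<close>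

locale triangular_type =
  vector_space scale + H: comm_group H
  for scale :: "'k::{field,finite} \<Rightarrow> 'a::ring \<Rightarrow> 'a" (infixr \<open>*s\<close> 75)
    and H :: "'h monoid" (structure) +
  fixes J :: "'a set"
    and lact :: "'h \<Rightarrow> 'a \<Rightarrow> 'a" (infixr \<open>\<triangleright>\<close> 75)
    and ract :: "'a \<Rightarrow> 'h \<Rightarrow> 'a" (infixl \<open>\<triangleleft>\<close> 75)
  assumes H_finite: "finite (carrier H)"
    and char_H: "\<not> CHAR('k) dvd order H"
    and J_subspace: "subspace J"
    and J_finite_dim: "\<exists>B. finite B \<and> B \<subseteq> J \<and> span B = J"
    and J_mult: "x \<in> J \<Longrightarrow> y \<in> J \<Longrightarrow> x * y \<in> J"
    and J_scale_left: "x \<in> J \<Longrightarrow> y \<in> J \<Longrightarrow> (c *s x) * y = c *s (x * y)"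
    and J_scale_right: "x \<in> J \<Longrightarrow> y \<in> J \<Longrightarrow> x * (c *s y) = c *s (x * y)"
    and J_nilpotent:
      "\<exists>n. \<forall>xs x. set xs \<subseteq> J \<and> x \<in> J \<and> length xs = n \<longrightarrow> foldr (*) xs x = 0"
    and lact_closed: "h \<in> carrier H \<Longrightarrow> x \<in> J \<Longrightarrow> h \<triangleright> x \<in> J"
    and lact_add: "h \<in> carrier H \<Longrightarrow> x \<in> J \<Longrightarrow> y \<in> J \<Longrightarrow> h \<triangleright> (x + y) = h \<triangleright> x + h \<triangleright> y"
    and lact_scale: "h \<in> carrier H \<Longrightarrow> x \<in> J \<Longrightarrow> h \<triangleright> (c *s x) = c *s (h \<triangleright> x)"
    and lact_one: "x \<in> J \<Longrightarrow> \<one> \<triangleright> x = x"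
    and lact_mult: "h \<in> carrier H \<Longrightarrow> g \<in> carrier H \<Longrightarrow> x \<in> J \<Longrightarrow> (h \<otimes> g) \<triangleright> x = h \<triangleright> (g \<triangleright> x)"
    and ract_closed: "h \<in> carrier H \<Longrightarrow> x \<in> J \<Longrightarrow> x \<triangleleft> h \<in> J"
    and ract_add: "h \<in> carrier H \<Longrightarrow> x \<in> J \<Longrightarrow> y \<in> J \<Longrightarrow> (x + y) \<triangleleft> h = x \<triangleleft> h + y \<triangleleft> h"
    and ract_scale: "h \<in> carrier H \<Longrightarrow> x \<in> J \<Longrightarrow> (c *s x) \<triangleleft> h = c *s (x \<triangleleft> h)"
    and ract_one: "x \<in> J \<Longrightarrow> x \<triangleleft> \<one> = x"
    and ract_mult: "h \<in> carrier H \<Longrightarrow> g \<in> carrier H \<Longrightarrow> x \<in> J \<Longrightarrow> x \<triangleleft> (h \<otimes> g) = (x \<triangleleft> h) \<triangleleft> g"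
    and actions_commute: "h \<in> carrier H \<Longrightarrow> g \<in> carrier H \<Longrightarrow> x \<in> J \<Longrightarrow> (h \<triangleright> x) \<triangleleft> g = h \<triangleright> (x \<triangleleft> g)"
    and lact_times: "h \<in> carrier H \<Longrightarrow> x \<in> J \<Longrightarrow> y \<in> J \<Longrightarrow> h \<triangleright> (x * y) = (h \<triangleright> x) * y"
    and ract_times: "h \<in> carrier H \<Longrightarrow> x \<in> J \<Longrightarrow> y \<in> J \<Longrightarrow> (x * y) \<triangleleft> h = x * (y \<triangleleft> h)"
    and middle_times: "h \<in> carrier H \<Longrightarrow> x \<in> J \<Longrightarrow> y \<in> J \<Longrightarrow> x * (h \<triangleright> y) = (x \<triangleleft> h) * y"

text \<open>Induction of functions from a subgroup \<open>K\<close> of a finite group \<open>G\<close>, by the usual formula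
  for induced characters.\<close>

definition induced_character :: "('g, 'b) monoid_scheme \<Rightarrow> 'g set \<Rightarrow> ('g \<Rightarrow> complex) \<Rightarrow> 'g \<Rightarrow> complex"
  where "induced_character G K \<xi> g =
    (\<Sum>x | x \<in> carrier G \<and> inv\<^bsub>G\<^esub> x \<otimes>\<^bsub>G\<^esub> g \<otimes>\<^bsub>G\<^esub> x \<in> K. \<xi> (inv\<^bsub>G\<^esub> x \<otimes>\<^bsub>G\<^esub> g \<otimes>\<^bsub>G\<^esub> x)) / of_nat (card K)"

definition nontrivial_additive_character :: "('k::field \<Rightarrow> complex) \<Rightarrow> bool"
  where "nontrivial_additive_character \<epsilon> \<longleftrightarrow>
    (\<forall>t. \<epsilon> t \<noteq> 0) \<and> (\<forall>s t. \<epsilon> (s + t) = \<epsilon> s * \<epsilon> t) \<and> (\<exists>t. \<epsilon> t \<noteq> 1)"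

context triangular_type
begin

text \<open>The algebra \<open>A = kH \<oplus> J\<close>: elements of \<open>kH\<close> are coefficient functions that vanish
  outside \<open>H\<close>.\<close>

definition A :: "(('h \<Rightarrow> 'k) \<times> 'a) ring"
  where "A = \<lparr>
    carrier = {f. \<forall>h. h \<notin> carrier H \<longrightarrow> f h = 0} \<times> J,
    monoid.mult = (\<lambda>(f, x) (g, y).
      (\<lambda>h. \<Sum>(u, v) \<in> {(u, v). u \<in> carrier H \<and> v \<in> carrier H \<and> u \<otimes> v = h}. f u * g v,
       (\<Sum>h\<in>carrier H. f h *s (h \<triangleright> y)) + (\<Sum>h\<in>carrier H. g h *s (x \<triangleleft> h)) + x * y)),
    one = (\<lambda>h. if h = \<one> then 1 else 0, 0),
    ring.zero = (\<lambda>_. 0, 0),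
    ring.add = (\<lambda>(f, x) (g, y). (\<lambda>h. f h + g h, x + y))\<rparr>"

definition of_H :: "'h \<Rightarrow> ('h \<Rightarrow> 'k) \<times> 'a"
  where "of_H h = (\<lambda>u. if u = h then 1 else 0, 0)"

definition of_J :: "'a \<Rightarrow> ('h \<Rightarrow> 'k) \<times> 'a"
  where "of_J x = (\<lambda>_. 0, x)"

definition kH :: "(('h \<Rightarrow> 'k) \<times> 'a) set"
  where "kH = {z \<in> carrier A. snd z = 0}"

definition G :: "(('h \<Rightarrow> 'k) \<times> 'a) monoid"
  where "G = \<lparr>carrier = {of_H h \<oplus>\<^bsub>A\<^esub> of_J x | h x. h \<in> carrier H \<and> x \<in> J},
    monoid.mult = monoid.mult A, one = \<one>\<^bsub>A\<^esub>\<rparr>"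

definition idempotents :: "(('h \<Rightarrow> 'k) \<times> 'a) set"
  where "idempotents = {e \<in> kH. e \<otimes>\<^bsub>A\<^esub> e = e}"

definition H_e :: "('h \<Rightarrow> 'k) \<times> 'a \<Rightarrow> (('h \<Rightarrow> 'k) \<times> 'a) set"
  where "H_e e = {e \<otimes>\<^bsub>A\<^esub> of_H h \<otimes>\<^bsub>A\<^esub> e | h. h \<in> carrier H}"

definition N_e :: "('h \<Rightarrow> 'k) \<times> 'a \<Rightarrow> (('h \<Rightarrow> 'k) \<times> 'a) set"
  where "N_e e = {e \<oplus>\<^bsub>A\<^esub> e \<otimes>\<^bsub>A\<^esub> of_J x \<otimes>\<^bsub>A\<^esub> e | x. x \<in> J}"

definition G_e :: "('h \<Rightarrow> 'k) \<times> 'a \<Rightarrow> (('h \<Rightarrow> 'k) \<times> 'a) monoid"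
  where "G_e e = \<lparr>carrier = {e \<otimes>\<^bsub>A\<^esub> g \<otimes>\<^bsub>A\<^esub> e | g. g \<in> carrier G},
    monoid.mult = monoid.mult A, one = e\<rparr>"

definition triples ::
    "('h \<Rightarrow> 'k) \<times> 'a \<Rightarrow>
      ((('h \<Rightarrow> 'k) \<times> 'a) \<times> (('h \<Rightarrow> 'k) \<times> 'a) \<times> (('h \<Rightarrow> 'k) \<times> 'a)) monoid"
  where "triples e = \<lparr>
    carrier = H_e e \<times> N_e e \<times> N_e e,
    monoid.mult = (\<lambda>(t1, a1, b1) (t2, a2, b2).
      (t1 \<otimes>\<^bsub>A\<^esub> t2,
       inv\<^bsub>G_e e\<^esub> t2 \<otimes>\<^bsub>A\<^esub> a1 \<otimes>\<^bsub>A\<^esub> t2 \<otimes>\<^bsub>A\<^esub> a2,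
       inv\<^bsub>G_e e\<^esub> t2 \<otimes>\<^bsub>A\<^esub> b1 \<otimes>\<^bsub>A\<^esub> t2 \<otimes>\<^bsub>A\<^esub> b2)),
    one = (e, e, e)\<rparr>"

text \<open>The element \<open>axb\<close> of \<open>J\<close>, for \<open>a, b\<close> in \<open>A\<close> and \<open>x\<close> in \<open>J\<close>.\<close>

definition sandwich :: "('h \<Rightarrow> 'k) \<times> 'a \<Rightarrow> 'a \<Rightarrow> ('h \<Rightarrow> 'k) \<times> 'a \<Rightarrow> 'a"
  where "sandwich a x b = snd (a \<otimes>\<^bsub>A\<^esub> of_J x \<otimes>\<^bsub>A\<^esub> b)"

definition rho ::
    "('h \<Rightarrow> 'k) \<times> 'a \<Rightarrow>
      (('h \<Rightarrow> 'k) \<times> 'a) \<times> (('h \<Rightarrow> 'k) \<times> 'a) \<times> (('h \<Rightarrow> 'k) \<times> 'a) \<Rightarrow> 'a \<Rightarrow> 'a"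
  where "rho e = (\<lambda>(t, a, b) x.
    sandwich (t \<otimes>\<^bsub>A\<^esub> a) x (inv\<^bsub>G_e e\<^esub> b \<otimes>\<^bsub>A\<^esub> inv\<^bsub>G_e e\<^esub> t))"

text \<open>Linear forms on \<open>J\<close> are normalised to be \<open>0\<close> outside \<open>J\<close>.  The dual of
  \<open>J_e = eJe\<close> is treated throughout as the subspace \<open>dual_e e\<close> of \<open>dual\<close>; for idempotents
  \<open>f = fe\<close> it contains \<open>dual_e f\<close>, and it makes no difference whether the complement of
  \<open>f\<close> is taken in \<open>A\<close> or in \<open>eAe\<close>.\<close>

definition dual :: "('a \<Rightarrow> 'k) set"
  where "dual = {l. (\<forall>x\<in>J. \<forall>y\<in>J. l (x + y) = l x + l y) \<and>
    (\<forall>c. \<forall>x\<in>J. l (c *s x) = c * l x) \<and> (\<forall>x. x \<notin> J \<longrightarrow> l x = 0)}"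

definition dual_e :: "('h \<Rightarrow> 'k) \<times> 'a \<Rightarrow> ('a \<Rightarrow> 'k) set"
  where "dual_e e = (let e' = \<one>\<^bsub>A\<^esub> \<ominus>\<^bsub>A\<^esub> e in
    {l \<in> dual. \<forall>x\<in>J. l (sandwich e x e') = 0 \<and> l (sandwich e' x e) = 0 \<and> l (sandwich e' x e') = 0})"

text \<open>A form in \<open>dual_e e\<close> is determined by its restriction to \<open>eJe\<close>, its value at \<open>x\<close>
  being its value at \<open>exe\<close>; this is how the transformed form on \<open>eJe\<close> is extended to \<open>J\<close>.\<close>

definition rho_dual ::
    "('h \<Rightarrow> 'k) \<times> 'a \<Rightarrow>
      (('h \<Rightarrow> 'k) \<times> 'a) \<times> (('h \<Rightarrow> 'k) \<times> 'a) \<times> (('h \<Rightarrow> 'k) \<times> 'a) \<Rightarrow> ('a \<Rightarrow> 'k) \<Rightarrow> 'a \<Rightarrow> 'k"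
  where "rho_dual e \<tau> l =
    (\<lambda>x. if x \<in> J then l (rho e (inv\<^bsub>triples e\<^esub> \<tau>) (sandwich e x e)) else 0)"

definition dual_orbits :: "('h \<Rightarrow> 'k) \<times> 'a \<Rightarrow> ('a \<Rightarrow> 'k) set set"
  where "dual_orbits e = {{rho_dual e \<tau> l | \<tau>. \<tau> \<in> carrier (triples e)} | l. l \<in> dual_e e}"

definition regular_orbits :: "('h \<Rightarrow> 'k) \<times> 'a \<Rightarrow> ('a \<Rightarrow> 'k) set set"
  where "regular_orbits e = {\<Omega> \<in> dual_orbits e.
    \<forall>f \<in> idempotents \<inter> {z \<otimes>\<^bsub>A\<^esub> e | z. z \<in> kH}. f \<noteq> e \<longrightarrow> \<Omega> \<inter> dual_e f = {}}"

definition H_fix :: "('h \<Rightarrow> 'k) \<times> 'a \<Rightarrow> 'h set"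
  where "H_fix e = {h \<in> carrier H. of_H h \<otimes>\<^bsub>A\<^esub> e = e}"

definition linear_character :: "'h set \<Rightarrow> ('h \<Rightarrow> complex) \<Rightarrow> bool"
  where "linear_character K \<theta> \<longleftrightarrow>
    (\<forall>h\<in>K. \<theta> h \<noteq> 0) \<and> (\<forall>g\<in>K. \<forall>h\<in>K. \<theta> (g \<otimes> h) = \<theta> g * \<theta> h)"

definition index_set ::
    "((('h \<Rightarrow> 'k) \<times> 'a) \<times> ('h \<Rightarrow> complex) \<times> ('a \<Rightarrow> 'k) set) set"
  where "index_set = {(e, \<theta>, \<Omega>).
    e \<in> idempotents \<and> linear_character (H_fix e) \<theta> \<and> \<Omega> \<in> regular_orbits e}"

definition J_right :: "('a \<Rightarrow> 'k) \<Rightarrow> 'a set"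
  where "J_right l = {x \<in> J. \<forall>y\<in>J. l (x * y) = 0}"

definition G_sub :: "('h \<Rightarrow> 'k) \<times> 'a \<Rightarrow> ('a \<Rightarrow> 'k) \<Rightarrow> (('h \<Rightarrow> 'k) \<times> 'a) set"
  where "G_sub e l = {of_H h \<oplus>\<^bsub>A\<^esub> of_J x | h x. h \<in> H_fix e \<and> x \<in> J_right l}"

definition xi :: "('k \<Rightarrow> complex) \<Rightarrow> ('h \<Rightarrow> complex) \<Rightarrow> ('a \<Rightarrow> 'k) \<Rightarrow> ('h \<Rightarrow> 'k) \<times> 'a \<Rightarrow> complex"
  where "xi \<epsilon> \<theta> l g =
    \<theta> (THE h. h \<in> carrier H \<and> fst g = fst (of_H h)) * \<epsilon> (l (snd g))"

text \<open>The character does not depend on the choice of \<open>l\<close> in the orbit, so collecting it for all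
  \<open>l\<close> in the orbit adds nothing to making one choice per orbit.\<close>

definition supercharacters :: "('k \<Rightarrow> complex) \<Rightarrow> ((('h \<Rightarrow> 'k) \<times> 'a) \<Rightarrow> complex) set"
  where "supercharacters \<epsilon> =
    {induced_character G (G_sub e l) (xi \<epsilon> \<theta> l) | e \<theta> \<Omega> l. (e, \<theta>, \<Omega>) \<in> index_set \<and> l \<in> \<Omega>}"

definition triangular_subgroup :: "'h set \<Rightarrow> 'a set \<Rightarrow> bool"
  where "triangular_subgroup H' J' \<longleftrightarrow>
    subgroup H' H \<and> J' \<subseteq> J \<and> subspace J' \<and> (\<forall>x\<in>J'. \<forall>y\<in>J'. x * y \<in> J') \<and>
    (\<forall>h\<in>H'. \<forall>x\<in>J'. h \<triangleright> x \<in> J' \<and> x \<triangleleft> h \<in> J')"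

lemma triangular_type_triangular_subgroup:
  assumes "triangular_subgroup H' J'"
  shows "triangular_type scale (H\<lparr>carrier := H'\<rparr>) J' lact ract"
proof -
  have H': "subgroup H' H" and sub: "J' \<subseteq> J" "subspace J'"
    and mult: "\<And>x y. x \<in> J' \<Longrightarrow> y \<in> J' \<Longrightarrow> x * y \<in> J'"
    and act: "\<And>h x. h \<in> H' \<Longrightarrow> x \<in> J' \<Longrightarrow> h \<triangleright> x \<in> J'"
      "\<And>h x. h \<in> H' \<Longrightarrow> x \<in> J' \<Longrightarrow> x \<triangleleft> h \<in> J'"
    using assms by (auto simp: triangular_subgroup_def)
  have HH: "h \<in> carrier H" if "h \<in> H'" for h using that H' subgroup.mem_carrier by metis
  have JJ: "x \<in> J" if "x \<in> J'" for x using that sub by blast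
  have "comm_group (H\<lparr>carrier := H'\<rparr>)"
    using HH by (intro group.group_comm_groupI[OF H.subgroup_imp_group[OF H']]) (auto intro: H.m_comm)
  moreover have "\<not> CHAR('k) dvd order (H\<lparr>carrier := H'\<rparr>)"
    using char_H H.lagrange[OF H'] dvd_mult[of "CHAR('k)" "card H'" "card (rcosets H')"]
    by (auto simp: order_def)
  moreover have "\<exists>B. finite B \<and> B \<subseteq> J' \<and> span B = J'"
  proof -
    obtain B where B: "finite B" "span B = J" using J_finite_dim by blast
    obtain C where C: "C \<subseteq> J'" "independent C" "span C = J'"
      using sub(2) basis_exists span_eq_iff span_subspace by metis
    have "finite C"
      using independent_span_bound[OF B(1) C(2)] C(1) sub(1) B(2) by blast
    then show ?thesis using C by blast
  qed
  moreover have "\<exists>n. \<forall>xs x. set xs \<subseteq> J' \<and> x \<in> J' \<and> length xs = n \<longrightarrow> foldr (*) xs x = 0"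
    using J_nilpotent sub(1) by (meson subset_iff)
  moreover have "finite H'"
    using H' H_finite by (meson finite_subset subgroup.subset)
  ultimately show ?thesis
    using vector_space_axioms sub(2) mult act
    by (simp add: triangular_type_def triangular_type_axioms_def HH JJ J_scale_left J_scale_right
        lact_add lact_scale lact_one lact_mult ract_add ract_scale ract_one ract_mult
        actions_commute lact_times ract_times middle_times)
qed

end

end

theory Submission
  imports Defs
begin

text \<open>Write \<open>J\<^sub>\<lambda>\<close> for \<open>{x \<in> J. \<lambda>(xJ) = 0}\<close>, and let \<open>\<chi>\<close> be induced from \<open>H(e) + J\<^sub>\<lambda>\<close>.  Mackey's formula writes the restriction of \<open>\<chi>\<close> to \<open>G'\<close> as a
  sum of characters induced from stabilizers of forms \<open>\<mu>\<close> on \<open>J\<close>.  Since \<open>|H|\<close> is invertible in \<open>k\<close>, averaging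
  over the projection \<open>K\<close> of a stabilizer to \<open>H'\<close> allows one to choose \<open>\<mu>\<close> invariant under \<open>K\<close> on both sides;
  the stabilizer is then \<open>K + R\<close>, where \<open>R\<close> is a right ideal of \<open>J'\<close> that may be smaller than \<open>J'\<^sub>\<mu>\<close>.
  By Fourier inversion, the character of \<open>K + J'\<close> induced from \<open>K + R\<close> is the trace of a monomial action
  on the forms that agree with \<open>\<mu>\<close> on \<open>R\<close>.  Splitting it into orbits and averaging once more gives
  characters induced from \<open>L + J'\<^sub>\<nu>\<close> with \<open>\<nu>\<close> invariant under \<open>L \<le> K\<close> on both sides.  Finally, choose an
  idempotent \<open>e\<close>, minimal subject to \<open>L \<le> H'(e)\<close> and to \<open>\<nu>\<close> being movable into \<open>J'\<^sub>e\<^sup>*\<close> without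
  changing the induced character.  Minimality makes the orbit regular, and inducing in stages through
  \<open>H'(e) + J'\<^sub>\<nu>\<close> gives a sum of supercharacters, one for each extension of the character of \<open>L\<close> to \<open>H'(e)\<close>.\<close>

section \<open>Induced characters and monomial actions\<close>

text \<open>The obstacle is that a Mackey component has the wrong shape: its subgroup need not
  contain its projection \<open>K\<close> to \<open>H'\<close>, and its unipotent part is cut out by
  products with \<open>J\<close> rather than with \<open>J'\<close>. The averages over
  \<open>K\<close> and \<open>L\<close> answer the first defect: a mean of the discrepancies between
  elements of the projection and their lifts conjugates the stabilizer into split position. The
  second defect is why forms replace cosets. The character of \<open>K + J'\<close> induced from
  \<open>K + R\<close> has degree \<open>|J'|/|R|\<close>, which is also the number of forms that
  agree with \<open>\<mu>\<close> on \<open>R\<close>; the Fourier transform exchanges the two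
  descriptions, and on forms the decomposition into orbits is visible. The price is a change of
  side. Forms are moved by \<open>\<nu>(y)\<close> to \<open>\<nu>(yg)\<close>, so stabilizers
  contain the left annihilator \<open>J_left\<close>, whereas supercharacters are built from the
  right annihilator \<open>J_right\<close>. \<open>induced_left_eq_right\<close> exchanges them by
  the same trace formula with \<open>R = J_right \<nu>\<close>, for which the forms in question are
  a single orbit.\<close>

context group
begin

text \<open>Multiplication by a member is injective on the finite set, hence onto; this produces the
  identity and the inverses.\<close>

lemma finite_mult_closed_subgroup:
  assumes "finite (carrier G)" "K \<subseteq> carrier G" "K \<noteq> {}"
    and cl: "\<And>x y. x \<in> K \<Longrightarrow> y \<in> K \<Longrightarrow> x \<otimes> y \<in> K"
  shows "subgroup K G"
proof -
  have inv: "\<one> \<in> K \<and> inv x \<in> K" if x: "x \<in> K" for x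
  proof -
    have xc: "x \<in> carrier G" using x assms by blast
    have "inj_on (\<lambda>y. x \<otimes> y) K"
      by (rule inj_onI) (metis assms(2) l_cancel subsetD xc)
    moreover have "(\<lambda>y. x \<otimes> y) ` K \<subseteq> K" using cl x by auto
    moreover have "finite K" using assms finite_subset by blast
    ultimately have im: "(\<lambda>y. x \<otimes> y) ` K = K"
      by (simp add: endo_inj_surj)
    obtain y where y: "y \<in> K" "x \<otimes> y = x" using im x by (metis imageE)
    then have 1: "\<one> \<in> K" using xc assms(2) by (metis l_cancel_one' subsetD)
    obtain z where z: "z \<in> K" "x \<otimes> z = \<one>" using im 1 by (metis imageE)
    then have "inv x = z" using xc assms(2) by (metis inv_comm inv_equality subsetD)
    then show ?thesis using 1 z by simp
  qed
  show ?thesis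
    using assms inv by (intro subgroupI) auto
qed

text \<open>Replacing x by its inverse and extending by zero makes the summand a function of x g
  x^-1, the kind of conjugate that \<open>conj_el\<close> computes later.\<close>

lemma induced_character_alt:
  assumes "finite (carrier G)"
  shows "induced_character G S \<xi> g =
    (\<Sum>x\<in>carrier G. if x \<otimes> g \<otimes> inv x \<in> S then \<xi> (x \<otimes> g \<otimes> inv x) else 0) / of_nat (card S)"
proof -
  have "(\<Sum>x | x \<in> carrier G \<and> inv x \<otimes> g \<otimes> x \<in> S. \<xi> (inv x \<otimes> g \<otimes> x)) =
      (\<Sum>x\<in>carrier G. if inv x \<otimes> g \<otimes> x \<in> S then \<xi> (inv x \<otimes> g \<otimes> x) else 0)"
    by (simp add: sum.inter_filter[symmetric] assms)
  also have "\<dots> = (\<Sum>x\<in>carrier G. if x \<otimes> g \<otimes> inv x \<in> S then \<xi> (x \<otimes> g \<otimes> inv x) else 0)"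
    by (rule sum.reindex_bij_witness[of _ "\<lambda>x. inv x" "\<lambda>x. inv x"]) auto
  finally show ?thesis by (simp add: induced_character_def)
qed

text \<open>Translation by \<open>c\<close> permutes the group and conjugation by \<open>c\<close>
  matches \<open>T\<close> with \<open>S\<close>, so conjugate data induce the same
  function.\<close>

lemma induced_character_conj:
  assumes fin: "finite (carrier G)" and c: "c \<in> carrier G" and S: "S \<subseteq> carrier G"
    and g: "g \<in> carrier G"
    and T: "T = {t \<in> carrier G. c \<otimes> t \<otimes> inv c \<in> S}"
    and \<eta>: "\<And>t. t \<in> T \<Longrightarrow> \<eta> t = \<xi> (c \<otimes> t \<otimes> inv c)"
  shows "induced_character G T \<eta> g = induced_character G S \<xi> g"
proof -
  have "bij_betw (\<lambda>t. c \<otimes> t \<otimes> inv c) T S"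
  proof (rule bij_betw_byWitness[where f' = "\<lambda>s. inv c \<otimes> s \<otimes> c"])
    show "\<forall>t\<in>T. inv c \<otimes> (c \<otimes> t \<otimes> inv c) \<otimes> c = t"
      using c T by (auto simp: m_assoc inv_solve_left')
    have r: "c \<otimes> (inv c \<otimes> s \<otimes> c) \<otimes> inv c = s" if "s \<in> S" for s
    proof -
      have sc: "s \<in> carrier G" using that S by blast
      have "c \<otimes> (inv c \<otimes> s \<otimes> c) \<otimes> inv c = (c \<otimes> inv c) \<otimes> s \<otimes> (c \<otimes> inv c)"
        using c sc by (simp only: m_assoc m_closed inv_closed)
      then show ?thesis using c sc by simp
    qed
    then show "\<forall>s\<in>S. c \<otimes> (inv c \<otimes> s \<otimes> c) \<otimes> inv c = s" by blast
    show "(\<lambda>t. c \<otimes> t \<otimes> inv c) ` T \<subseteq> S" using T by auto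
    show "(\<lambda>s. inv c \<otimes> s \<otimes> c) ` S \<subseteq> T"
      using T c S r by auto
  qed
  then have card: "card T = card S" by (rule bij_betw_same_card)
  have "(\<Sum>x\<in>carrier G. if x \<otimes> g \<otimes> inv x \<in> T then \<eta> (x \<otimes> g \<otimes> inv x) else 0) =
      (\<Sum>x\<in>carrier G. if x \<otimes> g \<otimes> inv x \<in> S then \<xi> (x \<otimes> g \<otimes> inv x) else 0)"
  proof (rule sum.reindex_bij_witness[of _ "\<lambda>x. inv c \<otimes> x" "\<lambda>x. c \<otimes> x"])
    fix x assume x: "x \<in> carrier G"
    show "inv c \<otimes> (c \<otimes> x) = x" using c x by (simp add: m_assoc[symmetric])
    show "c \<otimes> (inv c \<otimes> x) = x" using c x by (simp add: m_assoc[symmetric])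
    show "c \<otimes> x \<in> carrier G" "inv c \<otimes> x \<in> carrier G" using c x by auto
    have e: "c \<otimes> x \<otimes> g \<otimes> inv (c \<otimes> x) = c \<otimes> (x \<otimes> g \<otimes> inv x) \<otimes> inv c"
      using c x g by (simp add: m_assoc inv_mult_group)
    have xg: "x \<otimes> g \<otimes> inv x \<in> carrier G" using x g by auto
    show "(if c \<otimes> x \<otimes> g \<otimes> inv (c \<otimes> x) \<in> S then \<xi> (c \<otimes> x \<otimes> g \<otimes> inv (c \<otimes> x)) else 0) =
        (if x \<otimes> g \<otimes> inv x \<in> T then \<eta> (x \<otimes> g \<otimes> inv x) else 0)"
      unfolding e using \<eta>[of "x \<otimes> g \<otimes> inv x"] xg by (auto simp: T)
  qed
  then show ?thesis by (simp add: induced_character_alt fin card)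
qed

text \<open>Transitivity of induction. Both averages are written as one double sum over x in the
  group and y in \<open>Q\<close>; for each y the substitution of yx by x leaves the same sum over
  the group, so \<open>card Q\<close> equal copies arise and cancel the outer denominator.\<close>

lemma induced_character_stages:
  assumes fin: "finite (carrier G)" and Q: "subgroup Q G" and S: "S \<subseteq> Q" and g: "g \<in> carrier G"
  shows "induced_character G Q (induced_character (G\<lparr>carrier := Q\<rparr>) S \<xi>) g = induced_character G S \<xi> g"
proof -
  interpret Q: group "G\<lparr>carrier := Q\<rparr>" using Q subgroup_imp_group by blast
  have Qc: "q \<in> carrier G" if "q \<in> Q" for q using that Q subgroup.mem_carrier by metis
  have finQ: "finite Q" using fin Qc by (meson finite_subset subsetI)
  define F where "F z = (if z \<in> S then \<xi> z else 0)" for z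
  have inner: "(if x \<otimes> g \<otimes> inv x \<in> Q then induced_character (G\<lparr>carrier := Q\<rparr>) S \<xi> (x \<otimes> g \<otimes> inv x) else 0)
      = (\<Sum>y\<in>Q. F ((y \<otimes> x) \<otimes> g \<otimes> inv (y \<otimes> x))) / of_nat (card S)" if x: "x \<in> carrier G" for x
  proof -
    have e: "(y \<otimes> x) \<otimes> g \<otimes> inv (y \<otimes> x) = y \<otimes> (x \<otimes> g \<otimes> inv x) \<otimes> inv y" if "y \<in> Q" for y
      using that Qc x g by (simp add: m_assoc inv_mult_group)
    show ?thesis
    proof (cases "x \<otimes> g \<otimes> inv x \<in> Q")
      case True
      then show ?thesis
        using Q.induced_character_alt[of S \<xi> "x \<otimes> g \<otimes> inv x"] finQ Q
        by (simp add: e F_def cong: if_cong)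
    next
      case False
      have "y \<otimes> (x \<otimes> g \<otimes> inv x) \<otimes> inv y \<notin> S" if y: "y \<in> Q" for y
      proof
        assume "y \<otimes> (x \<otimes> g \<otimes> inv x) \<otimes> inv y \<in> S"
        then have "inv y \<otimes> (y \<otimes> (x \<otimes> g \<otimes> inv x) \<otimes> inv y) \<otimes> y \<in> Q"
          using S y Q by (meson subgroup.m_closed subgroup.m_inv_closed subsetD)
        moreover have "inv y \<otimes> (y \<otimes> (x \<otimes> g \<otimes> inv x) \<otimes> inv y) \<otimes> y = x \<otimes> g \<otimes> inv x"
          using Qc[OF y] x g by (simp add: m_assoc inv_solve_left')
        ultimately show False using False by simp
      qed
      then have "(\<Sum>y\<in>Q. F ((y \<otimes> x) \<otimes> g \<otimes> inv (y \<otimes> x))) = 0"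
        by (intro sum.neutral) (simp add: e F_def)
      then show ?thesis using False by simp
    qed
  qed
  have "(\<Sum>x\<in>carrier G. (\<Sum>y\<in>Q. F ((y \<otimes> x) \<otimes> g \<otimes> inv (y \<otimes> x)))) =
    (\<Sum>y\<in>Q. \<Sum>x\<in>carrier G. F ((y \<otimes> x) \<otimes> g \<otimes> inv (y \<otimes> x)))" by (rule sum.swap)
  also have "\<dots> = (\<Sum>y\<in>Q. \<Sum>x\<in>carrier G. F (x \<otimes> g \<otimes> inv x))"
  proof (rule sum.cong[OF refl])
    fix y assume y: "y \<in> Q"
    show "(\<Sum>x\<in>carrier G. F ((y \<otimes> x) \<otimes> g \<otimes> inv (y \<otimes> x))) = (\<Sum>x\<in>carrier G. F (x \<otimes> g \<otimes> inv x))"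
      by (rule sum.reindex_bij_witness[of _ "\<lambda>x. inv y \<otimes> x" "\<lambda>x. y \<otimes> x"])
        (use Qc[OF y] in \<open>auto simp: m_assoc[symmetric]\<close>)
  qed
  also have "\<dots> = of_nat (card Q) * (\<Sum>x\<in>carrier G. F (x \<otimes> g \<otimes> inv x))" by simp
  finally have s: "(\<Sum>x\<in>carrier G. (\<Sum>y\<in>Q. F ((y \<otimes> x) \<otimes> g \<otimes> inv (y \<otimes> x)))) =
    of_nat (card Q) * (\<Sum>x\<in>carrier G. F (x \<otimes> g \<otimes> inv x))" .
  have "card Q \<noteq> 0" using finQ subgroup.one_closed[OF Q] by auto
  moreover have "induced_character G Q (induced_character (G\<lparr>carrier := Q\<rparr>) S \<xi>) g =
      (\<Sum>x\<in>carrier G. (\<Sum>y\<in>Q. F ((y \<otimes> x) \<otimes> g \<otimes> inv (y \<otimes> x)))) / of_nat (card S) / of_nat (card Q)"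
    by (simp add: induced_character_alt[OF fin] inner sum_divide_distrib cong: sum.cong)
  ultimately have "induced_character G Q (induced_character (G\<lparr>carrier := Q\<rparr>) S \<xi>) g =
      (\<Sum>x\<in>carrier G. F (x \<otimes> g \<otimes> inv x)) / of_nat (card S)"
    unfolding s by simp
  then show ?thesis
    by (simp add: induced_character_alt[OF fin] F_def)
qed

end

lemma induced_character_cong:
  assumes "g = g'" "\<And>s. s \<in> S \<Longrightarrow> \<xi> s = \<eta> s"
  shows "induced_character G S \<xi> g = induced_character G S \<eta> g'"
  using assms by (auto simp: induced_character_def intro!: sum.cong)

text \<open>The group of a subgroup of triangular type is built from its own algebra, so as a record
  it differs from the restriction of \<open>G\<close>, although the products agree on the carrier.
  This lemma passes between the two.\<close>

lemma induced_character_group_cong: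
  assumes "group G" "group G'" "carrier G = carrier G'" "g \<in> carrier G"
    and "\<And>x y. x \<in> carrier G \<Longrightarrow> y \<in> carrier G \<Longrightarrow> x \<otimes>\<^bsub>G\<^esub> y = x \<otimes>\<^bsub>G'\<^esub> y"
  shows "induced_character G S \<xi> g = induced_character G' S \<xi> g"
proof -
  interpret G: group G by fact
  interpret G': group G' by fact
  have "\<one>\<^bsub>G\<^esub> = \<one>\<^bsub>G'\<^esub>"
    using assms by (metis G.one_closed G.l_one G'.l_cancel_one')
  then have inv: "inv\<^bsub>G\<^esub> x = inv\<^bsub>G'\<^esub> x" if "x \<in> carrier G" for x
    using that assms by (metis G.inv_closed G.l_inv G'.inv_equality)
  have "inv\<^bsub>G\<^esub> x \<otimes>\<^bsub>G\<^esub> g \<otimes>\<^bsub>G\<^esub> x = inv\<^bsub>G'\<^esub> x \<otimes>\<^bsub>G'\<^esub> g \<otimes>\<^bsub>G'\<^esub> x" if "x \<in> carrier G" for x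
    using that assms by (metis G.inv_closed G.m_closed inv)
  then have "{x \<in> carrier G. inv\<^bsub>G\<^esub> x \<otimes>\<^bsub>G\<^esub> g \<otimes>\<^bsub>G\<^esub> x \<in> S} = {x \<in> carrier G'. inv\<^bsub>G'\<^esub> x \<otimes>\<^bsub>G'\<^esub> g \<otimes>\<^bsub>G'\<^esub> x \<in> S}"
    "\<And>x. x \<in> carrier G \<Longrightarrow> \<xi> (inv\<^bsub>G\<^esub> x \<otimes>\<^bsub>G\<^esub> g \<otimes>\<^bsub>G\<^esub> x) = \<xi> (inv\<^bsub>G'\<^esub> x \<otimes>\<^bsub>G'\<^esub> g \<otimes>\<^bsub>G'\<^esub> x)"
    using assms(3) by auto
  then show ?thesis
    unfolding induced_character_def by (intro arg_cong2[where f = "(/)"] sum.cong) auto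
qed

text \<open>This encodes a complex representation with basis \<open>E\<close> in which g sends x to
  a multiple of \<open>act g x\<close>. Only traces matter, so \<open>c x g\<close> is meaningful
  when g fixes x, where it is a diagonal entry; \<open>c_conj\<close> is the invariance of diagonal
  entries under conjugation.\<close>

locale monomial_action = group G for G (structure) +
  fixes E :: "'x set" and act :: "'a \<Rightarrow> 'x \<Rightarrow> 'x" and c :: "'x \<Rightarrow> 'a \<Rightarrow> complex"
  assumes finite_carrier: "finite (carrier G)" and finite_E: "finite E"
    and act_closed: "g \<in> carrier G \<Longrightarrow> x \<in> E \<Longrightarrow> act g x \<in> E"
    and act_one: "x \<in> E \<Longrightarrow> act \<one> x = x"
    and act_mult: "g \<in> carrier G \<Longrightarrow> h \<in> carrier G \<Longrightarrow> x \<in> E \<Longrightarrow> act (g \<otimes> h) x = act g (act h x)"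
    and c_conj: "w \<in> carrier G \<Longrightarrow> g \<in> carrier G \<Longrightarrow> x \<in> E \<Longrightarrow> act g x = x \<Longrightarrow>
      c (act w x) (w \<otimes> g \<otimes> inv w) = c x g"
begin

definition stab :: "'x \<Rightarrow> 'a set" where "stab x = {s \<in> carrier G. act s x = x}"

definition orb :: "'x \<Rightarrow> 'x set" where "orb x = (\<lambda>w. act w x) ` carrier G"

lemma subgroup_stab: "x \<in> E \<Longrightarrow> subgroup (stab x) G"
  by (rule finite_mult_closed_subgroup)
    (auto simp: stab_def finite_carrier act_one act_mult intro!: exI[of _ \<one>])

lemma act_inv: "w \<in> carrier G \<Longrightarrow> x \<in> E \<Longrightarrow> act (inv w) (act w x) = x"
  by (metis act_mult act_one inv_closed l_inv)

text \<open>A transitive monomial representation is induced from the scalar character of a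
  stabilizer. Summing over all w instead of over the orbit counts every point of the orbit
  \<open>card (stab x0)\<close> times, and that is the denominator of the induced character.\<close>

lemma trace_orb:
  assumes x0: "x0 \<in> E" and g: "g \<in> carrier G"
  shows "(\<Sum>x | x \<in> orb x0 \<and> act g x = x. c x g) = induced_character G (stab x0) (c x0) g"
proof -
  define F where "F x = (if act g x = x then c x g else 0)" for x
  have stab_iff: "inv w \<otimes> g \<otimes> w \<in> stab x0 \<longleftrightarrow> act g (act w x0) = act w x0" if "w \<in> carrier G" for w
  proof -
    have "act (inv w \<otimes> g \<otimes> w) x0 = act (inv w) (act g (act w x0))"
      using that g x0 by (simp add: act_mult act_closed)
    moreover have "act (inv w) y = x0 \<longleftrightarrow> y = act w x0" if "y \<in> E" for y
      using that \<open>w \<in> carrier G\<close> x0 by (metis act_inv act_mult act_one inv_closed r_inv)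
    ultimately show ?thesis
      using that g x0 by (simp add: stab_def act_closed)
  qed
  have "(\<Sum>w | w \<in> carrier G \<and> inv w \<otimes> g \<otimes> w \<in> stab x0. c x0 (inv w \<otimes> g \<otimes> w)) =
      (\<Sum>w\<in>carrier G. F (act w x0))"
  proof -
    have "(\<Sum>w | w \<in> carrier G \<and> inv w \<otimes> g \<otimes> w \<in> stab x0. c x0 (inv w \<otimes> g \<otimes> w)) =
      (\<Sum>w\<in>carrier G. if inv w \<otimes> g \<otimes> w \<in> stab x0 then c x0 (inv w \<otimes> g \<otimes> w) else 0)"
      by (simp add: sum.inter_filter[symmetric] finite_carrier)
    also have "\<dots> = (\<Sum>w\<in>carrier G. F (act w x0))"
    proof (rule sum.cong[OF refl])
      fix w assume w: "w \<in> carrier G"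
      have "w \<otimes> (inv w \<otimes> g \<otimes> w) \<otimes> inv w = g"
        using w g by (simp add: m_assoc inv_solve_left')
          (metis inv_closed l_one m_assoc r_inv)
      then show "(if inv w \<otimes> g \<otimes> w \<in> stab x0 then c x0 (inv w \<otimes> g \<otimes> w) else 0) = F (act w x0)"
        using c_conj[OF w, of "inv w \<otimes> g \<otimes> w" x0] w g x0 stab_iff[OF w]
        by (auto simp: F_def stab_def)
    qed
    finally show ?thesis .
  qed
  also have "\<dots> = (\<Sum>x\<in>orb x0. \<Sum>w | w \<in> carrier G \<and> act w x0 = x. F (act w x0))"
    unfolding orb_def by (rule sum.image_gen[OF finite_carrier])
  also have "\<dots> = (\<Sum>x\<in>orb x0. of_nat (card (stab x0)) * F x)"
  proof (rule sum.cong[OF refl])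
    fix x assume "x \<in> orb x0"
    then obtain v where v: "v \<in> carrier G" "x = act v x0" by (auto simp: orb_def)
    \<comment> \<open>The elements that carry \<open>x0\<close> to x form a left coset of the
      stabilizer.\<close>
    have "bij_betw (\<lambda>s. v \<otimes> s) (stab x0) {w \<in> carrier G. act w x0 = x}"
    proof (rule bij_betw_byWitness[where f' = "\<lambda>w. inv v \<otimes> w"])
      show "(\<lambda>w. inv v \<otimes> w) ` {w \<in> carrier G. act w x0 = x} \<subseteq> stab x0"
        using v x0 by (auto simp: stab_def act_mult act_inv)
    qed (use v x0 in \<open>auto simp: stab_def act_mult m_assoc[symmetric]\<close>)
    then have "card {w \<in> carrier G. act w x0 = x} = card (stab x0)"
      by (metis bij_betw_same_card)
    then show "(\<Sum>w | w \<in> carrier G \<and> act w x0 = x. F (act w x0)) = of_nat (card (stab x0)) * F x"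
      by simp
  qed
  also have "\<dots> = of_nat (card (stab x0)) * (\<Sum>x\<in>orb x0. F x)" by (simp add: sum_distrib_left)
  also have "(\<Sum>x\<in>orb x0. F x) = (\<Sum>x | x \<in> orb x0 \<and> act g x = x. c x g)"
    by (simp add: F_def sum.inter_filter[symmetric] orb_def finite_carrier)
  finally have *: "(\<Sum>w | w \<in> carrier G \<and> inv w \<otimes> g \<otimes> w \<in> stab x0. c x0 (inv w \<otimes> g \<otimes> w)) =
      of_nat (card (stab x0)) * (\<Sum>x | x \<in> orb x0 \<and> act g x = x. c x g)" .
  have "finite (stab x0)" "stab x0 \<noteq> {}"
    using finite_carrier subgroup_stab[OF x0] subgroup.one_closed by (auto simp: stab_def)
  then have "card (stab x0) \<noteq> 0" by simp
  then show ?thesis unfolding induced_character_def * by simp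
qed

lemma orb_act: assumes "x \<in> E" "w \<in> carrier G" shows "orb (act w x) = orb x"
proof
  have "act v (act w x) \<in> orb x" if "v \<in> carrier G" for v
    unfolding orb_def using that assms by (intro image_eqI[of _ _ "v \<otimes> w"]) (simp_all add: act_mult)
  then show "orb (act w x) \<subseteq> orb x" by (auto simp: orb_def)
  have "act v x \<in> orb (act w x)" if "v \<in> carrier G" for v
    unfolding orb_def using that assms
    by (intro image_eqI[of _ _ "v \<otimes> inv w"]) (simp_all add: act_mult act_closed act_inv)
  then show "orb x \<subseteq> orb (act w x)" by (auto simp: orb_def)
qed

text \<open>\<open>R\<close> lets the orbit representatives be chosen.\<close>

lemma trace_decomposition:
  assumes R: "\<And>x. x \<in> E \<Longrightarrow> \<exists>w\<in>carrier G. R (act w x)"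
  obtains D where "D \<subseteq> E" "\<And>y. y \<in> D \<Longrightarrow> R y"
    "\<And>g. g \<in> carrier G \<Longrightarrow>
      (\<Sum>x | x \<in> E \<and> act g x = x. c x g) = (\<Sum>y\<in>D. induced_character G (stab y) (c y) g)"
proof -
  have "\<exists>y. y \<in> E \<and> R y \<and> orb y = Y" if "Y \<in> orb ` E" for Y
  proof -
    obtain x where x: "x \<in> E" "Y = orb x" using \<open>Y \<in> orb ` E\<close> by blast
    obtain w where w: "w \<in> carrier G" "R (act w x)" using R[OF x(1)] by blast
    show ?thesis using orb_act[OF x(1) w(1)] act_closed[OF w(1) x(1)] w x by blast
  qed
  then have "\<forall>Y\<in>orb ` E. \<exists>y. y \<in> E \<and> R y \<and> orb y = Y" by blast
  from bchoice[OF this] obtain rep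
    where rep: "\<And>Y. Y \<in> orb ` E \<Longrightarrow> rep Y \<in> E \<and> R (rep Y) \<and> orb (rep Y) = Y"
    by blast
  have self: "x \<in> orb x" if "x \<in> E" for x
    unfolding orb_def using that by (intro image_eqI[of _ _ \<one>]) (simp_all add: act_one)
  have sub: "orb x \<subseteq> E" if "x \<in> E" for x using that by (auto simp: orb_def act_closed)
  have eq: "orb y = orb x" if x: "x \<in> E" and y: "y \<in> orb x" for x y
  proof -
    obtain w where "w \<in> carrier G" "y = act w x" using y unfolding orb_def by blast
    then show ?thesis using orb_act x by simp
  qed
  show thesis
  proof (rule that[of "rep ` orb ` E"])
    show "rep ` orb ` E \<subseteq> E" "\<And>y. y \<in> rep ` orb ` E \<Longrightarrow> R y" using rep by auto
    fix g assume g: "g \<in> carrier G"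
    define F where "F x = (if act g x = x then c x g else 0)" for x
    have "\<Union> (orb ` E) = E" using self sub by auto
    have "(\<Sum>x | x \<in> E \<and> act g x = x. c x g) = sum F (\<Union> (orb ` E))"
      using self sub by (simp add: F_def sum.inter_filter finite_E \<open>\<Union> (orb ` E) = E\<close>)
    also have "\<dots> = (\<Sum>Y\<in>orb ` E. sum F Y)"
    proof (subst sum.Union_disjoint)
      show "\<forall>Y\<in>orb ` E. \<forall>Z\<in>orb ` E. Y \<noteq> Z \<longrightarrow> Y \<inter> Z = {}"
      proof (intro ballI impI)
        fix Y Z assume Y: "Y \<in> orb ` E" and Z: "Z \<in> orb ` E" and "Y \<noteq> Z"
        then obtain x z where x: "x \<in> E" "Y = orb x" and z: "z \<in> E" "Z = orb z" by blast
        show "Y \<inter> Z = {}"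
        proof (rule ccontr)
          assume "Y \<inter> Z \<noteq> {}"
          then obtain y where "y \<in> orb x" "y \<in> orb z" using x z by blast
          then have "orb x = orb z" using eq[OF x(1)] eq[OF z(1)] by blast
          then show False using x z \<open>Y \<noteq> Z\<close> by simp
        qed
      qed
    qed (use finite_carrier in \<open>auto simp: orb_def\<close>)
    also have "\<dots> = (\<Sum>Y\<in>orb ` E. induced_character G (stab (rep Y)) (c (rep Y)) g)"
    proof (rule sum.cong[OF refl])
      fix Y assume Y: "Y \<in> orb ` E"
      have "sum F Y = (\<Sum>x | x \<in> orb (rep Y) \<and> act g x = x. c x g)"
        using rep[OF Y] Y finite_carrier by (auto simp: F_def sum.inter_filter[symmetric] orb_def)
      then show "sum F Y = induced_character G (stab (rep Y)) (c (rep Y)) g"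
        using trace_orb[of "rep Y" g] rep[OF Y] g by simp
    qed
    also have "\<dots> = (\<Sum>y\<in>rep ` orb ` E. induced_character G (stab y) (c y) g)"
      by (subst sum.reindex) (auto intro!: inj_on_inverseI[of _ orb] simp: rep)
    finally show "(\<Sum>x | x \<in> E \<and> act g x = x. c x g) =
      (\<Sum>y\<in>rep ` orb ` E. induced_character G (stab y) (c y) g)" .
  qed
qed

end

context group
begin

text \<open>Mackey's formula, from the action of \<open>Q\<close> on the right cosets of \<open>S\<close>.\<close>

lemma induced_character_restrict:
  assumes fin: "finite (carrier G)" and Q: "subgroup Q G" and S: "subgroup S G"
    and \<xi>: "\<And>s t. s \<in> S \<Longrightarrow> t \<in> S \<Longrightarrow> \<xi> (s \<otimes> t \<otimes> inv s) = \<xi> t"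
    and R: "\<And>w. w \<in> carrier G \<Longrightarrow> \<exists>q\<in>Q. R (w \<otimes> q)"
  obtains D where "finite D" "D \<subseteq> carrier G" "\<And>w. w \<in> D \<Longrightarrow> R w"
    "\<And>g. g \<in> Q \<Longrightarrow> induced_character G S \<xi> g = (\<Sum>w\<in>D. induced_character (G\<lparr>carrier := Q\<rparr>)
      {q \<in> Q. w \<otimes> q \<otimes> inv w \<in> S} (\<lambda>q. \<xi> (w \<otimes> q \<otimes> inv w)) g)"
proof -
  interpret Q: group "G\<lparr>carrier := Q\<rparr>" using Q subgroup_imp_group by blast
  have Qc: "q \<in> carrier G" if "q \<in> Q" for q using that Q subgroup.mem_carrier by metis
  have Sc: "q \<in> carrier G" if "q \<in> S" for q using that S subgroup.mem_carrier by metis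
  have finQ: "finite Q" using fin Qc by (meson finite_subset subsetI)
  have finS: "finite S" using fin Sc by (meson finite_subset subsetI)
  have Ssub: "S \<subseteq> carrier G" using Sc by blast
  define F where "F z = (if z \<in> S then \<xi> z else 0)" for z
  \<comment> \<open>The inverse turns right multiplication of cosets into a left action.\<close>
  define act where "act q C = C #> inv q" for q C
  \<comment> \<open>Averaging over the coset avoids the choice of a representative; by
    \<open>c_coset\<close> every representative w gives the value F(w g w^-1).\<close>
  define c where "c C g = (\<Sum>w\<in>C. F (w \<otimes> g \<otimes> inv w)) / of_nat (card S)" for C g
  have Cc: "C \<subseteq> carrier G" if "C \<in> rcosets S" for C
    using that Ssub rcosets_part_G[OF S] by auto
  have F_inv: "F (s \<otimes> z \<otimes> inv s) = F z" if s: "s \<in> S" and z: "z \<in> carrier G" for s z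
  proof -
    have "z = inv s \<otimes> (s \<otimes> z \<otimes> inv s) \<otimes> s"
      using Sc[OF s] z by (simp add: m_assoc inv_solve_left)
    then have "s \<otimes> z \<otimes> inv s \<in> S \<longleftrightarrow> z \<in> S"
      using s S by (metis subgroup.m_closed subgroup.m_inv_closed)
    then show ?thesis using \<xi>[OF s] by (auto simp: F_def)
  qed
  have c_coset: "c (S #> w) g = F (w \<otimes> g \<otimes> inv w)" if w: "w \<in> carrier G" and g: "g \<in> carrier G" for w g
  proof -
    have "(\<Sum>v\<in>S #> w. F (v \<otimes> g \<otimes> inv v)) = (\<Sum>s\<in>S. F (w \<otimes> g \<otimes> inv w))"
    proof (rule sum.reindex_bij_witness[of _ "\<lambda>s. s \<otimes> w" "\<lambda>v. v \<otimes> inv w"])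
      fix v assume "v \<in> S #> w"
      then obtain s where s: "s \<in> S" "v = s \<otimes> w" by (auto simp: r_coset_def)
      show "v \<otimes> inv w \<otimes> w = v" "v \<otimes> inv w \<in> S" using s w Sc by (auto simp: m_assoc)
      have "v \<otimes> g \<otimes> inv v = s \<otimes> (w \<otimes> g \<otimes> inv w) \<otimes> inv s"
        using s w g Sc by (simp add: m_assoc inv_mult_group)
      then show "F (w \<otimes> g \<otimes> inv w) = F (v \<otimes> g \<otimes> inv v)"
        using F_inv[OF s(1)] w g by simp
    qed (use w Sc in \<open>auto simp: m_assoc r_coset_def\<close>)
    moreover have "card S \<noteq> 0" using finS subgroup.one_closed[OF S] by auto
    ultimately show ?thesis by (simp add: c_def)
  qed
  have act_coset: "act q (S #> w) = S #> (w \<otimes> inv q)" if "w \<in> carrier G" "q \<in> carrier G" for w q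
    using that Ssub by (simp add: act_def coset_mult_assoc)
  have cos_eq: "S #> v = S #> w \<longleftrightarrow> v \<otimes> inv w \<in> S" if "v \<in> carrier G" "w \<in> carrier G" for v w
  proof
    assume "S #> v = S #> w"
    then have "v \<in> S #> w" using rcos_self[OF that(1) S] by simp
    then show "v \<otimes> inv w \<in> S" using that Sc by (auto simp: r_coset_def m_assoc)
  next
    assume "v \<otimes> inv w \<in> S"
    then have "v \<in> S #> w"
      using that by (auto simp: r_coset_def m_assoc intro!: bexI[of _ "v \<otimes> inv w"])
    then show "S #> v = S #> w" using repr_independence[OF _ that(2) S] by simp
  qed
  have fix_iff: "act q (S #> w) = S #> w \<longleftrightarrow> w \<otimes> q \<otimes> inv w \<in> S" if "w \<in> carrier G" "q \<in> carrier G" for w q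
  proof -
    have "w \<otimes> inv q \<otimes> inv w = inv (w \<otimes> q \<otimes> inv w)"
      using that by (simp add: inv_mult_group m_assoc)
    moreover have "inv z \<in> S \<longleftrightarrow> z \<in> S" if "z \<in> carrier G" for z
      using that S by (metis inv_inv subgroup.m_inv_closed)
    ultimately show ?thesis using that by (simp add: act_coset cos_eq)
  qed
  have ex: "\<exists>w\<in>carrier G. C = S #> w" if "C \<in> rcosets S" for C
    using that by (auto simp: RCOSETS_def)
  have "monomial_action (G\<lparr>carrier := Q\<rparr>) (rcosets S) act c"
  proof (intro monomial_action.intro monomial_action_axioms.intro)
    show "group (G\<lparr>carrier := Q\<rparr>)" by (rule Q.group_axioms)
    show "finite (carrier (G\<lparr>carrier := Q\<rparr>))" using finQ by simp
    show "finite (rcosets S)" using fin by (simp add: RCOSETS_def)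
    fix C assume C: "C \<in> rcosets S"
    then obtain w where w: "w \<in> carrier G" "C = S #> w" using ex by blast
    show "act \<one>\<^bsub>G\<lparr>carrier := Q\<rparr>\<^esub> C = C" using w by (simp add: act_coset)
    fix g assume "g \<in> carrier (G\<lparr>carrier := Q\<rparr>)"
    then have g: "g \<in> Q" by simp
    show "act g C \<in> rcosets S" using w g Qc Ssub by (simp add: act_coset rcosetsI)
    fix h assume "h \<in> carrier (G\<lparr>carrier := Q\<rparr>)"
    then have h: "h \<in> Q" by simp
    show "act (g \<otimes>\<^bsub>G\<lparr>carrier := Q\<rparr>\<^esub> h) C = act g (act h C)"
      using w g h Qc by (simp add: act_coset inv_mult_group m_assoc)
    assume "act h C = C"
    have "c (act g C) (g \<otimes> h \<otimes> inv g) = F (w \<otimes> inv g \<otimes> (g \<otimes> h \<otimes> inv g) \<otimes> inv (w \<otimes> inv g))"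
      using w g h Qc by (simp add: act_coset c_coset)
    also have "w \<otimes> inv g \<otimes> (g \<otimes> h \<otimes> inv g) \<otimes> inv (w \<otimes> inv g) = w \<otimes> (inv g \<otimes> g) \<otimes> h \<otimes> (inv g \<otimes> g) \<otimes> inv w"
      using w Qc[OF g] Qc[OF h] by (simp only: m_assoc inv_mult_group inv_closed inv_inv m_closed)
    also have "\<dots> = w \<otimes> h \<otimes> inv w" using w Qc[OF g] Qc[OF h] by simp
    finally show "c (act g C) (g \<otimes>\<^bsub>G\<lparr>carrier := Q\<rparr>\<^esub> h \<otimes>\<^bsub>G\<lparr>carrier := Q\<rparr>\<^esub> inv\<^bsub>G\<lparr>carrier := Q\<rparr>\<^esub> g) = c C h"
      using w h Qc Q g by (simp add: c_coset)
  qed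
  then interpret M: monomial_action "G\<lparr>carrier := Q\<rparr>" "rcosets S" act c .
  define R' where "R' C \<longleftrightarrow> (\<exists>w\<in>carrier G. C = S #> w \<and> R w)" for C
  have exR: "\<exists>q\<in>carrier (G\<lparr>carrier := Q\<rparr>). R' (act q C)" if C: "C \<in> rcosets S" for C
  proof -
    obtain w where w: "w \<in> carrier G" "C = S #> w" using ex[OF C] by blast
    obtain q where q: "q \<in> Q" "R (w \<otimes> q)" using R[OF w(1)] by blast
    \<comment> \<open>\<open>act (inv q)\<close> multiplies the coset on the right by q, which
      matches the form of the hypothesis on \<open>R\<close>.\<close>
    have "R' (act (inv q) C)"
      unfolding R'_def using w q Qc[OF q(1)] by (intro bexI[of _ "w \<otimes> q"]) (simp_all add: act_coset)
    moreover have "inv q \<in> carrier (G\<lparr>carrier := Q\<rparr>)"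
      using q subgroup.m_inv_closed[OF Q] by simp
    ultimately show ?thesis by blast
  qed
  obtain D where D: "D \<subseteq> rcosets S" "\<And>C. C \<in> D \<Longrightarrow> R' C"
    "\<And>g. g \<in> carrier (G\<lparr>carrier := Q\<rparr>) \<Longrightarrow> (\<Sum>C | C \<in> rcosets S \<and> act g C = C. c C g) =
      (\<Sum>C\<in>D. induced_character (G\<lparr>carrier := Q\<rparr>) (M.stab C) (c C) g)"
    by (rule M.trace_decomposition[OF exR]) (assumption, rule that)
  have "\<forall>C\<in>D. \<exists>w. w \<in> carrier G \<and> C = S #> w \<and> R w" using D(2) unfolding R'_def by blast
  from bchoice[OF this] obtain r
    where r: "\<And>C. C \<in> D \<Longrightarrow> r C \<in> carrier G \<and> C = S #> r C \<and> R (r C)" by blast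
  have finD: "finite D" using D(1) M.finite_E finite_subset by blast
  show thesis
  proof (rule that[of "r ` D"])
    show "finite (r ` D)" using finD by simp
    show "r ` D \<subseteq> carrier G" "\<And>w. w \<in> r ` D \<Longrightarrow> R w" using r by auto
    fix g assume g: "g \<in> Q"
    have "induced_character G S \<xi> g = (\<Sum>w\<in>carrier G. F (w \<otimes> g \<otimes> inv w)) / of_nat (card S)"
      by (simp add: induced_character_alt[OF fin] F_def)
    also have "\<dots> = (\<Sum>w\<in>\<Union> (rcosets S). F (w \<otimes> g \<otimes> inv w)) / of_nat (card S)"
      using rcosets_part_G[OF S] by simp
    also have "\<dots> = (\<Sum>C\<in>rcosets S. \<Sum>w\<in>C. F (w \<otimes> g \<otimes> inv w)) / of_nat (card S)"
    proof (subst sum.Union_disjoint)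
      show "\<forall>C\<in>rcosets S. finite C" using Cc fin finite_subset by blast
      show "\<forall>C\<in>rcosets S. \<forall>D\<in>rcosets S. C \<noteq> D \<longrightarrow> C \<inter> D = {}"
        using rcos_disjoint[OF S] by (simp add: pairwise_def disjnt_def)
    qed simp
    also have "\<dots> = (\<Sum>C\<in>rcosets S. c C g)" by (simp add: c_def sum_divide_distrib)
    \<comment> \<open>If g does not fix the coset of w, then w g w^-1 is outside \<open>S\<close>
      and the scalar is 0.\<close>
    also have "\<dots> = (\<Sum>C | C \<in> rcosets S \<and> act g C = C. c C g)"
    proof (rule sum.mono_neutral_right)
      show "\<forall>C\<in>rcosets S - {C \<in> rcosets S. act g C = C}. c C g = 0"
      proof
        fix C assume C: "C \<in> rcosets S - {C \<in> rcosets S. act g C = C}"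
        then obtain w where w: "w \<in> carrier G" "C = S #> w" using ex by blast
        then show "c C g = 0" using C fix_iff[OF w(1) Qc[OF g]] Qc[OF g] by (simp add: c_coset F_def)
      qed
    qed (use M.finite_E in auto)
    also have "\<dots> = (\<Sum>C\<in>D. induced_character (G\<lparr>carrier := Q\<rparr>) (M.stab C) (c C) g)"
      using D(3) g by simp
    also have "\<dots> = (\<Sum>C\<in>D. induced_character (G\<lparr>carrier := Q\<rparr>)
      {q \<in> Q. r C \<otimes> q \<otimes> inv (r C) \<in> S} (\<lambda>q. \<xi> (r C \<otimes> q \<otimes> inv (r C))) g)"
    proof (rule sum.cong[OF refl])
      fix C assume C: "C \<in> D"
      have rC: "r C \<in> carrier G" "S #> r C = C" using r[OF C] by auto
      have fx: "act q C = C \<longleftrightarrow> r C \<otimes> q \<otimes> inv (r C) \<in> S" if "q \<in> Q" for q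
        using fix_iff[OF rC(1) Qc[OF that]] unfolding rC(2) .
      have cC: "c C q = F (r C \<otimes> q \<otimes> inv (r C))" if "q \<in> Q" for q
        using c_coset[OF rC(1) Qc[OF that]] unfolding rC(2) .
      have st: "M.stab C = {q \<in> Q. r C \<otimes> q \<otimes> inv (r C) \<in> S}"
        unfolding M.stab_def by (simp add: fx cong: conj_cong)
      have "c C q = \<xi> (r C \<otimes> q \<otimes> inv (r C))" if "q \<in> M.stab C" for q
        using that cC unfolding st by (simp add: F_def)
      then show "induced_character (G\<lparr>carrier := Q\<rparr>) (M.stab C) (c C) g =
        induced_character (G\<lparr>carrier := Q\<rparr>)
        {q \<in> Q. r C \<otimes> q \<otimes> inv (r C) \<in> S} (\<lambda>q. \<xi> (r C \<otimes> q \<otimes> inv (r C))) g"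
        unfolding st by (intro induced_character_cong) auto
    qed
    also have "\<dots> = (\<Sum>w\<in>r ` D. induced_character (G\<lparr>carrier := Q\<rparr>)
      {q \<in> Q. w \<otimes> q \<otimes> inv w \<in> S} (\<lambda>q. \<xi> (w \<otimes> q \<otimes> inv w)) g)"
      by (subst sum.reindex) (auto intro!: inj_on_inverseI[of _ "\<lambda>w. S #> w"] simp: r[THEN conjunct2, THEN conjunct1, symmetric])
    finally show "induced_character G S \<xi> g = \<dots>" .
  qed
qed

end

section \<open>Linear characters of finite abelian groups\<close>

text \<open>The notion of \<open>linear_character\<close> for an arbitrary group record, so that it
  applies also to subgroups of \<open>H\<close> regarded as groups of their own.\<close>

definition character_on :: "('g, 'b) monoid_scheme \<Rightarrow> 'g set \<Rightarrow> ('g \<Rightarrow> complex) \<Rightarrow> bool"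
  where "character_on G K \<theta> \<longleftrightarrow>
    (\<forall>h\<in>K. \<theta> h \<noteq> 0) \<and> (\<forall>g\<in>K. \<forall>h\<in>K. \<theta> (g \<otimes>\<^bsub>G\<^esub> h) = \<theta> g * \<theta> h)"

context comm_group
begin

lemma character_on_one:
  assumes "subgroup K G" "character_on G K \<theta>" shows "\<theta> \<one> = 1"
proof -
  have "\<one> \<in> K" using assms subgroup.one_closed by blast
  then have "\<theta> \<one> * \<theta> \<one> = \<theta> \<one>" "\<theta> \<one> \<noteq> 0"
    using assms(2) unfolding character_on_def by (metis l_one one_closed, blast)
  then show ?thesis by simp
qed

text \<open>Let n > 0 be least with h^n in \<open>K\<close>. An extension has to send k h^i to
  \<theta>(k) z^i for an n-th root z of \<theta>(h^n). As \<open>h\<close> is outside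
  \<open>K\<close>, n is at least 2 and a root other than 1 exists; the resulting clause on the
  value at \<open>h\<close> is what later separates \<open>h\<close> from \<open>K\<close>.\<close>

lemma character_adjoin:
  assumes fin: "finite (carrier G)" and K: "subgroup K G" and \<theta>: "character_on G K \<theta>"
    and h: "h \<in> carrier G" "h \<notin> K"
  shows "\<exists>L \<theta>'. subgroup L G \<and> K \<subseteq> L \<and> h \<in> L \<and> character_on G L \<theta>' \<and>
    (\<forall>k\<in>K. \<theta>' k = \<theta> k) \<and> \<theta>' h \<noteq> 1"
proof -
  have Kc: "k \<in> carrier G" if "k \<in> K" for k using that K subgroup.mem_carrier by metis
  have K1: "\<one> \<in> K" using K subgroup.one_closed by blast
  have Km: "k \<otimes> l \<in> K" if "k \<in> K" "l \<in> K" for k l using that K subgroup.m_closed by metis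
  have Ki: "inv k \<in> K" if "k \<in> K" for k using that K subgroup.m_inv_closed by metis
  have mult: "\<theta> (k \<otimes> l) = \<theta> k * \<theta> l" if "k \<in> K" "l \<in> K" for k l
    using that \<theta> unfolding character_on_def by blast
  have nz: "\<theta> k \<noteq> 0" if "k \<in> K" for k using that \<theta> unfolding character_on_def by blast
  have pc: "h [^] (i::nat) \<in> carrier G" for i using h by simp
  define n where "n = (LEAST n::nat. 0 < n \<and> h [^] n \<in> K)"
  have "0 < order G \<and> h [^] order G \<in> K"
    using fin h K1 by (simp add: pow_order_eq_1 order_gt_0_iff_finite)
  then have n: "0 < n" "h [^] n \<in> K"
    unfolding n_def by (metis (mono_tags, lifting) LeastI)+
  have "n \<noteq> 1" using n(2) h by auto
  then have n2: "n \<ge> 2" using n(1) by simp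
  have least: "m = 0" if "m < n" "h [^] m \<in> K" for m
    using that not_less_Least[of m "\<lambda>n. 0 < n \<and> h [^] n \<in> K"] unfolding n_def by auto
  have pow_mult: "h [^] (n * q) \<in> K" for q
    by (induction q) (use n K1 h in \<open>auto simp: nat_pow_mult[symmetric] algebra_simps intro: Km\<close>)
  have n_dvd: "n dvd m" if m: "h [^] m \<in> K" for m
  proof -
    have "h [^] m = h [^] (n * (m div n)) \<otimes> h [^] (m mod n)"
      using h by (simp add: nat_pow_mult)
    then have "h [^] (m mod n) = inv (h [^] (n * (m div n))) \<otimes> h [^] m"
      using pc by (metis inv_solve_left)
    then have "h [^] (m mod n) \<in> K" using m pow_mult Km Ki by simp
    then have "m mod n = 0" using least n(1) by simp
    then show ?thesis by auto
  qed
  \<comment> \<open>There are n distinct roots because \<theta>(h^n) is nonzero; with n at least 2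
    they cannot all be 1.\<close>
  have "card {z::complex. z ^ n = \<theta> (h [^] n)} = n"
    using n nz by (intro card_nth_roots) auto
  then have "\<not> {z::complex. z ^ n = \<theta> (h [^] n)} \<subseteq> {1}"
    using n2 by (metis card.empty card.insert card_mono empty_iff finite.emptyI finite_insert
        not_less_eq_eq numeral_2_eq_2 order_trans One_nat_def)
  then obtain z where z: "z ^ n = \<theta> (h [^] n)" "z \<noteq> 1" by blast
  have \<theta>_pow: "\<theta> (h [^] (n * q)) = z ^ (n * q)" for q
  proof (induction q)
    case 0
    show ?case using character_on_one[OF K \<theta>] by simp
  next
    case (Suc q)
    have "h [^] (n * Suc q) = h [^] n \<otimes> h [^] (n * q)" using h by (simp add: nat_pow_mult)
    then show ?case using Suc n pow_mult by (simp add: mult power_add z)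
  qed
  have zn: "z \<noteq> 0" using z n nz by (metis zero_power)
  \<comment> \<open>Two expressions of one element force h^(j - i) into \<open>K\<close>. Then n
    divides j - i, so \<theta> takes the value z^(j - i) there.\<close>
  have wd_le: "\<theta> k * z ^ i = \<theta> l * z ^ j"
    if kl: "k \<in> K" "l \<in> K" and e: "k \<otimes> h [^] i = l \<otimes> h [^] j" and ij: "i \<le> j" for k l i j
  proof -
    have "l \<otimes> h [^] j = (l \<otimes> h [^] (j - i)) \<otimes> h [^] i"
      using kl Kc h ij by (simp add: m_assoc nat_pow_mult)
    then have k: "k = l \<otimes> h [^] (j - i)" using e kl Kc pc by simp
    then have "h [^] (j - i) = inv l \<otimes> k" using kl Kc pc by (simp add: inv_solve_left)
    then have hK: "h [^] (j - i) \<in> K" using kl Km Ki by simp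
    then obtain q where "j - i = n * q" using n_dvd by (meson dvdE)
    then have "\<theta> (h [^] (j - i)) = z ^ (j - i)" using \<theta>_pow by simp
    then have "\<theta> k = \<theta> l * z ^ (j - i)" using k mult kl hK by simp
    then show ?thesis using ij by (simp add: power_add[symmetric])
  qed
  have wd: "\<theta> k * z ^ i = \<theta> l * z ^ j"
    if "k \<in> K" "l \<in> K" "k \<otimes> h [^] i = l \<otimes> h [^] j" for k l i j
    using wd_le[of k l i j] wd_le[of l k j i] that by (metis nat_le_linear)
  define L where "L = {k \<otimes> h [^] (i::nat) | k i. k \<in> K}"
  define \<theta>' where "\<theta>' x = (SOME v. \<exists>k\<in>K. \<exists>i::nat. x = k \<otimes> h [^] i \<and> v = \<theta> k * z ^ i)" for x
  have \<theta>': "\<theta>' (k \<otimes> h [^] i) = \<theta> k * z ^ i" if "k \<in> K" for k and i :: nat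
    unfolding \<theta>'_def
  proof (rule some_equality)
    show "\<exists>ka\<in>K. \<exists>ia. k \<otimes> h [^] i = ka \<otimes> h [^] ia \<and> \<theta> k * z ^ i = \<theta> ka * z ^ ia" using that by blast
    fix v assume "\<exists>ka\<in>K. \<exists>ia. k \<otimes> h [^] i = ka \<otimes> h [^] ia \<and> v = \<theta> ka * z ^ ia"
    then obtain l j where "l \<in> K" "k \<otimes> h [^] i = l \<otimes> h [^] j" "v = \<theta> l * z ^ j" by blast
    then show "v = \<theta> k * z ^ i" using wd[OF that, of l i j] by simp
  qed
  have prod: "(k \<otimes> h [^] i) \<otimes> (l \<otimes> h [^] j) = (k \<otimes> l) \<otimes> h [^] (i + j)"
    if "k \<in> K" "l \<in> K" for k l and i j :: nat
    using that Kc pc by (simp add: nat_pow_mult[symmetric] h m_ac)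
  show ?thesis
  proof (intro exI conjI)
    show sub: "K \<subseteq> L"
    proof
      fix k assume "k \<in> K"
      then have "k = k \<otimes> h [^] (0::nat)" using Kc by simp
      then show "k \<in> L" unfolding L_def using \<open>k \<in> K\<close> by blast
    qed
    show "h \<in> L" unfolding L_def using K1 h by (auto intro!: exI[of _ \<one>] exI[of _ "1::nat"])
    show "subgroup L G"
    proof (rule finite_mult_closed_subgroup[OF fin])
      show "L \<subseteq> carrier G" unfolding L_def using Kc pc by auto
      show "L \<noteq> {}" using sub K1 by blast
      fix x y assume "x \<in> L" "y \<in> L"
      then obtain k l i j where "k \<in> K" "l \<in> K" "x = k \<otimes> h [^] (i::nat)" "y = l \<otimes> h [^] (j::nat)"
        unfolding L_def by blast
      then show "x \<otimes> y \<in> L" unfolding L_def using prod Km by blast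
    qed
    show "character_on G L \<theta>'"
      unfolding character_on_def
    proof (intro conjI ballI)
      fix x assume "x \<in> L"
      then obtain k i where x: "k \<in> K" "x = k \<otimes> h [^] (i::nat)" unfolding L_def by blast
      then show "\<theta>' x \<noteq> 0" using \<theta>' zn nz by simp
      fix y assume "y \<in> L"
      then obtain l j where y: "l \<in> K" "y = l \<otimes> h [^] (j::nat)" unfolding L_def by blast
      show "\<theta>' (x \<otimes> y) = \<theta>' x * \<theta>' y"
        using x y by (simp add: prod \<theta>' Km mult power_add)
    qed
    show "\<forall>k\<in>K. \<theta>' k = \<theta> k"
    proof
      fix k assume "k \<in> K"
      then show "\<theta>' k = \<theta> k" using \<theta>'[of k 0] Kc by simp
    qed
    show "\<theta>' h \<noteq> 1" using \<theta>'[OF K1, of 1] h z character_on_one[OF K \<theta>] by simp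
  qed
qed

text \<open>Take a subgroup of largest order to which the character extends; adjoining one more
  element would contradict the choice.\<close>

lemma character_extend:
  assumes fin: "finite (carrier G)" and K: "subgroup K G" and \<theta>: "character_on G K \<theta>"
  shows "\<exists>\<theta>'. character_on G (carrier G) \<theta>' \<and> (\<forall>k\<in>K. \<theta>' k = \<theta> k)"
proof -
  define P where "P L \<longleftrightarrow> subgroup L G \<and> K \<subseteq> L \<and>
    (\<exists>\<theta>'. character_on G L \<theta>' \<and> (\<forall>k\<in>K. \<theta>' k = \<theta> k))" for L
  have "P K" using K \<theta> unfolding P_def by blast
  moreover have "card L < Suc (card (carrier G))" if "P L" for L
    using that fin subgroup.subset[of L G] unfolding P_def by (simp add: card_mono less_Suc_eq_le)
  ultimately obtain L where L: "P L" "\<And>M. P M \<Longrightarrow> card M \<le> card L"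
    using ex_has_greatest_nat[of P K card] by (metis less_imp_le_nat)
  then obtain \<theta>' where \<theta>': "character_on G L \<theta>'" "\<forall>k\<in>K. \<theta>' k = \<theta> k"
    unfolding P_def by blast
  have Ls: "subgroup L G" using L(1) P_def by blast
  have "L = carrier G"
  proof (rule ccontr)
    assume "L \<noteq> carrier G"
    then obtain h where h: "h \<in> carrier G" "h \<notin> L" using subgroup.subset[OF Ls] by blast
    from character_adjoin[OF fin Ls \<theta>'(1) h] obtain M \<psi> where
      M: "subgroup M G" "L \<subseteq> M" "h \<in> M" "character_on G M \<psi>" "\<forall>k\<in>L. \<psi> k = \<theta>' k"
      by blast
    have "K \<subseteq> L" using L(1) P_def by blast
    then have "P M" unfolding P_def using M \<theta>' by (intro conjI exI[of _ \<psi>]) auto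
    moreover have "card L < card M"
      using M h finite_subset[OF subgroup.subset[OF M(1)] fin] by (intro psubset_card_mono) auto
    ultimately show False using L(2)[of M] by simp
  qed
  then show ?thesis using \<theta>' by blast
qed

text \<open>The value 0 outside the group makes each extension one definite function, so that the
  set is finite and can be summed over.\<close>

definition extensions :: "'a set \<Rightarrow> ('a \<Rightarrow> complex) \<Rightarrow> ('a \<Rightarrow> complex) set" where
  "extensions K \<theta> = {\<psi>. character_on G (carrier G) \<psi> \<and> (\<forall>x. x \<notin> carrier G \<longrightarrow> \<psi> x = 0) \<and>
    (\<forall>k\<in>K. \<psi> k = \<theta> k)}"

text \<open>All values on the group are roots of unity of order dividing the group order.\<close>

lemma finite_extensions:
  assumes fin: "finite (carrier G)" shows "finite (extensions K \<theta>)"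
proof (rule finite_subset)
  have n: "order G > 0" using fin by (simp add: order_gt_0_iff_finite)
  show "finite {f. \<forall>x. (x \<in> carrier G \<longrightarrow> f x \<in> {z::complex. z ^ order G = 1}) \<and>
      (x \<notin> carrier G \<longrightarrow> f x = 0)}"
    using fin n by (intro finite_set_of_finite_funs finite_roots_unity) auto
  have "\<psi> x ^ order G = 1" if \<psi>: "character_on G (carrier G) \<psi>" and x: "x \<in> carrier G" for \<psi> x
  proof -
    have "\<psi> (x [^] m) = \<psi> x ^ m" for m :: nat
      by (induction m) (use \<psi> x character_on_one[OF subgroup_self \<psi>] in
          \<open>auto simp: character_on_def\<close>)
    then show ?thesis
      using x fin character_on_one[OF subgroup_self \<psi>] by (metis pow_order_eq_1)
  qed
  then show "extensions K \<theta> \<subseteq> {f. \<forall>x. (x \<in> carrier G \<longrightarrow> f x \<in> {z::complex. z ^ order G = 1}) \<and>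
      (x \<notin> carrier G \<longrightarrow> f x = 0)}"
    unfolding extensions_def by auto
qed

lemma sum_character:
  assumes \<psi>: "character_on G (carrier G) \<psi>" and h: "h \<in> carrier G" "\<psi> h \<noteq> 1"
  shows "(\<Sum>x\<in>carrier G. \<psi> x) = 0"
proof -
  have "(\<Sum>x\<in>carrier G. \<psi> x) = (\<Sum>x\<in>carrier G. \<psi> (h \<otimes> x))"
    by (rule sum.reindex_bij_witness[of _ "\<lambda>x. h \<otimes> x" "\<lambda>x. inv h \<otimes> x"])
      (use h in \<open>auto simp: m_assoc[symmetric]\<close>)
  also have "\<dots> = \<psi> h * (\<Sum>x\<in>carrier G. \<psi> x)"
    using \<psi> h by (simp add: character_on_def sum_distrib_left)
  finally have "(1 - \<psi> h) * (\<Sum>x\<in>carrier G. \<psi> x) = 0" by (simp add: algebra_simps)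
  then show ?thesis using h by simp
qed

text \<open>Multiplication by a character that is trivial on \<open>K\<close> but not at
  \<open>h\<close> permutes the extensions and scales the sum by a factor other than 1.\<close>

lemma sum_extensions_outside:
  assumes fin: "finite (carrier G)" and K: "subgroup K G" and h: "h \<in> carrier G" "h \<notin> K"
  shows "(\<Sum>\<psi>\<in>extensions K \<theta>. \<psi> h) = 0"
proof -
  have "character_on G K (\<lambda>_. 1)" by (simp add: character_on_def)
  from character_adjoin[OF fin K this h] obtain L \<eta>
    where L: "subgroup L G" "K \<subseteq> L" "h \<in> L" "character_on G L \<eta>"
    "\<forall>k\<in>K. \<eta> k = 1" "\<eta> h \<noteq> 1"
    by blast
  from character_extend[OF fin L(1,4)] obtain \<phi>
    where \<phi>: "character_on G (carrier G) \<phi>" "\<forall>k\<in>L. \<phi> k = \<eta> k"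
    by blast
  have \<phi>K: "\<phi> k = 1" if "k \<in> K" for k using that L \<phi> by auto
  have \<phi>h: "\<phi> h \<noteq> 1" using L \<phi> by auto
  have nz: "\<phi> x \<noteq> 0" if "x \<in> carrier G" for x using that \<phi>(1) by (simp add: character_on_def)
  have "(\<Sum>\<psi>\<in>extensions K \<theta>. \<psi> h) = (\<Sum>\<psi>\<in>extensions K \<theta>. \<phi> h * \<psi> h)"
  proof (rule sum.reindex_bij_witness[of _ "\<lambda>\<psi> x. \<phi> x * \<psi> x" "\<lambda>\<psi> x. \<psi> x / \<phi> x"])
    fix \<psi> assume \<psi>: "\<psi> \<in> extensions K \<theta>"
    show "(\<lambda>x. \<phi> x * (\<psi> x / \<phi> x)) = \<psi>" "(\<lambda>x. \<phi> x * \<psi> x / \<phi> x) = \<psi>"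
      using \<psi> nz by (auto simp: extensions_def fun_eq_iff)
    show "(\<lambda>x. \<psi> x / \<phi> x) \<in> extensions K \<theta>" "(\<lambda>x. \<phi> x * \<psi> x) \<in> extensions K \<theta>"
      using \<psi> nz \<phi>(1) \<phi>K by (auto simp: extensions_def character_on_def)
    show "\<phi> h * (\<psi> h / \<phi> h) = \<psi> h" using nz h by simp
  qed
  also have "\<dots> = \<phi> h * (\<Sum>\<psi>\<in>extensions K \<theta>. \<psi> h)" by (simp add: sum_distrib_left)
  finally have "(1 - \<phi> h) * (\<Sum>\<psi>\<in>extensions K \<theta>. \<psi> h) = 0" by (simp add: algebra_simps)
  then show ?thesis using \<phi>h by simp
qed

text \<open>For an abelian group, inducing a linear character gives the sum of all its extensions.
  Only their number is missing; it comes from evaluating the double sum of \<psi>(x)/\<phi>(x), for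
  a fixed extension \<phi>, in both orders, where orthogonality leaves only \<psi> = \<phi>.\<close>

lemma sum_extensions:
  assumes fin: "finite (carrier G)" and K: "subgroup K G" and \<theta>: "character_on G K \<theta>"
    and h: "h \<in> carrier G"
  shows "(\<Sum>\<psi>\<in>extensions K \<theta>. \<psi> h) =
    (if h \<in> K then of_nat (order G) / of_nat (card K) * \<theta> h else 0)"
proof -
  obtain \<phi>' where \<phi>': "character_on G (carrier G) \<phi>'" "\<forall>k\<in>K. \<phi>' k = \<theta> k"
    using character_extend[OF fin K \<theta>] by blast
  define \<phi> where "\<phi> x = (if x \<in> carrier G then \<phi>' x else 0)" for x
  have Kc: "k \<in> carrier G" if "k \<in> K" for k using that K subgroup.mem_carrier by metis
  have \<phi>: "\<phi> \<in> extensions K \<theta>"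
    using \<phi>' Kc by (auto simp: extensions_def character_on_def \<phi>_def)
  have nz: "\<phi> x \<noteq> 0" if "x \<in> carrier G" for x
    using that \<phi> by (simp add: extensions_def character_on_def)
  have \<phi>K: "\<psi> k = \<phi> k" if "k \<in> K" "\<psi> \<in> extensions K \<theta>" for k \<psi>
    using that \<phi> by (simp add: extensions_def)
  have "(\<Sum>\<psi>\<in>extensions K \<theta>. \<Sum>x\<in>carrier G. \<psi> x / \<phi> x) =
    (\<Sum>\<psi>\<in>extensions K \<theta>. if \<psi> = \<phi> then of_nat (order G) else 0)"
  proof (rule sum.cong[OF refl])
    fix \<psi> assume \<psi>: "\<psi> \<in> extensions K \<theta>"
    show "(\<Sum>x\<in>carrier G. \<psi> x / \<phi> x) = (if \<psi> = \<phi> then of_nat (order G) else 0)"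
    proof (cases "\<psi> = \<phi>")
      case True
      then show ?thesis using nz by (simp add: order_def)
    next
      case False
      then obtain x where x: "\<psi> x \<noteq> \<phi> x" by blast
      have xc: "x \<in> carrier G"
      proof (rule ccontr)
        assume "x \<notin> carrier G"
        then show False using x \<psi> \<phi> by (simp add: extensions_def)
      qed
      moreover have "character_on G (carrier G) (\<lambda>x. \<psi> x / \<phi> x)"
        using \<psi> \<phi> by (auto simp: extensions_def character_on_def)
      ultimately have "(\<Sum>x\<in>carrier G. \<psi> x / \<phi> x) = 0"
        using x nz[OF xc] by (intro sum_character[of _ x]) auto
      then show ?thesis using False by simp
    qed
  qed
  also have "\<dots> = of_nat (order G)"
    using \<phi> finite_extensions[OF fin] by simp
  finally have 1: "(\<Sum>\<psi>\<in>extensions K \<theta>. \<Sum>x\<in>carrier G. \<psi> x / \<phi> x) = of_nat (order G)" .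
  have "(\<Sum>\<psi>\<in>extensions K \<theta>. \<Sum>x\<in>carrier G. \<psi> x / \<phi> x) =
      (\<Sum>x\<in>carrier G. \<Sum>\<psi>\<in>extensions K \<theta>. \<psi> x / \<phi> x)"
    by (rule sum.swap)
  \<comment> \<open>For x outside \<open>K\<close> the extensions sum to 0; inside \<open>K\<close>
    every quotient is 1.\<close>
  also have "\<dots> = (\<Sum>x\<in>carrier G. if x \<in> K then of_nat (card (extensions K \<theta>)) else 0)"
  proof (rule sum.cong[OF refl])
    fix x assume x: "x \<in> carrier G"
    show "(\<Sum>\<psi>\<in>extensions K \<theta>. \<psi> x / \<phi> x) = (if x \<in> K then of_nat (card (extensions K \<theta>)) else 0)"
    proof (cases "x \<in> K")
      case True
      then have "(\<Sum>\<psi>\<in>extensions K \<theta>. \<psi> x / \<phi> x) = (\<Sum>\<psi>\<in>extensions K \<theta>. 1)"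
        using nz[OF x] \<phi>K by (intro sum.cong) auto
      then show ?thesis using True by simp
    next
      case False
      then show ?thesis
        using sum_extensions_outside[OF fin K x False] by (simp add: sum_divide_distrib[symmetric])
    qed
  qed
  also have "\<dots> = of_nat (card K) * of_nat (card (extensions K \<theta>))"
    using fin Kc by (simp add: sum.inter_filter[symmetric] Int_absorb1 subsetI Collect_conj_eq)
  finally have "of_nat (order G) = (of_nat (card K) * of_nat (card (extensions K \<theta>)) :: complex)"
    using 1 by simp
  moreover have "card K \<noteq> 0"
    using finite_subset[OF subgroup.subset[OF K] fin] subgroup.one_closed[OF K] by auto
  ultimately have card: "of_nat (card (extensions K \<theta>)) = (of_nat (order G) / of_nat (card K) :: complex)"
    by simp
  show ?thesis
  proof (cases "h \<in> K")
    case True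
    then have "(\<Sum>\<psi>\<in>extensions K \<theta>. \<psi> h) = (\<Sum>\<psi>\<in>extensions K \<theta>. \<theta> h)"
      by (intro sum.cong) (auto simp: extensions_def)
    then show ?thesis using True card by simp
  qed (use sum_extensions_outside[OF fin K h] in simp)
qed

end

section \<open>The group and its additive characters\<close>

context triangular_type
begin

lemmas J_zero = subspace_0[OF J_subspace]
lemmas J_add = subspace_add[OF J_subspace]
lemmas J_neg = subspace_neg[OF J_subspace]
lemmas J_diff = subspace_diff[OF J_subspace]
lemmas J_scale = subspace_scale[OF J_subspace]
lemmas J_sum = subspace_sum[OF J_subspace]

lemmas J_closed [simp, intro] = J_zero J_add J_neg J_diff J_scale J_mult lact_closed ract_closed

lemma lact_zero [simp]: "h \<in> carrier H \<Longrightarrow> h \<triangleright> 0 = 0"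
  using lact_add[of h 0 0] by simp

lemma ract_zero [simp]: "h \<in> carrier H \<Longrightarrow> 0 \<triangleleft> h = 0"
  using ract_add[of h 0 0] by simp

lemma lact_neg: "h \<in> carrier H \<Longrightarrow> x \<in> J \<Longrightarrow> h \<triangleright> (- x) = - (h \<triangleright> x)"
  using lact_add[of h x "- x"] by (simp add: eq_neg_iff_add_eq_0 add.commute)

lemma ract_neg: "h \<in> carrier H \<Longrightarrow> x \<in> J \<Longrightarrow> (- x) \<triangleleft> h = - (x \<triangleleft> h)"
  using ract_add[of h x "- x"] by (simp add: eq_neg_iff_add_eq_0 add.commute)

lemma lact_diff: "h \<in> carrier H \<Longrightarrow> x \<in> J \<Longrightarrow> y \<in> J \<Longrightarrow> h \<triangleright> (x - y) = h \<triangleright> x - h \<triangleright> y"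
  using lact_add[of h x "- y"] by (simp add: lact_neg)

lemma ract_diff: "h \<in> carrier H \<Longrightarrow> x \<in> J \<Longrightarrow> y \<in> J \<Longrightarrow> (x - y) \<triangleleft> h = x \<triangleleft> h - y \<triangleleft> h"
  using ract_add[of h x "- y"] by (simp add: ract_neg)

lemma lact_sum: "h \<in> carrier H \<Longrightarrow> (\<And>i. i \<in> I \<Longrightarrow> f i \<in> J) \<Longrightarrow> h \<triangleright> (\<Sum>i\<in>I. f i) = (\<Sum>i\<in>I. h \<triangleright> f i)"
  by (induction I rule: infinite_finite_induct) (auto simp: lact_add J_sum)

lemma ract_sum: "h \<in> carrier H \<Longrightarrow> (\<And>i. i \<in> I \<Longrightarrow> f i \<in> J) \<Longrightarrow> (\<Sum>i\<in>I. f i) \<triangleleft> h = (\<Sum>i\<in>I. f i \<triangleleft> h)"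
  by (induction I rule: infinite_finite_induct) (auto simp: ract_add J_sum)

lemmas J_simps = lact_add ract_add lact_diff ract_diff lact_neg ract_neg lact_scale ract_scale
  lact_mult ract_mult lact_one ract_one actions_commute lact_times ract_times middle_times
  J_scale_left J_scale_right

lemma lact_inv_cancel [simp]:
  assumes "h \<in> carrier H" "x \<in> J"
  shows "h \<triangleright> (inv h \<triangleright> x) = x" "inv h \<triangleright> (h \<triangleright> x) = x"
  using assms lact_mult[of h "inv h" x] lact_mult[of "inv h" h x] by (simp_all add: lact_one)

lemma ract_inv_cancel [simp]:
  assumes "h \<in> carrier H" "x \<in> J"
  shows "(x \<triangleleft> h) \<triangleleft> inv h = x" "(x \<triangleleft> inv h) \<triangleleft> h = x"
  using assms ract_mult[of h "inv h" x] ract_mult[of "inv h" h x] by (simp_all add: ract_one)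

lemma finite_J: "finite J"
proof -
  obtain B where B: "finite B" "B \<subseteq> J" "span B = J" using J_finite_dim by blast
  have "J = range (\<lambda>u. \<Sum>v\<in>B. u v *s v)" using span_finite[OF B(1)] B(3) by simp
  \<comment> \<open>Coefficients are cut down to \<open>B\<close>, since the functions on the whole
    type need not form a finite set.\<close>
  also have "\<dots> = (\<lambda>u. \<Sum>v\<in>B. u v *s v) ` (PiE B (\<lambda>_. UNIV))"
  proof
    show "range (\<lambda>u. \<Sum>v\<in>B. u v *s v) \<subseteq> (\<lambda>u. \<Sum>v\<in>B. u v *s v) ` (PiE B (\<lambda>_. UNIV))"
    proof
      fix x assume "x \<in> range (\<lambda>u. \<Sum>v\<in>B. u v *s v)"
      then obtain u where "x = (\<Sum>v\<in>B. u v *s v)" by blast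
      then have "x = (\<Sum>v\<in>B. restrict u B v *s v)" by simp
      then show "x \<in> (\<lambda>u. \<Sum>v\<in>B. u v *s v) ` (PiE B (\<lambda>_. UNIV))"
        by (intro image_eqI[of _ _ "restrict u B"]) simp_all
    qed
  qed auto
  also have "finite \<dots>" using B(1) by (intro finite_imageI finite_PiE) auto
  finally show ?thesis .
qed

lemma card_J_pos: "card J > 0"
  using finite_J J_zero by (auto simp: card_gt_0_iff)

text \<open>The element h + x of \<open>G\<close>. Products in \<open>G\<close> are computed by
  \<open>el_mult\<close>, without convolutions in \<open>A\<close>.\<close>

definition el :: "'h \<Rightarrow> 'a \<Rightarrow> ('h \<Rightarrow> 'k) \<times> 'a"
  where "el h x = (\<lambda>u. if u = h then 1 else 0, x)"

lemma el_inject [simp]: "el h x = el g y \<longleftrightarrow> h = g \<and> x = y"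
  by (auto simp: el_def fun_eq_iff)

lemma snd_el [simp]: "snd (el h x) = x" by (simp add: el_def)

lemma of_H_add_of_J: "of_H h \<oplus>\<^bsub>A\<^esub> of_J x = el h x"
  by (simp add: A_def of_H_def of_J_def el_def fun_eq_iff)

lemma carrier_G: "carrier G = {el h x | h x. h \<in> carrier H \<and> x \<in> J}"
  by (simp add: G_def of_H_add_of_J)

lemma G_cases [elim?]:
  assumes "g \<in> carrier G" obtains h x where "h \<in> carrier H" "x \<in> J" "g = el h x"
  using assms by (auto simp: carrier_G)

lemma el_in_G [simp]: "el h x \<in> carrier G \<longleftrightarrow> h \<in> carrier H \<and> x \<in> J"
  by (auto simp: carrier_G)

lemma one_G: "\<one>\<^bsub>G\<^esub> = el \<one> 0"
  by (simp add: G_def A_def el_def)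

lemma sum_delta_scale: "h \<in> carrier H \<Longrightarrow> (\<Sum>u\<in>carrier H. (if u = h then 1 else 0) *s f u) = f h"
proof -
  assume h: "h \<in> carrier H"
  have "(\<Sum>u\<in>carrier H. (if u = h then 1 else 0) *s f u) = (\<Sum>u\<in>carrier H. if u = h then f u else 0)"
    by (rule sum.cong) auto
  then show ?thesis using h H_finite by simp
qed

lemma el_mult_A:
  assumes "h \<in> carrier H" "g \<in> carrier H"
  shows "el h x \<otimes>\<^bsub>A\<^esub> el g y = el (h \<otimes> g) (h \<triangleright> y + x \<triangleleft> g + x * y)"
proof -
  have "(\<Sum>(u, v) \<in> {(u, v). u \<in> carrier H \<and> v \<in> carrier H \<and> u \<otimes> v = w}.
      (if u = h then 1 else 0) * (if v = g then 1 else (0::'k))) = (if w = h \<otimes> g then 1 else 0)" for w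
  proof -
    let ?S = "{(u, v). u \<in> carrier H \<and> v \<in> carrier H \<and> u \<otimes> v = w}"
    have fin: "finite ?S"
      by (rule finite_subset[of _ "carrier H \<times> carrier H"]) (use H_finite in auto)
    have "(\<Sum>(u, v) \<in> ?S. (if u = h then 1 else 0) * (if v = g then 1 else (0::'k))) =
      (\<Sum>p \<in> ?S. if p = (h, g) then 1 else 0)"
      by (rule sum.cong) (auto split: if_splits)
    also have "\<dots> = (if (h, g) \<in> ?S then 1 else 0)" using fin by simp
    finally show ?thesis using assms by auto
  qed
  then show ?thesis
    using assms by (simp add: A_def el_def sum_delta_scale)
qed

lemma el_mult [simp]:
  assumes "h \<in> carrier H" "g \<in> carrier H"
  shows "el h x \<otimes>\<^bsub>G\<^esub> el g y = el (h \<otimes> g) (h \<triangleright> y + x \<triangleleft> g + x * y)"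
  using el_mult_A[OF assms] by (simp add: G_def)

text \<open>Iterating y = -xy gives y = (-x)^n y, which is 0 by nilpotency.\<close>

lemma left_quasi_regular:
  assumes x: "x \<in> J" and y: "y \<in> J" and e: "y + x * y = 0"
  shows "y = 0"
proof -
  obtain n where n: "\<And>xs z. set xs \<subseteq> J \<Longrightarrow> z \<in> J \<Longrightarrow> length xs = n \<Longrightarrow> foldr (*) xs z = 0"
    using J_nilpotent by blast
  have e': "- x * y = y" using e by (simp add: add_eq_0_iff)
  have "foldr (*) (replicate m (- x)) y = y" for m
    by (induction m) (simp_all add: e'[simplified])
  moreover have "foldr (*) (replicate n (- x)) y = 0"
    using x y by (intro n) (auto simp: set_replicate_conv_if)
  ultimately show ?thesis by simp
qed

text \<open>The equation says (1 + x)(1 + y) = 1. The map y to y + xy is injective on the finite set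
  \<open>J\<close>, hence onto, so no geometric series is needed.\<close>

lemma right_quasi_inverse:
  assumes x: "x \<in> J" obtains y where "y \<in> J" "x + y + x * y = 0"
proof -
  have "inj_on (\<lambda>y. y + x * y) J"
  proof (rule inj_onI)
    fix y z assume "y \<in> J" "z \<in> J" "y + x * y = z + x * z"
    then have "y - z = 0"
      using x by (intro left_quasi_regular[of x "y - z"]) (auto simp: algebra_simps)
    then show "y = z" by simp
  qed
  moreover have "(\<lambda>y. y + x * y) ` J \<subseteq> J" using x by auto
  ultimately have "(\<lambda>y. y + x * y) ` J = J" using finite_J by (simp add: endo_inj_surj)
  then obtain y where "y \<in> J" "y + x * y = - x" using x by (metis (mono_tags, lifting) J_neg imageE)
  then show thesis using that[of y] by (simp add: algebra_simps add_eq_0_iff2)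
qed

lemma group_G: "group G"
proof -
  have assoc: "g \<otimes>\<^bsub>G\<^esub> h \<otimes>\<^bsub>G\<^esub> k = g \<otimes>\<^bsub>G\<^esub> (h \<otimes>\<^bsub>G\<^esub> k)"
    if "g \<in> carrier G" "h \<in> carrier G" "k \<in> carrier G" for g h k
    using that by (auto simp: carrier_G J_simps H.m_assoc algebra_simps)
  have one: "\<one>\<^bsub>G\<^esub> \<in> carrier G" by (simp add: one_G)
  have closed: "g \<otimes>\<^bsub>G\<^esub> h \<in> carrier G" if "g \<in> carrier G" "h \<in> carrier G" for g h
    using that by (auto simp: carrier_G)
  have l_one: "\<one>\<^bsub>G\<^esub> \<otimes>\<^bsub>G\<^esub> g = g" and r_one: "g \<otimes>\<^bsub>G\<^esub> \<one>\<^bsub>G\<^esub> = g" if "g \<in> carrier G" for g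
    using that by (auto simp: carrier_G one_G J_simps)
  have r_inv: "\<exists>h\<in>carrier G. g \<otimes>\<^bsub>G\<^esub> h = \<one>\<^bsub>G\<^esub>" if g: "g \<in> carrier G" for g
  proof -
    obtain h x where hx: "h \<in> carrier H" "x \<in> J" "g = el h x" using g by (rule G_cases)
    obtain y where y: "y \<in> J" "x \<triangleleft> inv h + y + (x \<triangleleft> inv h) * y = 0"
      using right_quasi_inverse[of "x \<triangleleft> inv h"] hx by auto
    \<comment> \<open>Since h + x = (1 + x h^-1) h, a right inverse is h^-1 (1 + y), where 1 + y is
      one for 1 + x h^-1.\<close>
    have "g \<otimes>\<^bsub>G\<^esub> (el (inv h) 0 \<otimes>\<^bsub>G\<^esub> el \<one> y) = \<one>\<^bsub>G\<^esub>"
      using hx y by (simp add: one_G middle_times algebra_simps)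
    then show ?thesis using hx y by (metis H.inv_closed H.one_closed J_zero closed el_in_G)
  qed
  have l_inv: "\<exists>h\<in>carrier G. h \<otimes>\<^bsub>G\<^esub> g = \<one>\<^bsub>G\<^esub>" if g: "g \<in> carrier G" for g
  proof -
    obtain h where h: "h \<in> carrier G" "g \<otimes>\<^bsub>G\<^esub> h = \<one>\<^bsub>G\<^esub>" using r_inv g by blast
    obtain k where k: "k \<in> carrier G" "h \<otimes>\<^bsub>G\<^esub> k = \<one>\<^bsub>G\<^esub>" using r_inv h by blast
    have "g = g \<otimes>\<^bsub>G\<^esub> (h \<otimes>\<^bsub>G\<^esub> k)" using k g r_one by simp
    also have "\<dots> = k" using assoc[OF g h(1) k(1)] h(2) k(1) l_one by simp
    finally show ?thesis using h k by blast
  qed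
  show ?thesis by (rule groupI) (use assoc one closed l_one l_inv in auto)
qed

sublocale G: group G by (rule group_G)

lemma finite_G: "finite (carrier G)"
proof -
  have "carrier G = (\<lambda>(h, x). el h x) ` (carrier H \<times> J)" by (auto simp: carrier_G)
  then show ?thesis using H_finite finite_J by simp
qed

lemma el_set_card:
  "card {el h x | h x. h \<in> K \<and> x \<in> R} = card K * card R"
proof -
  have "{el h x | h x. h \<in> K \<and> x \<in> R} = (\<lambda>(h, x). el h x) ` (K \<times> R)" by auto
  moreover have "inj_on (\<lambda>(h, x). el h x) (K \<times> R)" by (auto simp: inj_on_def)
  ultimately show ?thesis by (simp add: card_image card_cartesian_product)
qed

text \<open>Conjugation keeps the \<open>H\<close>-part because \<open>H\<close> is abelian. The new
  \<open>J\<close>-part z is given only implicitly, through z(j + u) = uk - ku + jx + ux; this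
  avoids inverses and is the expression at which forms are evaluated later.\<close>

lemma conj_el:
  assumes "j \<in> carrier H" "u \<in> J" "k \<in> carrier H" "x \<in> J"
  obtains z where "z \<in> J" "el j u \<otimes>\<^bsub>G\<^esub> el k x \<otimes>\<^bsub>G\<^esub> inv\<^bsub>G\<^esub> (el j u) = el k z"
    "z \<triangleleft> j + z * u = u \<triangleleft> k - k \<triangleright> u + j \<triangleright> x + u * x"
proof -
  let ?s = "el j u \<otimes>\<^bsub>G\<^esub> el k x \<otimes>\<^bsub>G\<^esub> inv\<^bsub>G\<^esub> (el j u)"
  have w: "el j u \<in> carrier G" and g: "el k x \<in> carrier G" using assms by auto
  then have "?s \<in> carrier G" by blast
  then obtain k' z where s: "k' \<in> carrier H" "z \<in> J" "?s = el k' z" by (rule G_cases)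
  have "?s \<otimes>\<^bsub>G\<^esub> el j u = el j u \<otimes>\<^bsub>G\<^esub> el k x"
    using w g by (simp add: G.m_assoc del: el_mult)
  then have e: "k' \<otimes> j = j \<otimes> k" "k' \<triangleright> u + z \<triangleleft> j + z * u = j \<triangleright> x + u \<triangleleft> k + u * x"
    unfolding s(3) using assms s by auto
  have "k' = k" using e(1) assms s by (metis H.m_comm H.r_cancel)
  then show thesis using that[of z] s e by (simp add: algebra_simps)
qed


lemma xi_el: "h \<in> carrier H \<Longrightarrow> xi \<epsilon> \<theta> l (el h x) = \<theta> h * \<epsilon> (l x)"
proof -
  assume h: "h \<in> carrier H"
  have "(THE g. g \<in> carrier H \<and> fst (el h x) = fst (of_H g)) = h"
    using h by (intro the_equality) (auto simp: el_def of_H_def fun_eq_iff, metis zero_neq_one)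
  then show ?thesis by (simp add: xi_def)
qed

lemma G_sub_eq: "G_sub e l = {el h x | h x. h \<in> H_fix e \<and> x \<in> J_right l}"
  by (simp add: G_sub_def of_H_add_of_J)

lemma linear_character_eq: "linear_character K \<theta> = character_on H K \<theta>"
  by (simp add: linear_character_def character_on_def)

text \<open>Here the condition on the characteristic enters: means over subgroups of
  \<open>H\<close> exist in the field.\<close>

lemma card_K_nonzero:
  assumes "subgroup K H" shows "(of_nat (card K) :: 'k) \<noteq> 0"
proof
  assume "(of_nat (card K) :: 'k) = 0"
  then have "CHAR('k) dvd card K" by (simp add: of_nat_eq_0_iff_char_dvd)
  also have "card K dvd order H" using H.lagrange[OF assms] by (metis dvd_triv_right)
  finally show False using char_H by blast
qed

lemma dual_zero: "l \<in> dual \<Longrightarrow> l 0 = 0"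
  unfolding dual_def using J_zero by (metis (mono_tags, lifting) mem_Collect_eq mult_zero_left scale_zero_left)

lemma dual_add: "l \<in> dual \<Longrightarrow> x \<in> J \<Longrightarrow> y \<in> J \<Longrightarrow> l (x + y) = l x + l y"
  by (simp add: dual_def)

lemma dual_scale: "l \<in> dual \<Longrightarrow> x \<in> J \<Longrightarrow> l (c *s x) = c * l x"
  by (simp add: dual_def)

lemma dual_neg: "l \<in> dual \<Longrightarrow> x \<in> J \<Longrightarrow> l (- x) = - l x"
  using dual_add[of l x "- x"] dual_zero[of l] by (simp add: eq_neg_iff_add_eq_0 add.commute)

lemma dual_diff: "l \<in> dual \<Longrightarrow> x \<in> J \<Longrightarrow> y \<in> J \<Longrightarrow> l (x - y) = l x - l y"
  using dual_add[of l x "- y"] dual_neg[of l y] by simp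

lemma dual_sum: "l \<in> dual \<Longrightarrow> (\<And>i. i \<in> I \<Longrightarrow> f i \<in> J) \<Longrightarrow> l (\<Sum>i\<in>I. f i) = (\<Sum>i\<in>I. l (f i))"
  by (induction I rule: infinite_finite_induct) (auto simp: dual_add dual_zero J_sum)

lemmas dual_simps = dual_add dual_scale dual_neg dual_diff dual_zero

lemma dual_outside: "l \<in> dual \<Longrightarrow> x \<notin> J \<Longrightarrow> l x = 0"
  by (simp add: dual_def)

lemma dual_eqI: "l \<in> dual \<Longrightarrow> m \<in> dual \<Longrightarrow> (\<And>x. x \<in> J \<Longrightarrow> l x = m x) \<Longrightarrow> l = m"
  by (metis dual_outside ext)

lemma dualI:
  assumes "\<And>x y. x \<in> J \<Longrightarrow> y \<in> J \<Longrightarrow> f (x + y) = f x + f y"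
    and "\<And>c x. x \<in> J \<Longrightarrow> f (c *s x) = c * f x"
  shows "(\<lambda>x. if x \<in> J then f x else 0) \<in> dual"
  using assms by (simp add: dual_def)

lemma finite_dual: "finite dual"
  by (rule finite_subset[OF _ finite_set_of_finite_funs[OF finite_J finite[of "UNIV :: 'k set"], of 0]])
    (auto simp: dual_def)

lemma dual_separating:
  assumes R: "subspace R" "R \<subseteq> J" and x: "x \<in> J" "x \<notin> R"
  obtains l where "l \<in> dual" "\<And>y. y \<in> R \<Longrightarrow> l y = 0" "l x = 1"
proof -
  interpret K: vector_space "(*) :: 'k \<Rightarrow> 'k \<Rightarrow> 'k"
    by unfold_locales (auto simp: algebra_simps)
  interpret P: vector_space_pair scale "(*) :: 'k \<Rightarrow> 'k \<Rightarrow> 'k" ..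
  obtain B where B: "B \<subseteq> R" "independent B" "span B = R"
    using R(1) basis_exists span_eq_iff span_subspace by metis
  have "independent (insert x B)" using B x by (simp add: independent_insert)
  from P.linear_independent_extend[OF this, of "\<lambda>b. if b = x then 1 else 0"]
  obtain g where g: "Vector_Spaces.linear scale (*) g" "\<And>b. b \<in> insert x B \<Longrightarrow> g b = (if b = x then 1 else 0)"
    by blast
  interpret g: Vector_Spaces.linear scale "(*)" g by (rule g(1))
  have "g b = 0" if "b \<in> B" for b using g(2)[of b] that B x by auto
  then have "g y = 0" if "y \<in> R" for y
    using P.linear_eq_0_on_span[OF g(1), of B y] that B by auto
  moreover have "(\<lambda>x. if x \<in> J then g x else 0) \<in> dual"
    by (rule dualI) (auto simp: g.add g.scale)
  ultimately show thesis
    using that[of "\<lambda>x. if x \<in> J then g x else 0"] g(2)[of x] x R by auto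
qed

end

section \<open>Characters of the additive group and sizes of annihilators\<close>

locale additive_character =
  fixes \<epsilon> :: "'k::field \<Rightarrow> complex"
  assumes nontrivial: "nontrivial_additive_character \<epsilon>"
begin

lemma eps_nonzero [simp]: "\<epsilon> t \<noteq> 0" and eps_add: "\<epsilon> (s + t) = \<epsilon> s * \<epsilon> t"
  using nontrivial by (auto simp: nontrivial_additive_character_def)

lemma eps_0 [simp]: "\<epsilon> 0 = 1"
  using eps_add[of 0 0] by simp

lemma eps_diff: "\<epsilon> (s - t) = \<epsilon> s / \<epsilon> t"
  using eps_add[of "s - t" t] by (simp add: field_simps)

end

locale triangular_type_character = triangular_type scale H J lact ract + additive_character \<epsilon>
  for scale :: "'k::{field,finite} \<Rightarrow> 'a::ring \<Rightarrow> 'a" (infixr \<open>*s\<close> 75)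
    and H :: "'h monoid" (structure)
    and J :: "'a set"
    and lact :: "'h \<Rightarrow> 'a \<Rightarrow> 'a" (infixr \<open>\<triangleright>\<close> 75)
    and ract :: "'a \<Rightarrow> 'h \<Rightarrow> 'a" (infixl \<open>\<triangleleft>\<close> 75)
    and \<epsilon> :: "'k \<Rightarrow> complex"
begin


text \<open>A nonzero linear map takes every value of the field, in particular one where \<epsilon>
  is not 1, and translation by a point with that value multiplies the sum by it. The map is not
  taken from \<open>dual\<close>, because maps such as x to l(xy) occur, which are not normalised
  outside \<open>J\<close>.\<close>

lemma sum_eps_J:
  assumes l: "\<And>x y. x \<in> J \<Longrightarrow> y \<in> J \<Longrightarrow> l (x + y) = l x + l y" "\<And>c x. x \<in> J \<Longrightarrow> l (c *s x) = c * l x"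
  shows "(\<Sum>x\<in>J. \<epsilon> (l x)) = (if \<forall>x\<in>J. l x = 0 then of_nat (card J) else 0)"
proof (cases "\<forall>x\<in>J. l x = 0")
  case False
  then obtain x where x: "x \<in> J" "l x \<noteq> 0" by blast
  obtain t where t: "\<epsilon> t \<noteq> 1" using nontrivial by (auto simp: nontrivial_additive_character_def)
  define z where "z = (t / l x) *s x"
  have z: "z \<in> J" "l z = t" using x by (simp_all add: z_def l)
  have "(\<Sum>x\<in>J. \<epsilon> (l x)) = (\<Sum>x\<in>J. \<epsilon> (l (x + z)))"
    by (rule sum.reindex_bij_witness[of _ "\<lambda>x. x + z" "\<lambda>x. x - z"]) (use z in auto)
  also have "\<dots> = \<epsilon> t * (\<Sum>x\<in>J. \<epsilon> (l x))"
    using z by (simp add: l eps_add sum_distrib_left mult.commute)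
  finally have "(1 - \<epsilon> t) * (\<Sum>x\<in>J. \<epsilon> (l x)) = 0" by (simp add: algebra_simps)
  then show ?thesis using t False by auto
qed simp

text \<open>For \<mu> in \<open>dual\<close> this is the coset of \<mu> modulo the annihilator of
  \<open>R\<close>.\<close>

definition agree :: "'a set \<Rightarrow> ('a \<Rightarrow> 'k) \<Rightarrow> ('a \<Rightarrow> 'k) set" where
  "agree R \<mu> = {\<nu> \<in> dual. \<forall>y\<in>R. \<nu> y = \<mu> y}"

lemma finite_agree: "finite (agree R \<mu>)"
  using finite_dual by (simp add: agree_def)

text \<open>If x is outside \<open>R\<close>, some form vanishes on \<open>R\<close> but not at x;
  adding a multiple of it permutes the coset and scales the sum by a factor other than 1.\<close>

lemma sum_eps_agree:
  assumes R: "subspace R" "R \<subseteq> J" and \<mu>: "\<mu> \<in> dual" and x: "x \<in> J"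
  shows "(\<Sum>\<nu>\<in>agree R \<mu>. \<epsilon> (\<nu> x)) = (if x \<in> R then of_nat (card (agree R \<mu>)) * \<epsilon> (\<mu> x) else 0)"
proof (cases "x \<in> R")
  case True
  then have "(\<Sum>\<nu>\<in>agree R \<mu>. \<epsilon> (\<nu> x)) = (\<Sum>\<nu>\<in>agree R \<mu>. \<epsilon> (\<mu> x))"
    by (intro sum.cong) (auto simp: agree_def)
  then show ?thesis using True by simp
next
  case False
  obtain l where l: "l \<in> dual" "\<And>y. y \<in> R \<Longrightarrow> l y = 0" "l x = 1"
    using dual_separating[OF R x False] by blast
  obtain t where t: "\<epsilon> t \<noteq> 1" using nontrivial by (auto simp: nontrivial_additive_character_def)
  have "(\<Sum>\<nu>\<in>agree R \<mu>. \<epsilon> (\<nu> x)) = (\<Sum>\<nu>\<in>agree R \<mu>. \<epsilon> t * \<epsilon> (\<nu> x))"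
  proof (rule sum.reindex_bij_witness[of _ "\<lambda>\<nu> y. \<nu> y + t * l y" "\<lambda>\<nu> y. \<nu> y - t * l y"])
    fix \<nu> assume "\<nu> \<in> agree R \<mu>"
    then show "(\<lambda>y. \<nu> y + t * l y) \<in> agree R \<mu>" "(\<lambda>y. \<nu> y - t * l y) \<in> agree R \<mu>"
      using l by (auto simp: agree_def dual_def algebra_simps)
    show "\<epsilon> t * \<epsilon> (\<nu> x - t * l x) = \<epsilon> (\<nu> x)" using l by (simp add: eps_add[symmetric])
  qed auto
  also have "\<dots> = \<epsilon> t * (\<Sum>\<nu>\<in>agree R \<mu>. \<epsilon> (\<nu> x))" by (simp add: sum_distrib_left)
  finally have "(1 - \<epsilon> t) * (\<Sum>\<nu>\<in>agree R \<mu>. \<epsilon> (\<nu> x)) = 0" by (simp add: algebra_simps)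
  then show ?thesis using t False by simp
qed

text \<open>Duality of sizes without dimensions: the double sum of \<epsilon>(\<nu>(x) - \<mu>(x))
  over \<open>J\<close> and the coset is evaluated in both orders.\<close>

lemma card_agree:
  assumes R: "subspace R" "R \<subseteq> J" and \<mu>: "\<mu> \<in> dual"
  shows "card (agree R \<mu>) * card R = card J"
proof -
  have "(\<Sum>x\<in>J. \<Sum>\<nu>\<in>agree R \<mu>. \<epsilon> (\<nu> x - \<mu> x)) = (\<Sum>x\<in>J. if x \<in> R then of_nat (card (agree R \<mu>)) else 0)"
    by (rule sum.cong[OF refl])
      (auto simp: eps_diff sum_divide_distrib[symmetric] sum_eps_agree[OF R \<mu>])
  also have "\<dots> = of_nat (card (agree R \<mu>) * card R)"
    using R(2) finite_J by (simp add: sum.inter_filter[symmetric] Int_absorb1 Collect_conj_eq)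
  finally have 1: "(\<Sum>x\<in>J. \<Sum>\<nu>\<in>agree R \<mu>. \<epsilon> (\<nu> x - \<mu> x)) = of_nat (card (agree R \<mu>) * card R)" .
  have "(\<Sum>x\<in>J. \<Sum>\<nu>\<in>agree R \<mu>. \<epsilon> (\<nu> x - \<mu> x)) = (\<Sum>\<nu>\<in>agree R \<mu>. \<Sum>x\<in>J. \<epsilon> (\<nu> x - \<mu> x))"
    by (rule sum.swap)
  also have "\<dots> = (\<Sum>\<nu>\<in>agree R \<mu>. if \<nu> = \<mu> then of_nat (card J) else 0)"
  proof (rule sum.cong[OF refl])
    fix \<nu> assume "\<nu> \<in> agree R \<mu>"
    then have \<nu>: "\<nu> \<in> dual" by (simp add: agree_def)
    have "(\<forall>x\<in>J. \<nu> x - \<mu> x = 0) \<longleftrightarrow> \<nu> = \<mu>" using dual_eqI[OF \<nu> \<mu>] by auto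
    then show "(\<Sum>x\<in>J. \<epsilon> (\<nu> x - \<mu> x)) = (if \<nu> = \<mu> then of_nat (card J) else 0)"
      using \<nu> \<mu> by (subst sum_eps_J) (auto simp: dual_simps algebra_simps)
  qed
  also have "\<dots> = of_nat (card J)" using \<mu> finite_agree by (simp add: agree_def)
  finally show ?thesis using 1 of_nat_eq_iff by metis
qed

end

section \<open>Induction from right ideals\<close>

context triangular_type
begin

text \<open>The projection of \<open>G\<close> onto \<open>H\<close>, a homomorphism by
  \<open>hpart_mult\<close>.\<close>

definition hpart :: "('h \<Rightarrow> 'k) \<times> 'a \<Rightarrow> 'h" where
  "hpart g = (THE h. h \<in> carrier H \<and> fst g = fst (of_H h))"

lemma hpart_el [simp]: "h \<in> carrier H \<Longrightarrow> hpart (el h x) = h"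
  unfolding hpart_def
  by (rule the_equality) (auto simp: el_def of_H_def fun_eq_iff, metis zero_neq_one)

definition els :: "'h set \<Rightarrow> 'a set \<Rightarrow> (('h \<Rightarrow> 'k) \<times> 'a) set" where
  "els K R = {el k x | k x. k \<in> K \<and> x \<in> R}"

lemma el_in_els [simp]: "el k x \<in> els K R \<longleftrightarrow> k \<in> K \<and> x \<in> R"
  by (auto simp: els_def)

lemma card_els: "card (els K R) = card K * card R"
  unfolding els_def by (rule el_set_card)

lemma els_carrier: "carrier G = els (carrier H) J"
  by (simp add: carrier_G els_def)

lemma els_mono: "K \<subseteq> L \<Longrightarrow> R \<subseteq> S \<Longrightarrow> els K R \<subseteq> els L S"
  by (auto simp: els_def)

text \<open>The closure hypothesis concerns the \<open>J\<close>-part of the product (k + x)(l +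
  y).\<close>

lemma subgroup_els:
  assumes K: "subgroup K H" and R: "R \<subseteq> J" "R \<noteq> {}"
    and cl: "\<And>k l x y. k \<in> K \<Longrightarrow> l \<in> K \<Longrightarrow> x \<in> R \<Longrightarrow> y \<in> R \<Longrightarrow> k \<triangleright> y + x \<triangleleft> l + x * y \<in> R"
  shows "subgroup (els K R) G"
proof (rule G.finite_mult_closed_subgroup[OF finite_G])
  have Kc: "k \<in> carrier H" if "k \<in> K" for k using that K subgroup.mem_carrier by metis
  show "els K R \<subseteq> carrier G" using Kc R by (auto simp: els_def)
  show "els K R \<noteq> {}"
    using R(2) subgroup.one_closed[OF K] el_in_els by (metis ex_in_conv)
  fix g h assume "g \<in> els K R" "h \<in> els K R"
  then show "g \<otimes>\<^bsub>G\<^esub> h \<in> els K R"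
    using Kc cl subgroup.m_closed[OF K] by (auto simp: els_def)
qed

definition left_invariant :: "'h set \<Rightarrow> ('a \<Rightarrow> 'k) \<Rightarrow> bool" where
  "left_invariant K l \<longleftrightarrow> (\<forall>k\<in>K. \<forall>x\<in>J. l (k \<triangleright> x) = l x)"

definition right_invariant :: "'h set \<Rightarrow> ('a \<Rightarrow> 'k) \<Rightarrow> bool" where
  "right_invariant K l \<longleftrightarrow> (\<forall>k\<in>K. \<forall>x\<in>J. l (x \<triangleleft> k) = l x)"

text \<open>The left action \<open>(g\<nu>)(y) = \<nu>(yg)\<close> of \<open>G\<close> on the dual space.\<close>

definition translate :: "('h \<Rightarrow> 'k) \<times> 'a \<Rightarrow> ('a \<Rightarrow> 'k) \<Rightarrow> 'a \<Rightarrow> 'k" where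
  "translate g \<nu> = (\<lambda>y. if y \<in> J then \<nu> (y \<triangleleft> hpart g + y * snd g) else 0)"

lemma translate_el: "k \<in> carrier H \<Longrightarrow> y \<in> J \<Longrightarrow> translate (el k x) \<nu> y = \<nu> (y \<triangleleft> k + y * x)"
  by (simp add: translate_def)

lemma translate_dual: "k \<in> carrier H \<Longrightarrow> x \<in> J \<Longrightarrow> \<nu> \<in> dual \<Longrightarrow> translate (el k x) \<nu> \<in> dual"
  unfolding translate_def
  by (rule dualI) (simp_all add: J_simps distrib_right dual_simps algebra_simps)

lemma translate_mult:
  assumes "g \<in> carrier G" "h \<in> carrier G"
  shows "translate (g \<otimes>\<^bsub>G\<^esub> h) \<nu> = translate g (translate h \<nu>)"
proof
  fix y
  obtain k x where g: "k \<in> carrier H" "x \<in> J" "g = el k x" using assms(1) by (rule G_cases)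
  obtain l z where h: "l \<in> carrier H" "z \<in> J" "h = el l z" using assms(2) by (rule G_cases)
  show "translate (g \<otimes>\<^bsub>G\<^esub> h) \<nu> y = translate g (translate h \<nu>) y"
    using g h by (simp add: translate_def J_simps algebra_simps)
qed

lemma translate_one: "\<nu> \<in> dual \<Longrightarrow> translate \<one>\<^bsub>G\<^esub> \<nu> = \<nu>"
  by (auto simp: translate_def one_G ract_one dual_outside)

lemma translate_fixed_iff:
  assumes "k \<in> carrier H" "x \<in> J" "\<nu> \<in> dual"
  shows "translate (el k x) \<nu> = \<nu> \<longleftrightarrow> (\<forall>y\<in>J. \<nu> (y \<triangleleft> k + y * x) = \<nu> y)"
  using dual_eqI[OF translate_dual[OF assms] assms(3)] assms
  by (auto simp: translate_el) (metis translate_el)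

text \<open>The mirror image of \<open>J_right\<close>. A form in \<open>dual\<close> is fixed by 1
  + z under \<open>translate\<close> exactly when z lies here.\<close>

definition J_left :: "('a \<Rightarrow> 'k) \<Rightarrow> 'a set"
  where "J_left l = {x \<in> J. \<forall>y\<in>J. l (y * x) = 0}"

end

context triangular_type_character
begin

text \<open>The two radicals of the pairing l(xy) have equal size: either one times
  \<open>card J\<close> is the double sum of \<epsilon>(l(xy)).\<close>

lemma card_J_left: assumes l: "l \<in> dual" shows "card (J_left l) = card (J_right l)"
proof -
  have "(\<Sum>x\<in>J. \<Sum>y\<in>J. \<epsilon> (l (x * y))) = (\<Sum>x\<in>J. if x \<in> J_right l then of_nat (card J) else 0)"
  proof (rule sum.cong[OF refl])
    fix x assume x: "x \<in> J"
    show "(\<Sum>y\<in>J. \<epsilon> (l (x * y))) = (if x \<in> J_right l then of_nat (card J) else 0)"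
      using x l by (subst sum_eps_J) (auto simp: dual_simps J_simps J_right_def distrib_left)
  qed
  also have "\<dots> = of_nat (card (J_right l) * card J)"
    using finite_J by (simp add: sum.inter_filter[symmetric] J_right_def Collect_conj_eq)
  finally have 1: "(\<Sum>x\<in>J. \<Sum>y\<in>J. \<epsilon> (l (x * y))) = of_nat (card (J_right l) * card J)" .
  have "(\<Sum>x\<in>J. \<Sum>y\<in>J. \<epsilon> (l (x * y))) = (\<Sum>y\<in>J. \<Sum>x\<in>J. \<epsilon> (l (x * y)))" by (rule sum.swap)
  also have "\<dots> = (\<Sum>y\<in>J. if y \<in> J_left l then of_nat (card J) else 0)"
  proof (rule sum.cong[OF refl])
    fix y assume y: "y \<in> J"
    show "(\<Sum>x\<in>J. \<epsilon> (l (x * y))) = (if y \<in> J_left l then of_nat (card J) else 0)"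
      using y l by (subst sum_eps_J) (auto simp: dual_simps J_simps J_left_def distrib_right)
  qed
  also have "\<dots> = of_nat (card (J_left l) * card J)"
    using finite_J by (simp add: sum.inter_filter[symmetric] J_left_def Collect_conj_eq)
  finally have "card (J_right l) * card J = card (J_left l) * card J"
    using 1 of_nat_eq_iff by metis
  then show ?thesis using card_J_pos by simp
qed

end

text \<open>The hypotheses on \<open>R\<close> and \<open>\<mu>\<close> make \<open>\<theta>(k)\<epsilon>(\<mu>(x))\<close> a linear character of \<open>K + R\<close> and force
  every form that agrees with \<open>\<mu>\<close> on \<open>R\<close> to be left invariant under \<open>K\<close>.\<close>

locale right_ideal_character = triangular_type_character scale H J lact ract \<epsilon>
  for scale :: "'k::{field,finite} \<Rightarrow> 'a::ring \<Rightarrow> 'a" (infixr \<open>*s\<close> 75)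
    and H :: "'h monoid" (structure)
    and J :: "'a set"
    and lact :: "'h \<Rightarrow> 'a \<Rightarrow> 'a" (infixr \<open>\<triangleright>\<close> 75)
    and ract :: "'a \<Rightarrow> 'h \<Rightarrow> 'a" (infixl \<open>\<triangleleft>\<close> 75)
    and \<epsilon> :: "'k \<Rightarrow> complex" +
  fixes K :: "'h set" and \<theta> :: "'h \<Rightarrow> complex" and R :: "'a set" and \<mu> :: "'a \<Rightarrow> 'k"
  assumes K: "subgroup K H"
    and R_subspace: "subspace R" and R_J: "R \<subseteq> J"
    and R_times: "x \<in> R \<Longrightarrow> y \<in> J \<Longrightarrow> x * y \<in> R" and mu_times: "x \<in> R \<Longrightarrow> y \<in> J \<Longrightarrow> \<mu> (x * y) = 0"
    and R_ract: "x \<in> R \<Longrightarrow> k \<in> K \<Longrightarrow> x \<triangleleft> k \<in> R"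
    and R_lact: "x \<in> J \<Longrightarrow> k \<in> K \<Longrightarrow> k \<triangleright> x - x \<in> R"
    and mu: "\<mu> \<in> dual" "left_invariant K \<mu>" "right_invariant K \<mu>"
begin

lemma K_carrier: "k \<in> K \<Longrightarrow> k \<in> carrier H"
  using K subgroup.mem_carrier by metis

lemma finite_K: "finite K" using K_carrier H_finite by (meson finite_subset subsetI)

lemma card_K_pos: "card K > 0"
  using finite_K subgroup.one_closed[OF K] by (auto simp: card_gt_0_iff)

lemma agree_dual: "\<nu> \<in> agree R \<mu> \<Longrightarrow> \<nu> \<in> dual" by (simp add: agree_def)

lemma agree_left_invariant:
  assumes \<nu>: "\<nu> \<in> agree R \<mu>" and k: "k \<in> K" and x: "x \<in> J"
  shows "\<nu> (k \<triangleright> x) = \<nu> x"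
proof -
  have "\<nu> (k \<triangleright> x - x) = \<mu> (k \<triangleright> x - x)" using \<nu> R_lact[OF x k] by (simp add: agree_def)
  also have "\<dots> = 0" using mu k x K_carrier by (simp add: dual_simps left_invariant_def)
  finally show ?thesis using agree_dual[OF \<nu>] k x K_carrier by (simp add: dual_simps)
qed

abbreviation Q where "Q \<equiv> els K J"

lemma subgroup_Q: "subgroup Q G"
  by (rule subgroup_els[OF K]) (use K_carrier J_zero in auto)

lemma Q_carrier: "g \<in> Q \<Longrightarrow> g \<in> carrier G"
  using subgroup_Q subgroup.mem_carrier by metis

lemma finite_Q: "finite Q" using finite_G Q_carrier by (meson finite_subset subsetI)

lemma Q_cases:
  assumes "g \<in> Q" obtains k x where "k \<in> K" "k \<in> carrier H" "x \<in> J" "g = el k x"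
  using assms K_carrier by (auto simp: els_def)

text \<open>For y in \<open>R\<close> both yk and yx lie in \<open>R\<close>, so only values of
  \<mu> enter; \<mu> is right invariant and vanishes on products from \<open>R\<close> and
  \<open>J\<close>.\<close>

lemma translate_agree:
  assumes g: "g \<in> Q" and \<nu>: "\<nu> \<in> agree R \<mu>" shows "translate g \<nu> \<in> agree R \<mu>"
proof -
  obtain k x where k: "k \<in> K" "k \<in> carrier H" "x \<in> J" "g = el k x" using g by (rule Q_cases)
  have "translate g \<nu> y = \<mu> y" if y: "y \<in> R" for y
  proof -
    have yJ: "y \<in> J" using y R_J by blast
    have "\<nu> (y \<triangleleft> k + y * x) = \<nu> (y \<triangleleft> k) + \<nu> (y * x)"
      using k yJ agree_dual[OF \<nu>] by (simp add: dual_simps)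
    also have "\<dots> = \<mu> (y \<triangleleft> k) + \<mu> (y * x)"
      using \<nu> y k R_ract R_times by (simp add: agree_def)
    also have "\<dots> = \<mu> y" using mu k y yJ mu_times by (simp add: right_invariant_def)
    finally show ?thesis using k yJ by (simp add: translate_el)
  qed
  then show ?thesis using translate_dual[OF k(2,3) agree_dual[OF \<nu>]] k(4) by (simp add: agree_def)
qed

text \<open>This is \<nu> applied to the equation of \<open>conj_el\<close>; left invariance removes
  k in front of u and j in front of x. The bracket vanishes for all u in \<open>J\<close> exactly
  when k + x fixes \<nu>.\<close>

lemma translate_conj:
  assumes \<nu>: "\<nu> \<in> agree R \<mu>" and j: "j \<in> K" "u \<in> J" and k: "k \<in> K" "x \<in> J" and z: "z \<in> J"
    and e: "z \<triangleleft> j + z * u = u \<triangleleft> k - k \<triangleright> u + j \<triangleright> x + u * x"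
  shows "translate (el j u) \<nu> z = \<nu> x + (\<nu> (u \<triangleleft> k + u * x) - \<nu> u)"
proof -
  have "translate (el j u) \<nu> z = \<nu> (u \<triangleleft> k - k \<triangleright> u + j \<triangleright> x + u * x)"
    using j z K_carrier by (simp add: translate_el e)
  then show ?thesis
    using agree_dual[OF \<nu>] j k z K_carrier by (simp add: dual_simps agree_left_invariant[OF \<nu>])
qed

text \<open>The scalar at a form \<nu> fixed by k + x is \<theta>(k) \<epsilon>(\<nu>(x)). Its
  invariance under conjugation is the vanishing of the bracket in
  \<open>translate_conj\<close>.\<close>

lemma action: "monomial_action (G\<lparr>carrier := Q\<rparr>) (agree R \<mu>) translate (xi \<epsilon> \<theta>)"
proof (intro monomial_action.intro monomial_action_axioms.intro)
  show "group (G\<lparr>carrier := Q\<rparr>)" using subgroup_Q by (rule G.subgroup_imp_group)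
  show "finite (carrier (G\<lparr>carrier := Q\<rparr>))" using finite_Q by simp
  show "finite (agree R \<mu>)" by (rule finite_agree)
  fix \<nu> assume \<nu>: "\<nu> \<in> agree R \<mu>"
  show "translate \<one>\<^bsub>G\<lparr>carrier := Q\<rparr>\<^esub> \<nu> = \<nu>" using translate_one agree_dual[OF \<nu>] by simp
  fix g assume "g \<in> carrier (G\<lparr>carrier := Q\<rparr>)"
  then have g: "g \<in> Q" by simp
  show "translate g \<nu> \<in> agree R \<mu>" using translate_agree[OF g \<nu>] .
  fix h assume "h \<in> carrier (G\<lparr>carrier := Q\<rparr>)"
  then have h: "h \<in> Q" by simp
  show "translate (g \<otimes>\<^bsub>G\<lparr>carrier := Q\<rparr>\<^esub> h) \<nu> = translate g (translate h \<nu>)"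
    using translate_mult[OF Q_carrier[OF g] Q_carrier[OF h]] by simp
  assume fixed: "translate h \<nu> = \<nu>"
  obtain j u where j: "j \<in> K" "j \<in> carrier H" "u \<in> J" "g = el j u" using g by (rule Q_cases)
  obtain k x where k: "k \<in> K" "k \<in> carrier H" "x \<in> J" "h = el k x" using h by (rule Q_cases)
  obtain z where z: "z \<in> J" "g \<otimes>\<^bsub>G\<^esub> h \<otimes>\<^bsub>G\<^esub> inv\<^bsub>G\<^esub> g = el k z"
    "z \<triangleleft> j + z * u = u \<triangleleft> k - k \<triangleright> u + j \<triangleright> x + u * x"
    using conj_el[OF j(2,3) k(2,3)] unfolding j(4)[symmetric] k(4)[symmetric] by blast
  have "translate g \<nu> z = \<nu> x + (\<nu> (u \<triangleleft> k + u * x) - \<nu> u)"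
    using translate_conj[OF \<nu> j(1,3) k(1,3) z(1,3)] j by simp
  also have "\<nu> (u \<triangleleft> k + u * x) = \<nu> u"
    using fixed j k agree_dual[OF \<nu>] by (simp add: translate_fixed_iff)
  finally have "xi \<epsilon> \<theta> (translate g \<nu>) (el k z) = xi \<epsilon> \<theta> \<nu> h"
    using k by (simp add: xi_el)
  then show "xi \<epsilon> \<theta> (translate g \<nu>) (g \<otimes>\<^bsub>G\<lparr>carrier := Q\<rparr>\<^esub> h \<otimes>\<^bsub>G\<lparr>carrier := Q\<rparr>\<^esub>
      inv\<^bsub>G\<lparr>carrier := Q\<rparr>\<^esub> g) = xi \<epsilon> \<theta> \<nu> h"
    using z g subgroup_Q by simp
qed

sublocale monomial_action "G\<lparr>carrier := Q\<rparr>" "agree R \<mu>" translate "xi \<epsilon> \<theta>"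
  rewrites "carrier (G\<lparr>carrier := Q\<rparr>) = Q"
  by (rule action) simp

lemma sum_Q: "(\<Sum>w\<in>Q. f w) = (\<Sum>j\<in>K. \<Sum>u\<in>J. f (el j u))"
proof -
  have "Q = (\<lambda>(j, u). el j u) ` (K \<times> J)" by (auto simp: els_def)
  moreover have "inj_on (\<lambda>(j, u). el j u) (K \<times> J)" by (auto simp: inj_on_def)
  ultimately show ?thesis by (simp add: sum.reindex sum.cartesian_product split_def)
qed

text \<open>Fourier inversion on \<open>R\<close> turns the induced character into a trace.\<close>

lemma induced_eq_trace:
  assumes g: "g \<in> Q"
  shows "induced_character (G\<lparr>carrier := Q\<rparr>) (els K R) (xi \<epsilon> \<theta> \<mu>) g =
    (\<Sum>\<nu> | \<nu> \<in> agree R \<mu> \<and> translate g \<nu> = \<nu>. xi \<epsilon> \<theta> \<nu> g)"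
proof -
  obtain k x where k: "k \<in> K" "k \<in> carrier H" "x \<in> J" "g = el k x" using g by (rule Q_cases)
  let ?M = "agree R \<mu>"
  have R_ne: "card R > 0" "card ?M > 0"
    using finite_subset[OF R_J finite_J] subspace_0[OF R_subspace] finite_agree mu
    by (auto simp: card_gt_0_iff agree_def)
  \<comment> \<open>The indicator of \<open>R\<close> times \<epsilon>(\<mu>(z)) is the mean of
    \<epsilon>(\<nu>(z)) over the coset. Replacing \<nu> by its translate under j + u then
    eliminates the implicit z.\<close>
  have term_eq: "(if el j u \<otimes>\<^bsub>G\<^esub> g \<otimes>\<^bsub>G\<^esub> inv\<^bsub>G\<^esub> (el j u) \<in> els K R
      then xi \<epsilon> \<theta> \<mu> (el j u \<otimes>\<^bsub>G\<^esub> g \<otimes>\<^bsub>G\<^esub> inv\<^bsub>G\<^esub> (el j u)) else 0) =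
      \<theta> k / of_nat (card ?M) * (\<Sum>\<nu>\<in>?M. \<epsilon> (\<nu> x) * \<epsilon> (\<nu> (u \<triangleleft> k + u * x) - \<nu> u))"
    if j: "j \<in> K" "u \<in> J" for j u
  proof -
    have jc: "j \<in> carrier H" using j K_carrier by blast
    obtain z where z: "z \<in> J" "el j u \<otimes>\<^bsub>G\<^esub> g \<otimes>\<^bsub>G\<^esub> inv\<^bsub>G\<^esub> (el j u) = el k z"
      "z \<triangleleft> j + z * u = u \<triangleleft> k - k \<triangleright> u + j \<triangleright> x + u * x"
      using conj_el[OF jc j(2) k(2,3)] unfolding k(4)[symmetric] by blast
    have w: "el j u \<in> Q" using j by simp
    have "(\<Sum>\<nu>\<in>?M. \<epsilon> (\<nu> z)) = (\<Sum>\<nu>\<in>?M. \<epsilon> (translate (el j u) \<nu> z))"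
    proof (rule sum.reindex_bij_witness[of _ "translate (el j u)" "translate (inv\<^bsub>G\<^esub> (el j u))"])
      fix \<nu> assume \<nu>: "\<nu> \<in> ?M"
      have iw: "inv\<^bsub>G\<^esub> (el j u) \<in> Q" using w subgroup_Q subgroup.m_inv_closed by metis
      show "translate (inv\<^bsub>G\<^esub> (el j u)) \<nu> \<in> ?M" "translate (el j u) \<nu> \<in> ?M"
        using translate_agree \<nu> w iw by auto
      show "translate (inv\<^bsub>G\<^esub> (el j u)) (translate (el j u) \<nu>) = \<nu>"
        using translate_mult[OF Q_carrier[OF iw] Q_carrier[OF w], of \<nu>] translate_one agree_dual[OF \<nu>]
          Q_carrier[OF w] by simp
      show 1: "translate (el j u) (translate (inv\<^bsub>G\<^esub> (el j u)) \<nu>) = \<nu>"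
        using translate_mult[OF Q_carrier[OF w] Q_carrier[OF iw], of \<nu>] translate_one agree_dual[OF \<nu>]
          Q_carrier[OF w] by simp
      show "\<epsilon> (translate (el j u) (translate (inv\<^bsub>G\<^esub> (el j u)) \<nu>) z) = \<epsilon> (\<nu> z)"
        unfolding 1 ..
    qed
    also have "\<dots> = (\<Sum>\<nu>\<in>?M. \<epsilon> (\<nu> x) * \<epsilon> (\<nu> (u \<triangleleft> k + u * x) - \<nu> u))"
      by (rule sum.cong[OF refl])
        (simp add: translate_conj[OF _ j k(1,3) z(1,3)] eps_add)
    finally have "(if z \<in> R then \<epsilon> (\<mu> z) else 0) =
        (\<Sum>\<nu>\<in>?M. \<epsilon> (\<nu> x) * \<epsilon> (\<nu> (u \<triangleleft> k + u * x) - \<nu> u)) / of_nat (card ?M)"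
      using sum_eps_agree[OF R_subspace R_J mu(1) z(1)] R_ne
      by (auto simp: eq_divide_eq mult.commute)
    then show ?thesis using z(2) k by (auto simp: xi_el)
  qed
  \<comment> \<open>Summing over u detects fixed forms: u to \<nu>(uk + ux) - \<nu>(u) is linear and
    vanishes on \<open>J\<close> only if g fixes \<nu>.\<close>
  have inner: "(\<Sum>u\<in>J. \<epsilon> (\<nu> (u \<triangleleft> k + u * x) - \<nu> u)) =
      (if translate g \<nu> = \<nu> then of_nat (card J) else 0)" if \<nu>: "\<nu> \<in> ?M" for \<nu>
    using agree_dual[OF \<nu>] k
    by (subst sum_eps_J) (auto simp: dual_simps J_simps distrib_right translate_fixed_iff algebra_simps)
  have "induced_character (G\<lparr>carrier := Q\<rparr>) (els K R) (xi \<epsilon> \<theta> \<mu>) g =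
      (\<Sum>w\<in>Q. if w \<otimes>\<^bsub>G\<^esub> g \<otimes>\<^bsub>G\<^esub> inv\<^bsub>G\<^esub> w \<in> els K R
        then xi \<epsilon> \<theta> \<mu> (w \<otimes>\<^bsub>G\<^esub> g \<otimes>\<^bsub>G\<^esub> inv\<^bsub>G\<^esub> w) else 0) / of_nat (card (els K R))"
    using group.induced_character_alt[OF G.subgroup_imp_group[OF subgroup_Q], of "els K R" "xi \<epsilon> \<theta> \<mu>" g]
      finite_Q subgroup_Q by (simp cong: sum.cong if_cong)
  also have "\<dots> = (\<Sum>j\<in>K. \<Sum>u\<in>J. \<theta> k / of_nat (card ?M) *
      (\<Sum>\<nu>\<in>?M. \<epsilon> (\<nu> x) * \<epsilon> (\<nu> (u \<triangleleft> k + u * x) - \<nu> u))) / of_nat (card (els K R))"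
    unfolding sum_Q by (simp add: term_eq cong: sum.cong)
  also have "(\<Sum>j\<in>K. \<Sum>u\<in>J. \<theta> k / of_nat (card ?M) *
      (\<Sum>\<nu>\<in>?M. \<epsilon> (\<nu> x) * \<epsilon> (\<nu> (u \<triangleleft> k + u * x) - \<nu> u))) =
      of_nat (card K) * (\<theta> k / of_nat (card ?M)) *
      (\<Sum>u\<in>J. \<Sum>\<nu>\<in>?M. \<epsilon> (\<nu> x) * \<epsilon> (\<nu> (u \<triangleleft> k + u * x) - \<nu> u))"
    by (simp only: sum_distrib_left[symmetric] sum_constant mult_ac)
  also have "(\<Sum>u\<in>J. \<Sum>\<nu>\<in>?M. \<epsilon> (\<nu> x) * \<epsilon> (\<nu> (u \<triangleleft> k + u * x) - \<nu> u)) =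
      (\<Sum>\<nu>\<in>?M. \<epsilon> (\<nu> x) * (\<Sum>u\<in>J. \<epsilon> (\<nu> (u \<triangleleft> k + u * x) - \<nu> u)))"
    by (subst sum.swap) (simp add: sum_distrib_left)
  also have "\<dots> = (\<Sum>\<nu>\<in>?M. if translate g \<nu> = \<nu> then \<epsilon> (\<nu> x) * of_nat (card J) else 0)"
    by (rule sum.cong[OF refl]) (simp add: inner)
  also have "\<dots> = of_nat (card J) * (\<Sum>\<nu> | \<nu> \<in> ?M \<and> translate g \<nu> = \<nu>. \<epsilon> (\<nu> x))"
    by (simp add: sum.inter_filter finite_agree sum_distrib_left mult.commute if_distrib cong: if_cong)
  finally have *: "induced_character (G\<lparr>carrier := Q\<rparr>) (els K R) (xi \<epsilon> \<theta> \<mu>) g =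
    of_nat (card K) * (\<theta> k / of_nat (card ?M)) *
      (of_nat (card J) * (\<Sum>\<nu> | \<nu> \<in> ?M \<and> translate g \<nu> = \<nu>. \<epsilon> (\<nu> x))) / of_nat (card (els K R))" .
  \<comment> \<open>\<open>card J\<close> is the number of forms times \<open>card R\<close>, so all
    constants cancel against \<open>card (els K R)\<close>.\<close>
  have "(of_nat (card J) :: complex) = of_nat (card ?M) * of_nat (card R)"
    using card_agree[OF R_subspace R_J mu(1)] by (metis of_nat_mult)
  then have "induced_character (G\<lparr>carrier := Q\<rparr>) (els K R) (xi \<epsilon> \<theta> \<mu>) g =
    \<theta> k * (\<Sum>\<nu> | \<nu> \<in> ?M \<and> translate g \<nu> = \<nu>. \<epsilon> (\<nu> x))"
    unfolding * card_els using R_ne card_K_pos by simp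
  then show ?thesis using k by (simp add: xi_el sum_distrib_left)
qed

end

lemma induced_character_sum:
  "induced_character G K (\<lambda>s. \<Sum>i\<in>I. f i s) g = (\<Sum>i\<in>I. induced_character G K (f i) g)"
  unfolding induced_character_def by (subst sum.swap) (simp add: sum_divide_distrib)

context right_ideal_character
begin

text \<open>The stabilizer splits over its projection to \<open>H\<close>, and the complement is the
  projection \<open>L\<close> itself, not merely a conjugate of it.\<close>

definition split_stabilizer :: "('a \<Rightarrow> 'k) \<Rightarrow> bool" where
  "split_stabilizer \<nu> \<longleftrightarrow> (\<exists>L. subgroup L H \<and> L \<subseteq> K \<and> stab \<nu> = els L (J_left \<nu>) \<and>
    left_invariant L \<nu> \<and> right_invariant L \<nu>)"

lemma stab_el:
  assumes "\<nu> \<in> agree R \<mu>" "k \<in> K" "x \<in> J"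
  shows "el k x \<in> stab \<nu> \<longleftrightarrow> (\<forall>y\<in>J. \<nu> (y \<triangleleft> k + y * x) = \<nu> y)"
  using assms K_carrier agree_dual[OF assms(1)] by (simp add: stab_def translate_fixed_iff)

text \<open>Let \<open>L\<close> be the projection to \<open>H\<close> of the stabilizer of \<open>\<nu>\<close>, and let \<open>k'\<close> be a lift of \<open>k\<close> in \<open>L\<close> to the
  stabilizer.  Translating \<open>\<nu>\<close> by the mean of the elements \<open>k\<^sup>-\<^sup>1k'\<close> makes it right invariant under \<open>L\<close>,
  because \<open>\<nu>(yk\<^sup>-\<^sup>1k') = \<nu>(yk\<^sup>-\<^sup>1)\<close>.\<close>

lemma exists_split_stabilizer:
  assumes \<nu>: "\<nu> \<in> agree R \<mu>"
  shows "\<exists>w\<in>Q. split_stabilizer (translate w \<nu>)"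
proof -
  define L where "L = {k \<in> K. \<exists>x\<in>J. el k x \<in> stab \<nu>}"
  have nud: "\<nu> \<in> dual" by (rule agree_dual[OF \<nu>])
  have st: "subgroup (stab \<nu>) (G\<lparr>carrier := Q\<rparr>)" by (rule subgroup_stab[OF \<nu>])
  have LK: "L \<subseteq> K" by (auto simp: L_def)
  have Lc: "k \<in> carrier H" if "k \<in> L" for k using that LK K_carrier by blast
  have L: "subgroup L H"
  proof (rule H.finite_mult_closed_subgroup[OF H_finite])
    show "L \<subseteq> carrier H" using Lc by blast
    have "\<one>\<^bsub>G\<^esub> \<in> stab \<nu>" using subgroup.one_closed[OF st] by simp
    then show "L \<noteq> {}" using subgroup.one_closed[OF K] by (auto simp: L_def one_G)
    fix k l assume "k \<in> L" "l \<in> L"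
    then obtain x y where x: "k \<in> K" "x \<in> J" "el k x \<in> stab \<nu>" and y: "l \<in> K" "y \<in> J" "el l y \<in> stab \<nu>"
      by (auto simp: L_def)
    have "el k x \<otimes>\<^bsub>G\<^esub> el l y \<in> stab \<nu>" using subgroup.m_closed[OF st x(3) y(3)] by simp
    moreover have "k \<triangleright> y + x \<triangleleft> l + x * y \<in> J" using x y K_carrier by simp
    ultimately show "k \<otimes> l \<in> L"
      using x y K_carrier subgroup.m_closed[OF K] unfolding L_def by auto
  qed
  have "\<forall>k\<in>L. \<exists>x. x \<in> J \<and> el k x \<in> stab \<nu>" by (auto simp: L_def)
  from bchoice[OF this] obtain f where f: "\<And>k. k \<in> L \<Longrightarrow> f k \<in> J \<and> el k (f k) \<in> stab \<nu>" by blast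
  define c where "c = inverse (of_nat (card L) :: 'k)"
  have cL: "c * of_nat (card L) = 1" using card_K_nonzero[OF L] by (simp add: c_def)
  define v where "v = c *s (\<Sum>k\<in>L. inv k \<triangleright> f k)"
  have sJ: "(\<Sum>k\<in>L. inv k \<triangleright> f k) \<in> J" using f Lc by (intro J_sum) auto
  then have v: "v \<in> J" by (simp add: v_def)
  define \<eta> where "\<eta> = translate (el \<one> v) \<nu>"
  have n: "el \<one> v \<in> Q" using v subgroup.one_closed[OF K] by simp
  have \<eta>: "\<eta> \<in> agree R \<mu>" unfolding \<eta>_def by (rule translate_agree[OF n \<nu>])
  \<comment> \<open>As a mean of the forms y to \<nu>(y k^-1), \<eta> is right invariant by a mere
    reindexing.\<close>
  have \<eta>_val: "\<eta> y = c * (\<Sum>k\<in>L. \<nu> (y \<triangleleft> inv k))" if y: "y \<in> J" for y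
  proof -
    have "\<nu> (y * (inv k \<triangleright> f k)) = \<nu> (y \<triangleleft> inv k) - \<nu> y" if k: "k \<in> L" for k
    proof -
      have kc: "k \<in> carrier H" "k \<in> K" using k Lc LK by auto
      have "\<nu> ((y \<triangleleft> inv k) \<triangleleft> k + (y \<triangleleft> inv k) * f k) = \<nu> (y \<triangleleft> inv k)"
        using f[OF k] stab_el[OF \<nu> kc(2), of "f k"] kc y
        by (meson H.inv_closed ract_closed)
      then show ?thesis
        using kc y f[OF k] nud by (simp add: middle_times dual_simps algebra_simps)
    qed
    moreover have "\<eta> y = \<nu> y + c * (\<Sum>k\<in>L. \<nu> (y * (inv k \<triangleright> f k)))"
    proof -
      have "\<eta> y = \<nu> (y + y * v)" using y by (simp add: \<eta>_def translate_el ract_one)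
      also have "\<dots> = \<nu> y + c * \<nu> (y * (\<Sum>k\<in>L. inv k \<triangleright> f k))"
        using y sJ nud by (simp add: v_def J_scale_right dual_simps)
      also have "\<nu> (y * (\<Sum>k\<in>L. inv k \<triangleright> f k)) = (\<Sum>k\<in>L. \<nu> (y * (inv k \<triangleright> f k)))"
        using y f Lc by (simp add: sum_distrib_left dual_sum[OF nud])
      finally show ?thesis .
    qed
    ultimately have "\<eta> y = \<nu> y + c * (\<Sum>k\<in>L. \<nu> (y \<triangleleft> inv k) - \<nu> y)" by simp
    also have "\<dots> = \<nu> y + c * (\<Sum>k\<in>L. \<nu> (y \<triangleleft> inv k)) - (c * of_nat (card L)) * \<nu> y"
      by (simp add: sum_subtractf algebra_simps)
    finally show ?thesis by (simp add: cL)
  qed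
  have right: "\<eta> (y \<triangleleft> l) = \<eta> y" if l: "l \<in> L" and y: "y \<in> J" for l y
  proof -
    have lc: "l \<in> carrier H" using l Lc by blast
    have "(\<Sum>k\<in>L. \<nu> ((y \<triangleleft> l) \<triangleleft> inv k)) = (\<Sum>k\<in>L. \<nu> (y \<triangleleft> inv k))"
    proof (rule sum.reindex_bij_witness[of _ "\<lambda>k. l \<otimes> k" "\<lambda>k. inv l \<otimes> k"])
      fix k assume k: "k \<in> L"
      then have kc: "k \<in> carrier H" using Lc by blast
      show "l \<otimes> (inv l \<otimes> k) = k" "inv l \<otimes> (l \<otimes> k) = k"
        using kc lc by (simp_all add: H.m_assoc[symmetric])
      show "inv l \<otimes> k \<in> L" "l \<otimes> k \<in> L"
        using k l L by (auto intro: subgroup.m_closed subgroup.m_inv_closed)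
      have "y \<triangleleft> inv (inv l \<otimes> k) = (y \<triangleleft> l) \<triangleleft> inv k"
        using kc lc y by (simp add: H.inv_mult_group H.m_comm[of "inv k" l] ract_mult[symmetric])
      then show "\<nu> (y \<triangleleft> inv (inv l \<otimes> k)) = \<nu> ((y \<triangleleft> l) \<triangleleft> inv k)" by simp
    qed
    then show ?thesis using lc y by (simp add: \<eta>_val)
  qed
  \<comment> \<open>Conjugation by 1 + v keeps \<open>H\<close>-parts, so the stabilizer of the new
    form still projects into \<open>L\<close>.\<close>
  have L_eq: "k \<in> L" if g: "el k x \<in> stab \<eta>" for k x
  proof -
    have gQ: "el k x \<in> Q" "translate (el k x) \<eta> = \<eta>" using g by (auto simp: stab_def)
    then have kx: "k \<in> K" "x \<in> J" "k \<in> carrier H" using K_carrier by auto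
    let ?n = "el \<one> v"
    have nG: "?n \<in> carrier G" and iQ: "inv\<^bsub>G\<^esub> ?n \<in> Q"
      using n subgroup_Q Q_carrier subgroup.m_inv_closed by metis+
    then have iG: "inv\<^bsub>G\<^esub> ?n \<in> carrier G" by simp
    obtain a where a: "a \<in> carrier H" "\<exists>u\<in>J. inv\<^bsub>G\<^esub> ?n = el a u" using iG by (metis G_cases)
    then obtain u where u: "u \<in> J" "inv\<^bsub>G\<^esub> ?n = el a u" by blast

    have gG: "el k x \<in> carrier G" using kx by simp
    obtain x' where x': "x' \<in> J" "inv\<^bsub>G\<^esub> ?n \<otimes>\<^bsub>G\<^esub> el k x \<otimes>\<^bsub>G\<^esub> inv\<^bsub>G\<^esub> (inv\<^bsub>G\<^esub> ?n) = el k x'"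
      using conj_el[OF a(1) u(1) kx(3,2)] unfolding u(2)[symmetric] by blast
    have "translate (inv\<^bsub>G\<^esub> ?n \<otimes>\<^bsub>G\<^esub> el k x \<otimes>\<^bsub>G\<^esub> ?n) \<nu> = translate (inv\<^bsub>G\<^esub> ?n) (translate (el k x) \<eta>)"
      using nG iG gG by (simp add: translate_mult \<eta>_def del: el_mult)
    also have "\<dots> = translate (inv\<^bsub>G\<^esub> ?n \<otimes>\<^bsub>G\<^esub> ?n) \<nu>"
      unfolding gQ(2) translate_mult[OF iG nG] by (simp only: \<eta>_def)
    also have "\<dots> = \<nu>" using nG nud by (simp add: translate_one)
    finally have "translate (el k x') \<nu> = \<nu>" using x'(2) nG by (simp del: el_mult)
    then show ?thesis using kx x' by (auto simp: L_def stab_def)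
  qed
  have "stab \<eta> = els L (J_left \<eta>)"
  proof -
    have "el k x \<in> stab \<eta> \<longleftrightarrow> x \<in> J_left \<eta>" if "k \<in> L" "x \<in> J" for k x
      using that LK Lc right agree_dual[OF \<eta>]
      by (subst stab_el[OF \<eta>]) (auto simp: J_left_def dual_simps)
    moreover have "k \<in> L \<and> x \<in> J" if "el k x \<in> stab \<eta>" for k x
      using L_eq[OF that] that by (simp add: stab_def)
    moreover have "J_left \<eta> \<subseteq> J" by (auto simp: J_left_def)
    moreover have "\<exists>k x. g = el k x" if "g \<in> stab \<eta>" for g
    proof -
      have "g \<in> Q" using that by (simp add: stab_def)
      then show ?thesis by (auto simp: els_def)
    qed
    ultimately show ?thesis unfolding els_def[of L] by blast
  qed
  moreover have "left_invariant L \<eta>" "right_invariant L \<eta>"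
    using agree_left_invariant[OF \<eta>] LK right by (auto simp: left_invariant_def right_invariant_def)
  ultimately have "split_stabilizer \<eta>" unfolding split_stabilizer_def using L LK by blast
  then show ?thesis unfolding \<eta>_def using n by blast
qed

text \<open>The trace formula lives in \<open>K + J\<close>; induction in stages carries both sides
  to \<open>G\<close>.\<close>

lemma induced_decomposition:
  obtains D where "D \<subseteq> agree R \<mu>" "\<And>\<nu>. \<nu> \<in> D \<Longrightarrow> split_stabilizer \<nu>"
    "\<And>g. g \<in> carrier G \<Longrightarrow> induced_character G (els K R) (xi \<epsilon> \<theta> \<mu>) g =
      (\<Sum>\<nu>\<in>D. induced_character G (stab \<nu>) (xi \<epsilon> \<theta> \<nu>) g)"
proof -
  obtain D where D: "D \<subseteq> agree R \<mu>" "\<And>\<nu>. \<nu> \<in> D \<Longrightarrow> split_stabilizer \<nu>"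
    "\<And>g. g \<in> Q \<Longrightarrow> (\<Sum>\<nu> | \<nu> \<in> agree R \<mu> \<and> translate g \<nu> = \<nu>. xi \<epsilon> \<theta> \<nu> g) =
      (\<Sum>\<nu>\<in>D. induced_character (G\<lparr>carrier := Q\<rparr>) (stab \<nu>) (xi \<epsilon> \<theta> \<nu>) g)"
    by (rule trace_decomposition[OF exists_split_stabilizer]) (assumption, rule that)
  have "induced_character G (els K R) (xi \<epsilon> \<theta> \<mu>) g =
      (\<Sum>\<nu>\<in>D. induced_character G (stab \<nu>) (xi \<epsilon> \<theta> \<nu>) g)" if g: "g \<in> carrier G" for g
  proof -
    have "induced_character G (els K R) (xi \<epsilon> \<theta> \<mu>) g =
        induced_character G Q (induced_character (G\<lparr>carrier := Q\<rparr>) (els K R) (xi \<epsilon> \<theta> \<mu>)) g"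
      by (rule G.induced_character_stages[OF finite_G subgroup_Q els_mono g, symmetric])
        (use R_J in auto)
    also have "\<dots> = induced_character G Q
        (\<lambda>s. \<Sum>\<nu>\<in>D. induced_character (G\<lparr>carrier := Q\<rparr>) (stab \<nu>) (xi \<epsilon> \<theta> \<nu>) s) g"
      by (rule induced_character_cong) (simp_all add: induced_eq_trace D(3))
    also have "\<dots> = (\<Sum>\<nu>\<in>D. induced_character G (stab \<nu>) (xi \<epsilon> \<theta> \<nu>) g)"
      unfolding induced_character_sum
    proof (rule sum.cong[OF refl])
      fix \<nu> assume "\<nu> \<in> D"
      show "induced_character G Q (induced_character (G\<lparr>carrier := Q\<rparr>) (stab \<nu>) (xi \<epsilon> \<theta> \<nu>)) g =
          induced_character G (stab \<nu>) (xi \<epsilon> \<theta> \<nu>) g"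
        by (rule G.induced_character_stages[OF finite_G subgroup_Q _ g]) (auto simp: stab_def)
    qed
    finally show ?thesis .
  qed
  then show thesis using that D by blast
qed

end

section \<open>Exchange of left and right annihilators\<close>

context triangular_type_character
begin

lemma subspace_J_right: assumes "l \<in> dual" shows "subspace (J_right l)"
  by (rule subspaceI) (use assms in \<open>auto simp: J_right_def dual_simps distrib_right J_simps\<close>)

text \<open>For \<open>R = J_right \<nu>\<close> the translates of \<nu> under 1 + J already exhaust
  the forms that agree with \<nu> on \<open>R\<close>: there are
  \<open>card J / card (J_left \<nu>)\<close> of them, which by \<open>card_J_left\<close> is the
  size of the whole coset. So the trace runs over one orbit, and the stabilizer of \<nu> has
  unipotent part \<open>J_left \<nu>\<close>.\<close>

lemma induced_left_eq_right:
  assumes K: "subgroup K H" and \<nu>: "\<nu> \<in> dual" "left_invariant K \<nu>" "right_invariant K \<nu>"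
    and g: "g \<in> carrier G"
  shows "induced_character G (els K (J_left \<nu>)) (xi \<epsilon> \<theta> \<nu>) g =
    induced_character G (els K (J_right \<nu>)) (xi \<epsilon> \<theta> \<nu>) g"
proof -
  have Kc: "k \<in> carrier H" if "k \<in> K" for k using that K subgroup.mem_carrier by metis
  let ?R = "J_right \<nu>"
  interpret right_ideal_character scale H J lact ract \<epsilon> K \<theta> ?R \<nu>
  proof (intro right_ideal_character.intro right_ideal_character_axioms.intro)
    show "triangular_type_character scale H J lact ract \<epsilon>" by (rule triangular_type_character_axioms)
    show "subspace ?R" using subspace_J_right \<nu> by blast
    show "k \<triangleright> x - x \<in> ?R" if "x \<in> J" "k \<in> K" for x k
      using that \<nu> Kc by (simp add: J_right_def left_diff_distrib dual_simps lact_times[symmetric] left_invariant_def)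
    show "x \<triangleleft> k \<in> ?R" if "x \<in> ?R" "k \<in> K" for x k
      using that Kc by (simp add: J_right_def middle_times[symmetric])
    show "x * y \<in> ?R" "\<nu> (x * y) = 0" if "x \<in> ?R" "y \<in> J" for x y
      using that by (simp_all add: J_right_def mult.assoc)
  qed (use K \<nu> in \<open>auto simp: J_right_def\<close>)
  have \<nu>M: "\<nu> \<in> agree ?R \<nu>" using \<nu> by (simp add: agree_def)
  let ?t = "\<lambda>z. translate (el \<one> z) \<nu>"
  have t: "?t z \<in> agree ?R \<nu>" if "z \<in> J" for z
    using translate_agree[OF _ \<nu>M] that subgroup.one_closed[OF K] by simp
  have fib: "?t z = ?t z' \<longleftrightarrow> z - z' \<in> J_left \<nu>" if "z \<in> J" "z' \<in> J" for z z'
  proof -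
    have "?t z = ?t z' \<longleftrightarrow> (\<forall>y\<in>J. ?t z y = ?t z' y)"
      using dual_eqI t[THEN agree_dual] that by metis
    also have "\<dots> \<longleftrightarrow> z - z' \<in> J_left \<nu>"
      using that \<nu>(1) by (simp add: translate_el J_left_def dual_simps ract_one right_diff_distrib)
    finally show ?thesis .
  qed
  have jl: "x \<in> J" if "x \<in> J_left \<nu>" for x using that by (simp add: J_left_def)
  \<comment> \<open>The fibres of z to the translate under 1 + z are the cosets of
    \<open>J_left \<nu>\<close>.\<close>
  have "card J = (\<Sum>\<eta>\<in>?t ` J. card {z \<in> J. ?t z = \<eta>})"
    using sum.image_gen[OF finite_J, of "\<lambda>_. 1::nat" ?t] by simp
  also have "\<dots> = (\<Sum>\<eta>\<in>?t ` J. card (J_left \<nu>))"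
  proof (rule sum.cong[OF refl])
    fix \<eta> assume "\<eta> \<in> ?t ` J"
    then obtain z where z: "z \<in> J" "\<eta> = ?t z" by blast
    have "bij_betw (\<lambda>x. x + z) (J_left \<nu>) {z \<in> J. ?t z = \<eta>}"
      by (rule bij_betw_byWitness[where f' = "\<lambda>x. x - z"])
        (use z jl in \<open>auto simp: fib\<close>)
    then show "card {z \<in> J. ?t z = \<eta>} = card (J_left \<nu>)"
      by (rule bij_betw_same_card[symmetric])
  qed
  also have "\<dots> = card (?t ` J) * card (J_left \<nu>)" by simp
  finally have "card (?t ` J) * card ?R = card (agree ?R \<nu>) * card ?R"
    using card_agree[OF R_subspace R_J \<nu>(1)] card_J_left[OF \<nu>(1)] by metis
  moreover have "card ?R > 0"
    using finite_subset[OF R_J finite_J] subspace_0[OF R_subspace] by (auto simp: card_gt_0_iff)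
  ultimately have "?t ` J = agree ?R \<nu>"
    using t by (intro card_subset_eq[OF finite_agree]) auto
  moreover have "?t ` J \<subseteq> orb \<nu>"
    using subgroup.one_closed[OF K] by (auto simp: orb_def)
  moreover have "orb \<nu> \<subseteq> agree ?R \<nu>"
    using translate_agree[OF _ \<nu>M] by (auto simp: orb_def)
  ultimately have orb: "orb \<nu> = agree ?R \<nu>" by blast
  have "el k x \<in> stab \<nu> \<longleftrightarrow> x \<in> J_left \<nu>" if "k \<in> K" "x \<in> J" for k x
    unfolding stab_def using that Kc \<nu>
    by (auto simp: translate_fixed_iff J_left_def dual_simps right_invariant_def)
  moreover have "J_left \<nu> \<subseteq> J" by (auto simp: J_left_def)
  moreover have "\<exists>k x. k \<in> K \<and> x \<in> J \<and> g = el k x" if "g \<in> stab \<nu>" for g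
  proof -
    have "g \<in> Q" using that by (simp add: stab_def)
    then show ?thesis by (auto simp: els_def)
  qed
  ultimately have stab: "stab \<nu> = els K (J_left \<nu>)" unfolding els_def[of K "J_left \<nu>"] by blast
  have "induced_character G (els K ?R) (xi \<epsilon> \<theta> \<nu>) g =
      induced_character G Q (induced_character (G\<lparr>carrier := Q\<rparr>) (els K ?R) (xi \<epsilon> \<theta> \<nu>)) g"
    by (rule G.induced_character_stages[OF finite_G subgroup_Q els_mono g, symmetric])
      (use R_J in auto)
  also have "\<dots> = induced_character G Q
      (induced_character (G\<lparr>carrier := Q\<rparr>) (stab \<nu>) (xi \<epsilon> \<theta> \<nu>)) g"
    by (rule induced_character_cong) (simp_all add: induced_eq_trace trace_orb[OF \<nu>M, symmetric] orb)
  also have "\<dots> = induced_character G (stab \<nu>) (xi \<epsilon> \<theta> \<nu>) g"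
    by (rule G.induced_character_stages[OF finite_G subgroup_Q _ g]) (auto simp: stab_def)
  finally show ?thesis unfolding stab by simp
qed

end

section \<open>Nonnegative integral combinations of supercharacters\<close>

context triangular_type
begin

text \<open>The conclusion of the theorem as a predicate. Equality is demanded on the group only,
  because outside it the functions are whatever their formulas happen to give.\<close>

definition nat_combination :: "('k \<Rightarrow> complex) \<Rightarrow> (('h \<Rightarrow> 'k) \<times> 'a \<Rightarrow> complex) \<Rightarrow> bool" where
  "nat_combination \<epsilon> \<phi> \<longleftrightarrow> (\<exists>S (m :: (('h \<Rightarrow> 'k) \<times> 'a \<Rightarrow> complex) \<Rightarrow> nat). finite S \<and>
    S \<subseteq> supercharacters \<epsilon> \<and> (\<forall>g\<in>carrier G. \<phi> g = (\<Sum>\<psi>\<in>S. of_nat (m \<psi>) * \<psi> g)))"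

lemma nat_combination_cong:
  assumes "nat_combination \<epsilon> \<phi>" "\<And>g. g \<in> carrier G \<Longrightarrow> \<phi>' g = \<phi> g"
  shows "nat_combination \<epsilon> \<phi>'"
  using assms(1) unfolding nat_combination_def by (simp add: assms(2) cong: ball_cong)

lemma nat_combination_supercharacter:
  "\<psi> \<in> supercharacters \<epsilon> \<Longrightarrow> nat_combination \<epsilon> \<psi>"
  unfolding nat_combination_def by (intro exI[of _ "{\<psi>}"] exI[of _ "\<lambda>_. 1"]) simp

lemma nat_combination_add:
  assumes "nat_combination \<epsilon> \<phi>" "nat_combination \<epsilon> \<psi>"
  shows "nat_combination \<epsilon> (\<lambda>g. \<phi> g + \<psi> g)"
proof -
  obtain S and m :: "_ \<Rightarrow> nat" where S: "finite S" "S \<subseteq> supercharacters \<epsilon>"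
    "\<And>g. g \<in> carrier G \<Longrightarrow> \<phi> g = (\<Sum>\<psi>\<in>S. of_nat (m \<psi>) * \<psi> g)"
    using assms(1) unfolding nat_combination_def by blast
  obtain T and n :: "_ \<Rightarrow> nat" where T: "finite T" "T \<subseteq> supercharacters \<epsilon>"
    "\<And>g. g \<in> carrier G \<Longrightarrow> \<psi> g = (\<Sum>\<psi>\<in>T. of_nat (n \<psi>) * \<psi> g)"
    using assms(2) unfolding nat_combination_def by blast
  \<comment> \<open>A supercharacter that occurs in both sums receives the sum of its
    multiplicities.\<close>
  define l where "l \<chi> = (if \<chi> \<in> S then m \<chi> else 0) + (if \<chi> \<in> T then n \<chi> else 0)" for \<chi>
  have ext: "(\<Sum>\<chi>\<in>S. of_nat (m \<chi>) * \<chi> g) = (\<Sum>\<chi>\<in>S \<union> T. of_nat (if \<chi> \<in> S then m \<chi> else 0) * \<chi> g)"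
    "(\<Sum>\<chi>\<in>T. of_nat (n \<chi>) * \<chi> g) = (\<Sum>\<chi>\<in>S \<union> T. of_nat (if \<chi> \<in> T then n \<chi> else 0) * \<chi> g)"
    for g :: "('h \<Rightarrow> 'k) \<times> 'a"
    by (rule sum.mono_neutral_cong_left; use S T in auto)+
  have "\<phi> g + \<psi> g = (\<Sum>\<chi>\<in>S \<union> T. of_nat (l \<chi>) * \<chi> g)" if "g \<in> carrier G" for g
    unfolding S(3)[OF that] T(3)[OF that] ext
    by (simp add: l_def sum.distrib[symmetric] distrib_right)
  then show ?thesis
    unfolding nat_combination_def using S T by (intro exI[of _ "S \<union> T"] exI[of _ l]) auto
qed

lemma nat_combination_sum:
  assumes "\<And>i. i \<in> I \<Longrightarrow> nat_combination \<epsilon> (f i)"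
  shows "nat_combination \<epsilon> (\<lambda>g. \<Sum>i\<in>I. f i g)"
proof -
  have zero: "nat_combination \<epsilon> (\<lambda>_. 0)"
    unfolding nat_combination_def by (intro exI[of _ "{}"]) simp
  show ?thesis
    using assms
    by (induction I rule: infinite_finite_induct) (auto simp: zero intro: nat_combination_add)
qed

end

section \<open>Idempotents and the algebra\<close>

context triangular_type
begin

text \<open>The product of \<open>kH\<close>, as a sum over all pairs with an indicator so that sums
  can be interchanged; \<open>A_mult\<close> identifies it with the product of
  \<open>A\<close>.\<close>

definition conv :: "('h \<Rightarrow> 'k) \<Rightarrow> ('h \<Rightarrow> 'k) \<Rightarrow> 'h \<Rightarrow> 'k" where
  "conv f g h = (\<Sum>u\<in>carrier H. \<Sum>v\<in>carrier H. f u * g v * (if u \<otimes> v = h then 1 else 0))"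

definition Lk :: "('h \<Rightarrow> 'k) \<Rightarrow> 'a \<Rightarrow> 'a" where "Lk f x = (\<Sum>h\<in>carrier H. f h *s (h \<triangleright> x))"

definition Rk :: "'a \<Rightarrow> ('h \<Rightarrow> 'k) \<Rightarrow> 'a" where "Rk x f = (\<Sum>h\<in>carrier H. f h *s (x \<triangleleft> h))"

definition supp_H :: "('h \<Rightarrow> 'k) set" where "supp_H = {f. \<forall>h. h \<notin> carrier H \<longrightarrow> f h = 0}"

lemma A_mult: "(f, x) \<otimes>\<^bsub>A\<^esub> (g, y) = (conv f g, Lk f y + Rk x g + x * y)"
proof -
  have "(\<Sum>(u, v) \<in> {(u, v). u \<in> carrier H \<and> v \<in> carrier H \<and> u \<otimes> v = h}. f u * g v) = conv f g h" for h
  proof -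
    have "(\<Sum>(u, v) \<in> {(u, v). u \<in> carrier H \<and> v \<in> carrier H \<and> u \<otimes> v = h}. f u * g v) =
      (\<Sum>p \<in> {p \<in> carrier H \<times> carrier H. fst p \<otimes> snd p = h}. f (fst p) * g (snd p))"
      by (rule sum.cong) auto
    also have "\<dots> = (\<Sum>p\<in>carrier H \<times> carrier H. if fst p \<otimes> snd p = h then f (fst p) * g (snd p) else 0)"
      using H_finite by (subst sum.inter_filter) auto
    also have "\<dots> = conv f g h"
      unfolding conv_def sum.cartesian_product by (rule sum.cong) auto
    finally show ?thesis .
  qed
  then show ?thesis by (simp add: A_def Lk_def Rk_def)
qed

lemma A_add: "(f, x) \<oplus>\<^bsub>A\<^esub> (g, y) = (\<lambda>h. f h + g h, x + y)"
  by (simp add: A_def)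

lemma A_carrier: "carrier A = supp_H \<times> J"
  by (simp add: A_def supp_H_def)

lemma A_one: "\<one>\<^bsub>A\<^esub> = el \<one> 0" and A_zero: "\<zero>\<^bsub>A\<^esub> = (\<lambda>_. 0, 0)"
  by (simp_all add: A_def el_def)

lemma conv_supp: "conv f g \<in> supp_H"
  by (auto simp: conv_def supp_H_def intro!: sum.neutral)

text \<open>Pairing with \<open>F\<close> is the linear extension of \<open>F\<close> to
  \<open>kH\<close>. Through it, and its analogue \<open>sum_conv_scale\<close> with values in
  \<open>J\<close>, associativity of \<open>conv\<close> and the module laws reduce to the laws for
  single elements of \<open>H\<close>.\<close>

lemma sum_conv:
  "(\<Sum>w\<in>carrier H. conv f g w * F w) = (\<Sum>u\<in>carrier H. \<Sum>v\<in>carrier H. f u * g v * F (u \<otimes> v))"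
proof -
  have "(\<Sum>w\<in>carrier H. conv f g w * F w) =
    (\<Sum>w\<in>carrier H. \<Sum>u\<in>carrier H. \<Sum>v\<in>carrier H. if u \<otimes> v = w then f u * g v * F w else 0)"
    unfolding conv_def sum_distrib_right by (intro sum.cong refl) auto
  also have "\<dots> = (\<Sum>u\<in>carrier H. \<Sum>v\<in>carrier H. \<Sum>w\<in>carrier H. if u \<otimes> v = w then f u * g v * F w else 0)"
    by (subst sum.swap, rule sum.cong[OF refl], rule sum.swap)
  also have "\<dots> = (\<Sum>u\<in>carrier H. \<Sum>v\<in>carrier H. f u * g v * F (u \<otimes> v))"
    using H_finite by (intro sum.cong refl) simp
  finally show ?thesis .
qed

lemma sum_conv_scale:
  "(\<Sum>w\<in>carrier H. conv f g w *s F w) = (\<Sum>u\<in>carrier H. \<Sum>v\<in>carrier H. (f u * g v) *s F (u \<otimes> v))"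
proof -
  have "(\<Sum>w\<in>carrier H. conv f g w *s F w) =
    (\<Sum>w\<in>carrier H. \<Sum>u\<in>carrier H. \<Sum>v\<in>carrier H. if u \<otimes> v = w then (f u * g v) *s F w else 0)"
    unfolding conv_def scale_sum_left by (intro sum.cong refl) auto
  also have "\<dots> = (\<Sum>u\<in>carrier H. \<Sum>v\<in>carrier H. \<Sum>w\<in>carrier H. if u \<otimes> v = w then (f u * g v) *s F w else 0)"
    by (subst sum.swap, rule sum.cong[OF refl], rule sum.swap)
  also have "\<dots> = (\<Sum>u\<in>carrier H. \<Sum>v\<in>carrier H. (f u * g v) *s F (u \<otimes> v))"
    using H_finite by (intro sum.cong refl) simp
  finally show ?thesis .
qed

lemma conv_comm: "conv f g = conv g f"
proof
  fix h
  have "conv f g h = (\<Sum>v\<in>carrier H. \<Sum>u\<in>carrier H. f u * g v * (if u \<otimes> v = h then 1 else 0))"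
    unfolding conv_def by (rule sum.swap)
  also have "\<dots> = conv g f h"
    unfolding conv_def by (intro sum.cong refl) (simp add: H.m_comm mult.commute)
  finally show "conv f g h = conv g f h" .
qed

lemma conv_assoc: "conv (conv f g) p = conv f (conv g p)"
proof
  fix h
  have "conv (conv f g) p h = (\<Sum>w\<in>carrier H. conv f g w * (\<Sum>v\<in>carrier H. p v * (if w \<otimes> v = h then 1 else 0)))"
    by (subst conv_def) (simp add: sum_distrib_left mult.assoc)
  also have "\<dots> = (\<Sum>u\<in>carrier H. \<Sum>v\<in>carrier H. \<Sum>w\<in>carrier H.
      f u * g v * (p w * (if (u \<otimes> v) \<otimes> w = h then 1 else 0)))"
    by (simp only: sum_conv) (simp only: sum_distrib_left)
  also have "\<dots> = (\<Sum>u\<in>carrier H. f u * (\<Sum>v\<in>carrier H. \<Sum>w\<in>carrier H.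
      g v * p w * (if u \<otimes> (v \<otimes> w) = h then 1 else 0)))"
    by (simp add: sum_distrib_left H.m_assoc mult.assoc cong: sum.cong)
  also have "\<dots> = (\<Sum>u\<in>carrier H. f u * (\<Sum>w\<in>carrier H. conv g p w * (if u \<otimes> w = h then 1 else 0)))"
    by (simp only: sum_conv)
  also have "\<dots> = conv f (conv g p) h"
    by (subst (2) conv_def) (simp add: sum_distrib_left mult.assoc)
  finally show "conv (conv f g) p h = conv f (conv g p) h" .
qed

lemma Lk_closed [simp]: "x \<in> J \<Longrightarrow> Lk f x \<in> J" and Rk_closed [simp]: "x \<in> J \<Longrightarrow> Rk x f \<in> J"
  unfolding Lk_def Rk_def by (auto intro: J_sum)

lemma Lk_add: "x \<in> J \<Longrightarrow> y \<in> J \<Longrightarrow> Lk f (x + y) = Lk f x + Lk f y"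
  and Rk_add: "x \<in> J \<Longrightarrow> y \<in> J \<Longrightarrow> Rk (x + y) f = Rk x f + Rk y f"
  by (simp_all add: Lk_def Rk_def lact_add ract_add scale_right_distrib sum.distrib)

lemma Lk_plus: "Lk (\<lambda>h. f h + g h) x = Lk f x + Lk g x"
  and Rk_plus: "Rk x (\<lambda>h. f h + g h) = Rk x f + Rk x g"
  by (simp_all add: Lk_def Rk_def scale_left_distrib sum.distrib)

lemma Lk_scale: "x \<in> J \<Longrightarrow> Lk f (c *s x) = c *s Lk f x"
  and Rk_scale: "x \<in> J \<Longrightarrow> Rk (c *s x) f = c *s Rk x f"
  by (simp_all add: Lk_def Rk_def lact_scale ract_scale scale_sum_right mult.commute)

lemma Lk_zero [simp]: "Lk (\<lambda>_. 0) x = 0" "Lk f 0 = 0"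
  and Rk_zero [simp]: "Rk x (\<lambda>_. 0) = 0" "Rk 0 f = 0"
  by (simp_all add: Lk_def Rk_def)

lemma Lk_delta: "h \<in> carrier H \<Longrightarrow> Lk (\<lambda>u. if u = h then 1 else 0) x = h \<triangleright> x"
  and Rk_delta: "h \<in> carrier H \<Longrightarrow> Rk x (\<lambda>u. if u = h then 1 else 0) = x \<triangleleft> h"
  by (simp_all add: Lk_def Rk_def sum_delta_scale)

lemma Lk_conv: assumes x: "x \<in> J" shows "Lk (conv f g) x = Lk f (Lk g x)"
proof -
  have "Lk f (Lk g x) = (\<Sum>u\<in>carrier H. \<Sum>v\<in>carrier H. (f u * g v) *s ((u \<otimes> v) \<triangleright> x))"
    using x by (simp add: Lk_def lact_sum lact_scale lact_mult scale_sum_right)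
  then show ?thesis by (simp add: Lk_def sum_conv_scale)
qed

lemma Rk_conv: assumes x: "x \<in> J" shows "Rk x (conv f g) = Rk (Rk x f) g"
proof -
  have "Rk (Rk x f) g = (\<Sum>v\<in>carrier H. \<Sum>u\<in>carrier H. (f u * g v) *s (x \<triangleleft> (u \<otimes> v)))"
    using x by (simp add: Rk_def ract_sum ract_scale ract_mult scale_sum_right mult.commute)
  also have "\<dots> = (\<Sum>u\<in>carrier H. \<Sum>v\<in>carrier H. (f u * g v) *s (x \<triangleleft> (u \<otimes> v)))"
    by (rule sum.swap)
  finally show ?thesis by (simp add: Rk_def sum_conv_scale)
qed

lemma Lk_Rk: assumes x: "x \<in> J" shows "Rk (Lk f x) g = Lk f (Rk x g)"
proof -
  have "Rk (Lk f x) g = (\<Sum>v\<in>carrier H. \<Sum>u\<in>carrier H. (f u * g v) *s (u \<triangleright> (x \<triangleleft> v)))"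
    using x by (simp add: Lk_def Rk_def ract_sum ract_scale actions_commute scale_sum_right mult.commute)
  also have "\<dots> = (\<Sum>u\<in>carrier H. \<Sum>v\<in>carrier H. (f u * g v) *s (u \<triangleright> (x \<triangleleft> v)))"
    by (rule sum.swap)
  also have "\<dots> = Lk f (Rk x g)"
    using x by (simp add: Lk_def Rk_def lact_sum lact_scale scale_sum_right)
  finally show ?thesis .
qed

lemma Lk_times: "x \<in> J \<Longrightarrow> y \<in> J \<Longrightarrow> Lk f (x * y) = Lk f x * y"
  and Rk_times: "x \<in> J \<Longrightarrow> y \<in> J \<Longrightarrow> Rk (x * y) f = x * Rk y f"
  and Rk_middle: "x \<in> J \<Longrightarrow> y \<in> J \<Longrightarrow> x * Lk f y = Rk x f * y"
  by (simp_all add: Lk_def Rk_def sum_distrib_left sum_distrib_right lact_times ract_times middle_times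
      J_scale_left J_scale_right)

lemma conv_plus: "conv f (\<lambda>h. g h + p h) = (\<lambda>h. conv f g h + conv f p h)"
  "conv (\<lambda>h. g h + p h) f = (\<lambda>h. conv g f h + conv p f h)"
  by (simp_all add: conv_def fun_eq_iff distrib_left distrib_right sum.distrib)

lemma conv_zero [simp]: "conv f (\<lambda>_. 0) = (\<lambda>_. 0)" "conv (\<lambda>_. 0) f = (\<lambda>_. 0)"
  by (simp_all add: conv_def fun_eq_iff)

lemma conv_one: assumes "f \<in> supp_H" shows "conv (\<lambda>u. if u = \<one> then 1 else 0) f = f"
proof
  fix h
  have "conv (\<lambda>u. if u = \<one> then 1 else 0) f h =
    (\<Sum>u\<in>carrier H. if u = \<one> then (\<Sum>v\<in>carrier H. f v * (if u \<otimes> v = h then 1 else 0)) else 0)"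
    unfolding conv_def by (intro sum.cong refl) auto
  also have "\<dots> = (\<Sum>v\<in>carrier H. f v * (if \<one> \<otimes> v = h then 1 else 0))"
    using H_finite by simp
  also have "\<dots> = (\<Sum>v\<in>carrier H. if v = h then f v else 0)"
    by (intro sum.cong refl) auto
  also have "\<dots> = f h" using assms H_finite by (simp add: supp_H_def)
  finally show "conv (\<lambda>u. if u = \<one> then 1 else 0) f h = f h" .
qed

lemma ring_A: "ring A"
proof (rule ringI)
  show "abelian_group A"
  proof (rule abelian_groupI)
    fix a assume "a \<in> carrier A"
    then show "\<exists>b\<in>carrier A. b \<oplus>\<^bsub>A\<^esub> a = \<zero>\<^bsub>A\<^esub>"
      by (intro bexI[of _ "(\<lambda>h. - fst a h, - snd a)"])
        (auto simp: A_carrier supp_H_def A_add A_zero)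
  qed (auto simp: A_carrier supp_H_def A_add A_zero add_ac)
  show "monoid A"
  proof (rule monoidI)
    show "\<one>\<^bsub>A\<^esub> \<in> carrier A" by (auto simp: A_one el_def A_carrier supp_H_def)
    fix a b assume "a \<in> carrier A" "b \<in> carrier A"
    then obtain f x g y where a: "a = (f, x)" "f \<in> supp_H" "x \<in> J" and b: "b = (g, y)" "g \<in> supp_H" "y \<in> J"
      by (auto simp: A_carrier)
    show "a \<otimes>\<^bsub>A\<^esub> b \<in> carrier A" using a b by (simp add: A_mult A_carrier conv_supp)
    show "\<one>\<^bsub>A\<^esub> \<otimes>\<^bsub>A\<^esub> a = a"
      using a by (simp add: A_one el_def A_mult conv_one Lk_delta lact_one)
    show "a \<otimes>\<^bsub>A\<^esub> \<one>\<^bsub>A\<^esub> = a"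
      using a by (simp add: A_one el_def A_mult conv_comm[of f] conv_one Rk_delta ract_one)
    fix c assume "c \<in> carrier A"
    then obtain p z where c: "c = (p, z)" "p \<in> supp_H" "z \<in> J" by (auto simp: A_carrier)
    show "a \<otimes>\<^bsub>A\<^esub> b \<otimes>\<^bsub>A\<^esub> c = a \<otimes>\<^bsub>A\<^esub> (b \<otimes>\<^bsub>A\<^esub> c)"
      using a b c by (simp add: A_mult conv_assoc Lk_add Rk_add Lk_conv Rk_conv Lk_Rk Lk_times Rk_times
          Rk_middle algebra_simps)
  qed
  fix a b c assume "a \<in> carrier A" "b \<in> carrier A" "c \<in> carrier A"
  then show "(a \<oplus>\<^bsub>A\<^esub> b) \<otimes>\<^bsub>A\<^esub> c = a \<otimes>\<^bsub>A\<^esub> c \<oplus>\<^bsub>A\<^esub> b \<otimes>\<^bsub>A\<^esub> c"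
    "c \<otimes>\<^bsub>A\<^esub> (a \<oplus>\<^bsub>A\<^esub> b) = c \<otimes>\<^bsub>A\<^esub> a \<oplus>\<^bsub>A\<^esub> c \<otimes>\<^bsub>A\<^esub> b"
    by (auto simp: A_carrier A_add A_mult conv_plus Lk_plus Rk_plus Lk_add Rk_add algebra_simps)
qed

sublocale A: ring A by (rule ring_A)

lemma G_mult: "g \<otimes>\<^bsub>G\<^esub> h = g \<otimes>\<^bsub>A\<^esub> h" by (simp add: G_def)

lemma el_in_A [simp]: "h \<in> carrier H \<Longrightarrow> x \<in> J \<Longrightarrow> el h x \<in> carrier A"
  by (auto simp: el_def A_carrier supp_H_def)

lemma G_in_A: "g \<in> carrier G \<Longrightarrow> g \<in> carrier A"
  by (auto simp: carrier_G)

lemma of_H_eq: "of_H h = el h 0" by (simp add: of_H_def el_def)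

lemma of_J_in_A [simp]: "x \<in> J \<Longrightarrow> of_J x \<in> carrier A"
  by (simp add: of_J_def A_carrier supp_H_def)

lemma snd_of_J [simp]: "snd (of_J x) = x" by (simp add: of_J_def)

lemma kH_in_A: "z \<in> kH \<Longrightarrow> z \<in> carrier A" by (simp add: kH_def)

lemma kH_mult: "a \<in> kH \<Longrightarrow> b \<in> kH \<Longrightarrow> a \<otimes>\<^bsub>A\<^esub> b \<in> kH"
  by (auto simp: kH_def A_carrier A_mult conv_supp)

lemma kH_comm: "a \<in> kH \<Longrightarrow> b \<in> kH \<Longrightarrow> a \<otimes>\<^bsub>A\<^esub> b = b \<otimes>\<^bsub>A\<^esub> a"
  by (auto simp: kH_def A_carrier A_mult conv_comm)

lemma of_H_in_kH: "h \<in> carrier H \<Longrightarrow> of_H h \<in> kH"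
  by (simp add: kH_def of_H_eq)

lemma finite_kH: "finite kH"
proof -
  have "finite {f :: 'h \<Rightarrow> 'k. \<forall>x. (x \<in> carrier H \<longrightarrow> f x \<in> UNIV) \<and> (x \<notin> carrier H \<longrightarrow> f x = 0)}"
    using H_finite by (intro finite_set_of_finite_funs) auto
  moreover have "kH \<subseteq> {f :: 'h \<Rightarrow> 'k. \<forall>x. (x \<in> carrier H \<longrightarrow> f x \<in> UNIV) \<and> (x \<notin> carrier H \<longrightarrow> f x = 0)} \<times> {0}"
    by (auto simp: kH_def A_carrier supp_H_def)
  ultimately show ?thesis by (meson finite.emptyI finite.insertI finite_SigmaI finite_subset)
qed

text \<open>\<open>J\<close> is an ideal of \<open>A\<close>, so taking the second component in
  \<open>sandwich\<close> loses nothing.\<close>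

lemma of_J_sandwich:
  assumes "a \<in> carrier A" "b \<in> carrier A" "x \<in> J"
  shows "a \<otimes>\<^bsub>A\<^esub> of_J x \<otimes>\<^bsub>A\<^esub> b = of_J (sandwich a x b)" and "sandwich a x b \<in> J"
proof -
  show "a \<otimes>\<^bsub>A\<^esub> of_J x \<otimes>\<^bsub>A\<^esub> b = of_J (sandwich a x b)"
    by (cases a; cases b) (simp add: sandwich_def of_J_def A_mult)
  show "sandwich a x b \<in> J"
    using assms by (auto simp: sandwich_def of_J_def A_mult A_carrier)
qed

lemma sandwich_sandwich:
  assumes "a \<in> carrier A" "b \<in> carrier A" "c \<in> carrier A" "d \<in> carrier A" "x \<in> J"
  shows "sandwich a (sandwich b x c) d = sandwich (a \<otimes>\<^bsub>A\<^esub> b) x (c \<otimes>\<^bsub>A\<^esub> d)"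
proof -
  have "a \<otimes>\<^bsub>A\<^esub> of_J (sandwich b x c) \<otimes>\<^bsub>A\<^esub> d = (a \<otimes>\<^bsub>A\<^esub> b) \<otimes>\<^bsub>A\<^esub> of_J x \<otimes>\<^bsub>A\<^esub> (c \<otimes>\<^bsub>A\<^esub> d)"
    using assms by (simp add: of_J_sandwich(1)[symmetric] A.m_assoc)
  then show ?thesis by (simp add: sandwich_def)
qed

lemma sandwich_add: "a \<in> carrier A \<Longrightarrow> b \<in> carrier A \<Longrightarrow> x \<in> J \<Longrightarrow> y \<in> J \<Longrightarrow>
    sandwich a (x + y) b = sandwich a x b + sandwich a y b"
  and sandwich_scale: "a \<in> carrier A \<Longrightarrow> b \<in> carrier A \<Longrightarrow> x \<in> J \<Longrightarrow>
    sandwich a (c *s x) b = c *s sandwich a x b"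
  by (auto simp: sandwich_def of_J_def A_mult A_carrier Lk_add Rk_add Lk_scale Rk_scale J_scale_left
      J_scale_right scale_right_distrib algebra_simps)

lemma sandwich_el:
  assumes "h \<in> carrier H" "g \<in> carrier H" "x \<in> J" "u \<in> J" "v \<in> J"
  shows "sandwich (el h u) x (el g v) = (h \<triangleright> x + u * x) \<triangleleft> g + (h \<triangleright> x + u * x) * v"
  using assms by (simp add: sandwich_def of_J_def el_def A_mult Lk_delta Rk_delta)

lemma sandwich_add_left:
  "a \<in> carrier A \<Longrightarrow> b \<in> carrier A \<Longrightarrow> c \<in> carrier A \<Longrightarrow> x \<in> J \<Longrightarrow>
    sandwich (a \<oplus>\<^bsub>A\<^esub> b) x c = sandwich a x c + sandwich b x c"
  and sandwich_add_right:
  "a \<in> carrier A \<Longrightarrow> b \<in> carrier A \<Longrightarrow> c \<in> carrier A \<Longrightarrow> x \<in> J \<Longrightarrow>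
    sandwich c x (a \<oplus>\<^bsub>A\<^esub> b) = sandwich c x a + sandwich c x b"
  by (auto simp: sandwich_def of_J_def A_carrier A_add A_mult Lk_plus Rk_plus Rk_add algebra_simps)

lemma sandwich_zero: "x \<in> J \<Longrightarrow> a \<in> carrier A \<Longrightarrow> sandwich \<zero>\<^bsub>A\<^esub> x a = 0 \<and> sandwich a x \<zero>\<^bsub>A\<^esub> = 0"
  by (auto simp: sandwich_def of_J_def A_carrier A_zero A_mult)

lemma idempotentD:
  assumes "e \<in> idempotents"
  shows "e \<in> kH" "e \<in> carrier A" "e \<otimes>\<^bsub>A\<^esub> e = e"
  using assms kH_in_A by (auto simp: idempotents_def)

text \<open>Peirce decomposition: x is exe plus three terms that involve e', so a form vanishing on
  those satisfies l(exe) = l(x). The converse applies this identity to each of the three terms and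
  uses ee' = e'e = 0.\<close>

lemma dual_e_iff:
  assumes e: "e \<in> idempotents"
  shows "l \<in> dual_e e \<longleftrightarrow> l \<in> dual \<and> (\<forall>x\<in>J. l (sandwich e x e) = l x)"
proof -
  define e' where "e' = \<one>\<^bsub>A\<^esub> \<ominus>\<^bsub>A\<^esub> e"
  note eA = idempotentD[OF e]
  have e'A: "e' \<in> carrier A" using eA by (simp add: e'_def)
  have ee': "e \<otimes>\<^bsub>A\<^esub> e' = \<zero>\<^bsub>A\<^esub>" "e' \<otimes>\<^bsub>A\<^esub> e = \<zero>\<^bsub>A\<^esub>"
    using eA by (simp_all add: e'_def A.minus_eq A.r_distr A.l_distr A.r_minus A.l_minus A.r_neg)
  have one: "\<one>\<^bsub>A\<^esub> = e \<oplus>\<^bsub>A\<^esub> e'"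
    using eA by (simp add: e'_def A.minus_eq A.a_lcomm[of e] A.r_neg)
  have split: "x = sandwich e x e + sandwich e x e' + (sandwich e' x e + sandwich e' x e')"
    if x: "x \<in> J" for x
  proof -
    have "x = sandwich \<one>\<^bsub>A\<^esub> x \<one>\<^bsub>A\<^esub>"
      using x by (simp add: A_one sandwich_el lact_one ract_one)
    also have "\<dots> = sandwich (e \<oplus>\<^bsub>A\<^esub> e') x (e \<oplus>\<^bsub>A\<^esub> e')" using one by simp
    also have "\<dots> = sandwich e x e + sandwich e x e' + (sandwich e' x e + sandwich e' x e')"
      using eA e'A x by (simp add: sandwich_add_left sandwich_add_right)
    finally show ?thesis .
  qed
  note sJ = of_J_sandwich(2)[OF eA(2) eA(2)] of_J_sandwich(2)[OF eA(2) e'A]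
    of_J_sandwich(2)[OF e'A eA(2)] of_J_sandwich(2)[OF e'A e'A]
  show ?thesis
  proof
    assume "l \<in> dual_e e"
    then have l: "l \<in> dual" "\<And>x. x \<in> J \<Longrightarrow> l (sandwich e x e') = 0 \<and> l (sandwich e' x e) = 0 \<and> l (sandwich e' x e') = 0"
      by (auto simp: dual_e_def Let_def e'_def)
    have "l (sandwich e x e) = l x" if x: "x \<in> J" for x
    proof -
      have "l x = l (sandwich e x e + sandwich e x e' + (sandwich e' x e + sandwich e' x e'))"
        using split[OF x] by simp
      then show ?thesis using l x sJ by (simp add: dual_add)
    qed
    then show "l \<in> dual \<and> (\<forall>x\<in>J. l (sandwich e x e) = l x)" using l by blast
  next
    assume l: "l \<in> dual \<and> (\<forall>x\<in>J. l (sandwich e x e) = l x)"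
    have "l (sandwich e x e') = 0 \<and> l (sandwich e' x e) = 0 \<and> l (sandwich e' x e') = 0" if x: "x \<in> J" for x
    proof -
      have "l (sandwich e x e') = l (sandwich e (sandwich e x e') e)" using l x sJ by simp
      moreover have "l (sandwich e' x e) = l (sandwich e (sandwich e' x e) e)" using l x sJ by simp
      moreover have "l (sandwich e' x e') = l (sandwich e (sandwich e' x e') e)" using l x sJ by simp
      ultimately show ?thesis
        using l x eA e'A by (simp add: sandwich_sandwich ee' sandwich_zero dual_zero)
    qed
    then show "l \<in> dual_e e" using l by (simp add: dual_e_def Let_def e'_def)
  qed
qed

end

lemma (in monoid) commute_mult:
  assumes "a \<in> carrier G" "b \<in> carrier G" "c \<in> carrier G" "a \<otimes> c = c \<otimes> a" "b \<otimes> c = c \<otimes> b"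
  shows "(a \<otimes> b) \<otimes> c = c \<otimes> (a \<otimes> b)"
proof -
  have "(a \<otimes> b) \<otimes> c = a \<otimes> (c \<otimes> b)" using assms by (simp add: m_assoc)
  also have "\<dots> = (c \<otimes> a) \<otimes> b" using assms by (simp add: m_assoc[symmetric])
  finally show ?thesis using assms by (simp add: m_assoc)
qed

section \<open>Lifting the group attached to an idempotent into \<open>G\<close>\<close>

context triangular_type
begin

text \<open>Elements of \<open>G\<^sub>e\<close> lift to the centralizer in \<open>G\<close> of \<open>e\<close> and \<open>H(e)\<close>; lifting turns the action of
  the triples on \<open>J\<^sub>e\<close> into two-sided multiplication by elements of \<open>G\<close>.\<close>

definition cent :: "('h \<Rightarrow> 'k) \<times> 'a \<Rightarrow> (('h \<Rightarrow> 'k) \<times> 'a) set" where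
  "cent e = {g \<in> carrier G. g \<otimes>\<^bsub>A\<^esub> e = e \<otimes>\<^bsub>A\<^esub> g \<and> (\<forall>k\<in>H_fix e. g \<otimes>\<^bsub>A\<^esub> of_H k = of_H k \<otimes>\<^bsub>A\<^esub> g)}"

lemma H_fix_carrier: "k \<in> H_fix e \<Longrightarrow> k \<in> carrier H" by (simp add: H_fix_def)

lemma cent_in_G: "g \<in> cent e \<Longrightarrow> g \<in> carrier G" by (simp add: cent_def)

lemma of_H_in_A [simp]: "h \<in> carrier H \<Longrightarrow> of_H h \<in> carrier A" by (simp add: of_H_eq)

lemma of_H_mult: "h \<in> carrier H \<Longrightarrow> k \<in> carrier H \<Longrightarrow> of_H h \<otimes>\<^bsub>A\<^esub> of_H k = of_H (h \<otimes> k)"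
  by (simp add: of_H_eq el_mult_A)

lemma el_one: "z \<in> J \<Longrightarrow> el \<one> z = \<one>\<^bsub>A\<^esub> \<oplus>\<^bsub>A\<^esub> of_J z"
  by (simp add: A_one of_H_eq[symmetric] of_H_add_of_J)

lemma hpart_mult: "g \<in> carrier G \<Longrightarrow> h \<in> carrier G \<Longrightarrow> hpart (g \<otimes>\<^bsub>G\<^esub> h) = hpart g \<otimes> hpart h"
  by (auto simp: carrier_G)

lemma hpart_closed: "g \<in> carrier G \<Longrightarrow> hpart g \<in> carrier H"
  by (auto simp: carrier_G)

lemma hpart_inv: assumes "g \<in> carrier G" shows "hpart (inv\<^bsub>G\<^esub> g) = inv (hpart g)"
proof -
  have "hpart (inv\<^bsub>G\<^esub> g) \<otimes> hpart g = \<one>"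
    using hpart_mult[of "inv\<^bsub>G\<^esub> g" g] assms by (simp add: one_G)
  then show ?thesis using assms hpart_closed by (metis G.inv_closed H.inv_equality)
qed

lemma hpart_one_iff: "g \<in> carrier G \<Longrightarrow> hpart g = \<one> \<longleftrightarrow> (\<exists>z\<in>J. g = el \<one> z)"
  by (auto simp: carrier_G)

lemma of_H_cent:
  assumes e: "e \<in> idempotents" and h: "h \<in> carrier H" shows "of_H h \<in> cent e"
  using h kH_comm[OF of_H_in_kH[OF h]] idempotentD(1)[OF e] of_H_in_kH H_fix_carrier
  by (auto simp: cent_def of_H_eq)

lemma subgroup_cent:
  assumes e: "e \<in> idempotents" shows "subgroup (cent e) G"
proof (rule G.finite_mult_closed_subgroup[OF finite_G])
  show "cent e \<subseteq> carrier G" using cent_in_G by blast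
  show "cent e \<noteq> {}" using of_H_cent[OF e H.one_closed] by blast
  fix g h assume "g \<in> cent e" "h \<in> cent e"
  then show "g \<otimes>\<^bsub>G\<^esub> h \<in> cent e"
    using A.commute_mult[OF G_in_A G_in_A] idempotentD(2)[OF e] H_fix_carrier
    by (auto simp: cent_def G_mult[symmetric])
qed

lemma subgroup_H_fix:
  assumes e: "e \<in> idempotents" shows "subgroup (H_fix e) H"
proof (rule H.finite_mult_closed_subgroup[OF H_finite])
  show "H_fix e \<subseteq> carrier H" using H_fix_carrier by blast
  have "of_H \<one> \<otimes>\<^bsub>A\<^esub> e = e" using idempotentD(2)[OF e] by (simp add: of_H_eq A_one[symmetric])
  then show "H_fix e \<noteq> {}" by (auto simp: H_fix_def)
  fix h k assume "h \<in> H_fix e" "k \<in> H_fix e"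
  then show "h \<otimes> k \<in> H_fix e"
    using idempotentD(2)[OF e] by (simp add: H_fix_def of_H_mult[symmetric] A.m_assoc)
qed

context
  fixes e assumes e: "e \<in> idempotents"
begin

lemmas eA = idempotentD(2)[OF e] and ee = idempotentD(3)[OF e]

lemma cent_A: "g \<in> cent e \<Longrightarrow> g \<in> carrier A" using cent_in_G G_in_A by blast

lemma cent_comm: "g \<in> cent e \<Longrightarrow> e \<otimes>\<^bsub>A\<^esub> g = g \<otimes>\<^bsub>A\<^esub> e" by (simp add: cent_def)

text \<open>For k in H(e) one has ke = e = ek, so k acts trivially on exe from both sides; hence 1 +
  exe commutes with k as well as with e.\<close>

lemma el_cent: assumes x: "x \<in> J" shows "el \<one> (sandwich e x e) \<in> cent e"
proof -
  let ?z = "sandwich e x e"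
  have zJ: "?z \<in> J" using of_J_sandwich(2)[OF eA eA x] .
  have Z: "of_J ?z = e \<otimes>\<^bsub>A\<^esub> of_J x \<otimes>\<^bsub>A\<^esub> e" using of_J_sandwich(1)[OF eA eA x] by simp
  have ez: "e \<otimes>\<^bsub>A\<^esub> of_J ?z = of_J ?z" "of_J ?z \<otimes>\<^bsub>A\<^esub> e = of_J ?z"
    using eA x ee unfolding Z by (simp_all add: A.m_assoc) (simp add: A.m_assoc[symmetric])
  have k: "of_H k \<otimes>\<^bsub>A\<^esub> of_J ?z = of_J ?z \<and> of_J ?z \<otimes>\<^bsub>A\<^esub> of_H k = of_J ?z" if "k \<in> H_fix e" for k
  proof -
    have kc: "k \<in> carrier H" "of_H k \<otimes>\<^bsub>A\<^esub> e = e" using that by (simp_all add: H_fix_def)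
    then have "e \<otimes>\<^bsub>A\<^esub> of_H k = e" using kH_comm[OF of_H_in_kH idempotentD(1)[OF e]] by simp
    then have "of_J ?z \<otimes>\<^bsub>A\<^esub> of_H k = of_J ?z" using ez(2) eA zJ kc by (metis A.m_assoc of_H_in_A of_J_in_A)
    moreover have "of_H k \<otimes>\<^bsub>A\<^esub> of_J ?z = of_J ?z"
      using ez(1) eA zJ kc by (metis A.m_assoc of_H_in_A of_J_in_A)
    ultimately show ?thesis by simp
  qed
  show ?thesis
    using zJ eA ez k H_fix_carrier
    by (simp add: cent_def el_one[OF zJ] A.l_distr A.r_distr) (use zJ in \<open>simp add: el_one[symmetric]\<close>)
qed

text \<open>The lift of e + exe is 1 + exe, because (1 + exe)e = e + exe. Conversely, ge = ege for g
  = 1 + z in the centralizer.\<close>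

lemma N_e_eq: "N_e e = {g \<otimes>\<^bsub>A\<^esub> e | g. g \<in> cent e \<and> hpart g = \<one>}"
proof (intro equalityI subsetI)
  fix y assume "y \<in> N_e e"
  then obtain x where x: "x \<in> J" "y = e \<oplus>\<^bsub>A\<^esub> e \<otimes>\<^bsub>A\<^esub> of_J x \<otimes>\<^bsub>A\<^esub> e" by (auto simp: N_e_def)
  have zJ: "sandwich e x e \<in> J" using of_J_sandwich(2)[OF eA eA x(1)] .
  have "el \<one> (sandwich e x e) \<otimes>\<^bsub>A\<^esub> e = e \<oplus>\<^bsub>A\<^esub> (e \<otimes>\<^bsub>A\<^esub> of_J x \<otimes>\<^bsub>A\<^esub> e) \<otimes>\<^bsub>A\<^esub> e"
    using x zJ eA by (simp add: el_one A.l_distr of_J_sandwich(1))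
  then have "y = el \<one> (sandwich e x e) \<otimes>\<^bsub>A\<^esub> e" using x eA ee by (simp add: A.m_assoc)
  then show "y \<in> {g \<otimes>\<^bsub>A\<^esub> e | g. g \<in> cent e \<and> hpart g = \<one>}"
    using el_cent[OF x(1)] hpart_el[OF H.one_closed] by blast
next
  fix y assume "y \<in> {g \<otimes>\<^bsub>A\<^esub> e | g. g \<in> cent e \<and> hpart g = \<one>}"
  then obtain g where g: "g \<in> cent e" "hpart g = \<one>" "y = g \<otimes>\<^bsub>A\<^esub> e" by blast
  then obtain z where z: "z \<in> J" "g = el \<one> z" using hpart_one_iff cent_in_G by blast
  have "y = e \<otimes>\<^bsub>A\<^esub> g \<otimes>\<^bsub>A\<^esub> e"
    using g cent_A[OF g(1)] eA ee by (simp add: cent_comm A.m_assoc)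
  also have "\<dots> = e \<oplus>\<^bsub>A\<^esub> e \<otimes>\<^bsub>A\<^esub> of_J z \<otimes>\<^bsub>A\<^esub> e"
    using z eA ee by (simp add: el_one A.l_distr A.r_distr)
  finally show "y \<in> N_e e" using z by (auto simp: N_e_def)
qed

lemma H_e_eq: "H_e e = {of_H h \<otimes>\<^bsub>A\<^esub> e | h. h \<in> carrier H}"
proof -
  have "e \<otimes>\<^bsub>A\<^esub> of_H h \<otimes>\<^bsub>A\<^esub> e = of_H h \<otimes>\<^bsub>A\<^esub> e" if "h \<in> carrier H" for h
    using that cent_comm[OF of_H_cent[OF e that]] eA ee by (simp add: A.m_assoc)
  then show ?thesis unfolding H_e_def by (intro Collect_cong ex_cong1) auto
qed

text \<open>The image of the centralizer under g to ge. All components of triples lie in it, and its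
  inverses come from inverses in \<open>G\<close> by \<open>inv_lift\<close>.\<close>

definition lifted :: "(('h \<Rightarrow> 'k) \<times> 'a) monoid" where
  "lifted = \<lparr>carrier = (\<lambda>g. g \<otimes>\<^bsub>A\<^esub> e) ` cent e, monoid.mult = monoid.mult A, one = e\<rparr>"

lemma lift_mult:
  assumes "g \<in> cent e" "h \<in> cent e"
  shows "(g \<otimes>\<^bsub>A\<^esub> e) \<otimes>\<^bsub>A\<^esub> (h \<otimes>\<^bsub>A\<^esub> e) = (g \<otimes>\<^bsub>G\<^esub> h) \<otimes>\<^bsub>A\<^esub> e"
proof -
  have "(g \<otimes>\<^bsub>A\<^esub> e) \<otimes>\<^bsub>A\<^esub> (h \<otimes>\<^bsub>A\<^esub> e) = g \<otimes>\<^bsub>A\<^esub> (e \<otimes>\<^bsub>A\<^esub> h) \<otimes>\<^bsub>A\<^esub> e"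
    using assms[THEN cent_A] eA by (simp add: A.m_assoc)
  also have "\<dots> = (g \<otimes>\<^bsub>A\<^esub> h) \<otimes>\<^bsub>A\<^esub> (e \<otimes>\<^bsub>A\<^esub> e)"
    using assms[THEN cent_A] eA by (simp only: cent_comm[OF assms(2)] A.m_assoc A.m_closed)
  finally show ?thesis by (simp add: ee G_mult)
qed

lemma lift_one: "\<one>\<^bsub>G\<^esub> \<otimes>\<^bsub>A\<^esub> e = e"
  using eA by (simp add: one_G A_one[symmetric])

lemma group_lifted: "group lifted"
proof (rule groupI)
  show "\<one>\<^bsub>lifted\<^esub> \<in> carrier lifted"
    using subgroup.one_closed[OF subgroup_cent[OF e]] lift_one by (force simp: lifted_def)
  fix x y assume x: "x \<in> carrier lifted" and y: "y \<in> carrier lifted"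
  then obtain g h where g: "g \<in> cent e" "x = g \<otimes>\<^bsub>A\<^esub> e" and h: "h \<in> cent e" "y = h \<otimes>\<^bsub>A\<^esub> e"
    by (auto simp: lifted_def)
  show "x \<otimes>\<^bsub>lifted\<^esub> y \<in> carrier lifted"
    using g h subgroup.m_closed[OF subgroup_cent[OF e]] by (auto simp: lifted_def lift_mult)
  have xA: "x \<in> carrier A" "y \<in> carrier A" using g h cent_A eA by auto
  show "x \<otimes>\<^bsub>lifted\<^esub> y \<otimes>\<^bsub>lifted\<^esub> z = x \<otimes>\<^bsub>lifted\<^esub> (y \<otimes>\<^bsub>lifted\<^esub> z)" if "z \<in> carrier lifted" for z
    using that xA cent_A eA by (auto simp: lifted_def A.m_assoc)
  show "\<one>\<^bsub>lifted\<^esub> \<otimes>\<^bsub>lifted\<^esub> x = x"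
    using g cent_A[OF g(1)] eA ee cent_comm[OF g(1)] by (simp add: lifted_def A.m_assoc[symmetric])
      (simp add: A.m_assoc)
  show "\<exists>z\<in>carrier lifted. z \<otimes>\<^bsub>lifted\<^esub> x = \<one>\<^bsub>lifted\<^esub>"
  proof (rule bexI[of _ "inv\<^bsub>G\<^esub> g \<otimes>\<^bsub>A\<^esub> e"])
    have ig: "inv\<^bsub>G\<^esub> g \<in> cent e" using g subgroup.m_inv_closed[OF subgroup_cent[OF e]] by blast
    then show "inv\<^bsub>G\<^esub> g \<otimes>\<^bsub>A\<^esub> e \<in> carrier lifted" by (simp add: lifted_def)
    show "inv\<^bsub>G\<^esub> g \<otimes>\<^bsub>A\<^esub> e \<otimes>\<^bsub>lifted\<^esub> x = \<one>\<^bsub>lifted\<^esub>"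
      using g ig cent_in_G[OF g(1)] by (simp add: lifted_def lift_mult lift_one)
  qed
qed

interpretation L: group lifted by (rule group_lifted)

lemma lift_in: "g \<in> cent e \<Longrightarrow> g \<otimes>\<^bsub>A\<^esub> e \<in> carrier lifted" by (simp add: lifted_def)

lemma lifted_cases: "x \<in> carrier lifted \<Longrightarrow> \<exists>g\<in>cent e. x = g \<otimes>\<^bsub>A\<^esub> e" by (auto simp: lifted_def)

lemma mult_lifted: "x \<otimes>\<^bsub>lifted\<^esub> y = x \<otimes>\<^bsub>A\<^esub> y" and one_lifted: "\<one>\<^bsub>lifted\<^esub> = e"
  by (simp_all add: lifted_def)

lemma inv_lift: assumes g: "g \<in> cent e" shows "inv\<^bsub>lifted\<^esub> (g \<otimes>\<^bsub>A\<^esub> e) = inv\<^bsub>G\<^esub> g \<otimes>\<^bsub>A\<^esub> e"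
proof -
  have ig: "inv\<^bsub>G\<^esub> g \<in> cent e" using g subgroup.m_inv_closed[OF subgroup_cent[OF e]] by blast
  show ?thesis
    using g ig cent_in_G[OF g] by (intro L.inv_equality lift_in) (simp_all add: mult_lifted one_lifted lift_mult lift_one)
qed

text \<open>An inverse in \<open>G_e\<close> is a definite description, so uniqueness is the point:
  if zx = e and y is the lifted inverse, then z = ze = z(xy) = (zx)y = y.\<close>

lemma inv_G_e: assumes x: "x \<in> carrier lifted" shows "inv\<^bsub>G_e e\<^esub> x = inv\<^bsub>lifted\<^esub> x"
proof -
  let ?y = "inv\<^bsub>lifted\<^esub> x"
  have yl: "?y \<in> carrier lifted" using x by simp
  have lA: "z \<in> carrier A" if "z \<in> carrier lifted" for z
    using lifted_cases[OF that] cent_A eA by auto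
  have y: "?y \<in> carrier (G_e e)"
  proof -
    obtain g where g: "g \<in> cent e" "?y = g \<otimes>\<^bsub>A\<^esub> e" using lifted_cases[OF yl] by blast
    then have "?y = e \<otimes>\<^bsub>A\<^esub> g \<otimes>\<^bsub>A\<^esub> e"
      using cent_A[OF g(1)] eA ee by (simp add: cent_comm A.m_assoc)
    moreover have "e \<otimes>\<^bsub>A\<^esub> g \<otimes>\<^bsub>A\<^esub> e \<in> carrier (G_e e)"
      using cent_in_G[OF g(1)] unfolding G_e_def partial_object.simps by blast
    ultimately show ?thesis by simp
  qed
  have xy: "x \<otimes>\<^bsub>A\<^esub> ?y = e" "?y \<otimes>\<^bsub>A\<^esub> x = e" "e \<otimes>\<^bsub>A\<^esub> ?y = ?y"
    using L.r_inv[OF x] L.l_inv[OF x] L.l_one[OF yl] by (simp_all add: mult_lifted one_lifted)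
  have "z = ?y" if z: "z \<in> carrier (G_e e)" "z \<otimes>\<^bsub>A\<^esub> x = e" for z
  proof -
    obtain g where g: "g \<in> carrier G" "z = e \<otimes>\<^bsub>A\<^esub> g \<otimes>\<^bsub>A\<^esub> e" using z by (auto simp: G_e_def)
    have zA: "z \<in> carrier A" using g G_in_A eA by simp
    have "z = z \<otimes>\<^bsub>A\<^esub> e" using g G_in_A[OF g(1)] eA ee by (simp add: A.m_assoc)
    also have "\<dots> = (z \<otimes>\<^bsub>A\<^esub> x) \<otimes>\<^bsub>A\<^esub> ?y" using zA lA[OF x] lA[OF yl] xy(1) by (simp add: A.m_assoc)
    finally show ?thesis using z(2) xy(3) by simp
  qed
  note unique = this
  have ops: "a \<otimes>\<^bsub>G_e e\<^esub> b = a \<otimes>\<^bsub>A\<^esub> b" "\<one>\<^bsub>G_e e\<^esub> = e" for a b by (simp_all add: G_e_def)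
  show ?thesis
    unfolding m_inv_def[of "G_e e"] ops
  proof (rule the_equality)
    show "?y \<in> carrier (G_e e) \<and> x \<otimes>\<^bsub>A\<^esub> ?y = e \<and> ?y \<otimes>\<^bsub>A\<^esub> x = e" using y xy by blast
  qed (use unique in blast)
qed

lemma triples_subset: "carrier (triples e) \<subseteq> carrier lifted \<times> carrier lifted \<times> carrier lifted"
  using of_H_cent[OF e] by (auto simp: triples_def H_e_eq N_e_eq lifted_def)

text \<open>Again the inverse is obtained from uniqueness: the first component has to be t^-1, and
  the multiplication rule then leaves only t a^-1 t^-1 and t b^-1 t^-1 for the other two.\<close>

lemma inv_triples:
  assumes "(t, a, b) \<in> carrier (triples e)"
  shows "inv\<^bsub>triples e\<^esub> (t, a, b) = (inv\<^bsub>lifted\<^esub> t, t \<otimes>\<^bsub>lifted\<^esub> inv\<^bsub>lifted\<^esub> a \<otimes>\<^bsub>lifted\<^esub> inv\<^bsub>lifted\<^esub> t,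
      t \<otimes>\<^bsub>lifted\<^esub> inv\<^bsub>lifted\<^esub> b \<otimes>\<^bsub>lifted\<^esub> inv\<^bsub>lifted\<^esub> t)" (is "_ = ?y")
    and "inv\<^bsub>triples e\<^esub> (t, a, b) \<in> carrier (triples e)"
proof -
  have l: "t \<in> carrier lifted" "a \<in> carrier lifted" "b \<in> carrier lifted"
    using assms triples_subset by auto
  have mult: "(t1, a1, b1) \<otimes>\<^bsub>triples e\<^esub> (t2, a2, b2) = (t1 \<otimes>\<^bsub>lifted\<^esub> t2,
      inv\<^bsub>lifted\<^esub> t2 \<otimes>\<^bsub>lifted\<^esub> a1 \<otimes>\<^bsub>lifted\<^esub> t2 \<otimes>\<^bsub>lifted\<^esub> a2, inv\<^bsub>lifted\<^esub> t2 \<otimes>\<^bsub>lifted\<^esub> b1 \<otimes>\<^bsub>lifted\<^esub> t2 \<otimes>\<^bsub>lifted\<^esub> b2)"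
    if "t2 \<in> carrier lifted" for t1 a1 b1 t2 a2 b2
    using that by (simp add: triples_def inv_G_e mult_lifted)
  have one: "\<one>\<^bsub>triples e\<^esub> = (\<one>\<^bsub>lifted\<^esub>, \<one>\<^bsub>lifted\<^esub>, \<one>\<^bsub>lifted\<^esub>)"
    by (simp add: triples_def one_lifted)
  have inv_cancel: "g \<otimes>\<^bsub>lifted\<^esub> (inv\<^bsub>lifted\<^esub> g \<otimes>\<^bsub>lifted\<^esub> k) = k"
    "inv\<^bsub>lifted\<^esub> g \<otimes>\<^bsub>lifted\<^esub> (g \<otimes>\<^bsub>lifted\<^esub> k) = k"
    if "g \<in> carrier lifted" "k \<in> carrier lifted" for g k
    using that by (simp_all add: L.m_assoc[symmetric])
  obtain h where h: "h \<in> carrier H" "t = of_H h \<otimes>\<^bsub>A\<^esub> e" using assms by (auto simp: triples_def H_e_eq)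
  have hc: "of_H h \<in> cent e" using of_H_cent[OF e h(1)] .
  have ih: "inv\<^bsub>G\<^esub> (of_H h) = of_H (inv h)"
    by (rule G.inv_equality) (use h in \<open>simp_all add: of_H_eq one_G\<close>)
  have c1: "inv\<^bsub>lifted\<^esub> t \<in> H_e e"
    using h by (auto simp: H_e_eq inv_lift[OF hc] ih)
  \<comment> \<open>The conjugate lifts to an element of the centralizer whose \<open>H\<close>-part
    is trivial, since those of h and h^-1 cancel.\<close>
  have c2: "t \<otimes>\<^bsub>lifted\<^esub> inv\<^bsub>lifted\<^esub> c \<otimes>\<^bsub>lifted\<^esub> inv\<^bsub>lifted\<^esub> t \<in> N_e e" if c: "c \<in> N_e e" for c
  proof -
    obtain g where g: "g \<in> cent e" "hpart g = \<one>" "c = g \<otimes>\<^bsub>A\<^esub> e" using c by (auto simp: N_e_eq)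
    have gG: "g \<in> carrier G" "of_H h \<in> carrier G" using cent_in_G g hc by auto
    let ?k = "of_H h \<otimes>\<^bsub>G\<^esub> inv\<^bsub>G\<^esub> g \<otimes>\<^bsub>G\<^esub> inv\<^bsub>G\<^esub> (of_H h)"
    have s: "inv\<^bsub>G\<^esub> g \<in> cent e" "inv\<^bsub>G\<^esub> (of_H h) \<in> cent e" "of_H h \<otimes>\<^bsub>G\<^esub> inv\<^bsub>G\<^esub> g \<in> cent e" "?k \<in> cent e"
      using g hc subgroup_cent[OF e] by (simp_all add: subgroup.m_inv_closed subgroup.m_closed)
    have "t \<otimes>\<^bsub>lifted\<^esub> inv\<^bsub>lifted\<^esub> c \<otimes>\<^bsub>lifted\<^esub> inv\<^bsub>lifted\<^esub> t = ?k \<otimes>\<^bsub>A\<^esub> e"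
      using s g hc by (simp add: h(2) inv_lift mult_lifted lift_mult)
    moreover have "hpart ?k = \<one>"
      using gG h g by (simp add: hpart_mult hpart_inv) (simp add: of_H_eq)
    ultimately show ?thesis unfolding N_e_eq using s(4) by blast
  qed
  have y: "?y \<in> carrier (triples e)"
    using assms c1 c2 by (auto simp: triples_def)
  have "inv\<^bsub>triples e\<^esub> (t, a, b) = ?y"
    unfolding m_inv_def[of "triples e"]
  proof (rule the_equality, intro conjI)
    show "?y \<in> carrier (triples e)" by (rule y)
    show "(t, a, b) \<otimes>\<^bsub>triples e\<^esub> ?y = \<one>\<^bsub>triples e\<^esub>"
      using l by (simp add: mult one L.m_assoc inv_cancel)
    show "?y \<otimes>\<^bsub>triples e\<^esub> (t, a, b) = \<one>\<^bsub>triples e\<^esub>"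
      using l by (simp add: mult one L.m_assoc inv_cancel)
  next
    fix z assume z: "z \<in> carrier (triples e) \<and> (t, a, b) \<otimes>\<^bsub>triples e\<^esub> z = \<one>\<^bsub>triples e\<^esub> \<and>
      z \<otimes>\<^bsub>triples e\<^esub> (t, a, b) = \<one>\<^bsub>triples e\<^esub>"
    obtain t2 a2 b2 where z2: "z = (t2, a2, b2)" by (cases z)
    have l2: "t2 \<in> carrier lifted" "a2 \<in> carrier lifted" "b2 \<in> carrier lifted"
      using z z2 triples_subset by auto
    have eqs: "t \<otimes>\<^bsub>lifted\<^esub> t2 = \<one>\<^bsub>lifted\<^esub>"
      "inv\<^bsub>lifted\<^esub> t2 \<otimes>\<^bsub>lifted\<^esub> a \<otimes>\<^bsub>lifted\<^esub> t2 \<otimes>\<^bsub>lifted\<^esub> a2 = \<one>\<^bsub>lifted\<^esub>"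
      "inv\<^bsub>lifted\<^esub> t2 \<otimes>\<^bsub>lifted\<^esub> b \<otimes>\<^bsub>lifted\<^esub> t2 \<otimes>\<^bsub>lifted\<^esub> b2 = \<one>\<^bsub>lifted\<^esub>"
      using z l2 by (auto simp: z2 mult one)
    have t2: "t2 = inv\<^bsub>lifted\<^esub> t" using eqs(1) l l2 by (metis L.inv_comm L.inv_equality)
    have "c2 = t \<otimes>\<^bsub>lifted\<^esub> inv\<^bsub>lifted\<^esub> c \<otimes>\<^bsub>lifted\<^esub> inv\<^bsub>lifted\<^esub> t"
      if c: "c \<in> carrier lifted" "c2 \<in> carrier lifted"
        and e2: "inv\<^bsub>lifted\<^esub> t2 \<otimes>\<^bsub>lifted\<^esub> c \<otimes>\<^bsub>lifted\<^esub> t2 \<otimes>\<^bsub>lifted\<^esub> c2 = \<one>\<^bsub>lifted\<^esub>" for c c2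
    proof -
      have "c2 = inv\<^bsub>lifted\<^esub> (t \<otimes>\<^bsub>lifted\<^esub> c \<otimes>\<^bsub>lifted\<^esub> inv\<^bsub>lifted\<^esub> t)"
        using e2 c l unfolding t2 by (metis L.inv_closed L.inv_comm L.inv_equality L.inv_inv L.m_closed)
      then show ?thesis using c l by (simp add: L.inv_mult_group L.m_assoc)
    qed
    then show "z = ?y" using z2 t2 eqs l l2 by simp
  qed
  then show "inv\<^bsub>triples e\<^esub> (t, a, b) = ?y" "inv\<^bsub>triples e\<^esub> (t, a, b) \<in> carrier (triples e)"
    using y by simp_all
qed

text \<open>If h, a, b lift the components of the inverse triple, then c = ha and d = b^-1 h^-1.
  Their \<open>H\<close>-parts are inverse to each other because those of a and b are
  trivial.\<close>

lemma rho_inv_triples: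
  assumes \<tau>: "\<tau> \<in> carrier (triples e)"
  obtains c d where "c \<in> cent e" "d \<in> cent e" "hpart d = inv (hpart c)"
    "\<And>x. rho e (inv\<^bsub>triples e\<^esub> \<tau>) x = sandwich (c \<otimes>\<^bsub>A\<^esub> e) x (d \<otimes>\<^bsub>A\<^esub> e)"
proof -
  obtain T A' B where T: "inv\<^bsub>triples e\<^esub> \<tau> = (T, A', B)" by (metis prod_cases3)
  have "(T, A', B) \<in> carrier (triples e)" using inv_triples(2) \<tau> T by (metis prod_cases3)
  then have "T \<in> H_e e" "A' \<in> N_e e" "B \<in> N_e e" by (simp_all add: triples_def)
  then obtain h a b where h: "h \<in> carrier H" "T = of_H h \<otimes>\<^bsub>A\<^esub> e"
    and a: "a \<in> cent e" "hpart a = \<one>" "A' = a \<otimes>\<^bsub>A\<^esub> e" and b: "b \<in> cent e" "hpart b = \<one>" "B = b \<otimes>\<^bsub>A\<^esub> e"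
    unfolding H_e_eq N_e_eq by blast
  have hc: "of_H h \<in> cent e" using of_H_cent[OF e h(1)] .
  have G: "a \<in> carrier G" "b \<in> carrier G" "of_H h \<in> carrier G" using a b hc cent_in_G by auto
  have s: "inv\<^bsub>G\<^esub> b \<in> cent e" "inv\<^bsub>G\<^esub> (of_H h) \<in> cent e"
    "of_H h \<otimes>\<^bsub>G\<^esub> a \<in> cent e" "inv\<^bsub>G\<^esub> b \<otimes>\<^bsub>G\<^esub> inv\<^bsub>G\<^esub> (of_H h) \<in> cent e"
    using a b hc subgroup_cent[OF e] by (simp_all add: subgroup.m_inv_closed subgroup.m_closed)
  show thesis
  proof (rule that[OF s(3,4)])
    show "hpart (inv\<^bsub>G\<^esub> b \<otimes>\<^bsub>G\<^esub> inv\<^bsub>G\<^esub> (of_H h)) = inv (hpart (of_H h \<otimes>\<^bsub>G\<^esub> a))"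
      using G a b hpart_closed[OF G(3)] by (simp add: hpart_mult hpart_inv)
    fix x
    show "rho e (inv\<^bsub>triples e\<^esub> \<tau>) x = sandwich ((of_H h \<otimes>\<^bsub>G\<^esub> a) \<otimes>\<^bsub>A\<^esub> e) x
      ((inv\<^bsub>G\<^esub> b \<otimes>\<^bsub>G\<^esub> inv\<^bsub>G\<^esub> (of_H h)) \<otimes>\<^bsub>A\<^esub> e)"
      unfolding T rho_def using h a b hc s
      by (simp add: inv_G_e lift_in inv_lift lift_mult)
  qed
qed

lemma rho_dual_eq:
  assumes \<tau>: "\<tau> \<in> carrier (triples e)" and l: "l \<in> dual_e e"
  obtains c d where "c \<in> cent e" "d \<in> cent e" "hpart d = inv (hpart c)"
    "\<And>x. x \<in> J \<Longrightarrow> rho_dual e \<tau> l x = l (sandwich c x d)"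
proof -
  obtain c d where c: "c \<in> cent e" and d: "d \<in> cent e" and cd: "hpart d = inv (hpart c)"
    and rho: "\<And>x. rho e (inv\<^bsub>triples e\<^esub> \<tau>) x = sandwich (c \<otimes>\<^bsub>A\<^esub> e) x (d \<otimes>\<^bsub>A\<^esub> e)"
    by (rule rho_inv_triples[OF \<tau>]) (rule that)
  have cA: "c \<in> carrier A" "d \<in> carrier A" using c d cent_A by auto
  show thesis
  proof (rule that[OF c d cd])
    fix x assume x: "x \<in> J"
    have "rho_dual e \<tau> l x = l (sandwich (c \<otimes>\<^bsub>A\<^esub> e) (sandwich e x e) (d \<otimes>\<^bsub>A\<^esub> e))"
      using x by (simp add: rho_dual_def rho)
    also have "sandwich (c \<otimes>\<^bsub>A\<^esub> e) (sandwich e x e) (d \<otimes>\<^bsub>A\<^esub> e) = sandwich (c \<otimes>\<^bsub>A\<^esub> e \<otimes>\<^bsub>A\<^esub> e) x (e \<otimes>\<^bsub>A\<^esub> (d \<otimes>\<^bsub>A\<^esub> e))"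
      using x cA eA by (simp add: sandwich_sandwich)
    also have "c \<otimes>\<^bsub>A\<^esub> e \<otimes>\<^bsub>A\<^esub> e = e \<otimes>\<^bsub>A\<^esub> c"
      using cA eA ee by (simp add: A.m_assoc cent_comm[OF c])
    also have "e \<otimes>\<^bsub>A\<^esub> (d \<otimes>\<^bsub>A\<^esub> e) = d \<otimes>\<^bsub>A\<^esub> e"
      using cA eA ee by (simp add: A.m_assoc[symmetric] cent_comm[OF d]) (simp add: A.m_assoc)
    also have "sandwich (e \<otimes>\<^bsub>A\<^esub> c) x (d \<otimes>\<^bsub>A\<^esub> e) = sandwich e (sandwich c x d) e"
      using x cA eA by (simp add: sandwich_sandwich)
    also have "l \<dots> = l (sandwich c x d)"
      using l x cA of_J_sandwich(2)[OF cA x] by (simp add: dual_e_iff[OF e])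
    finally show "rho_dual e \<tau> l x = l (sandwich c x d)" .
  qed
qed

lemma rho_dual_dual:
  assumes \<tau>: "\<tau> \<in> carrier (triples e)" and l: "l \<in> dual_e e"
  shows "rho_dual e \<tau> l \<in> dual"
proof -
  obtain c d where cd: "c \<in> cent e" "d \<in> cent e"
    "\<And>x. x \<in> J \<Longrightarrow> rho_dual e \<tau> l x = l (sandwich c x d)"
    using rho_dual_eq[OF \<tau> l] by metis
  have A: "c \<in> carrier A" "d \<in> carrier A" using cd cent_A by auto
  have ld: "l \<in> dual" using l by (simp add: dual_e_iff[OF e])
  have "rho_dual e \<tau> l = (\<lambda>x. if x \<in> J then l (sandwich c x d) else 0)"
    by (rule ext) (auto simp: cd(3), simp add: rho_dual_def)
  also have "\<dots> \<in> dual"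
    by (rule dualI) (simp_all add: sandwich_add[OF A] sandwich_scale[OF A] of_J_sandwich(2)[OF A]
        dual_add[OF ld] dual_scale[OF ld])
  finally show ?thesis .
qed

lemma triples_nonempty: "\<exists>\<tau>. \<tau> \<in> carrier (triples e)"
proof -
  have "e \<otimes>\<^bsub>A\<^esub> of_H \<one> \<otimes>\<^bsub>A\<^esub> e \<in> H_e e" "e \<oplus>\<^bsub>A\<^esub> e \<otimes>\<^bsub>A\<^esub> of_J 0 \<otimes>\<^bsub>A\<^esub> e \<in> N_e e"
    unfolding H_e_def N_e_def using H.one_closed J_zero by blast+
  then show ?thesis unfolding triples_def partial_object.simps by blast
qed

text \<open>From ke = e = ek one gets e(kx)e = exe = e(xk)e.\<close>

lemma dual_e_invariant:
  assumes l: "l \<in> dual" "\<And>x. x \<in> J \<Longrightarrow> l (sandwich e x e) = l x"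
  shows "left_invariant (H_fix e) l" "right_invariant (H_fix e) l"
proof -
  have "l (k \<triangleright> x) = l x \<and> l (x \<triangleleft> k) = l x" if k: "k \<in> H_fix e" and x: "x \<in> J" for k x
  proof -
    have kc: "k \<in> carrier H" "of_H k \<otimes>\<^bsub>A\<^esub> e = e" using k by (simp_all add: H_fix_def)
    then have ek: "e \<otimes>\<^bsub>A\<^esub> of_H k = e" using kH_comm[OF of_H_in_kH idempotentD(1)[OF e]] by simp
    have a: "k \<triangleright> x = sandwich (of_H k) x \<one>\<^bsub>A\<^esub>" "x \<triangleleft> k = sandwich \<one>\<^bsub>A\<^esub> x (of_H k)"
      using kc x by (simp_all add: of_H_eq A_one sandwich_el ract_one lact_one)
    have "sandwich e (k \<triangleright> x) e = sandwich e x e" "sandwich e (x \<triangleleft> k) e = sandwich e x e"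
      unfolding a using kc ek x eA by (simp_all add: sandwich_sandwich)
    then show ?thesis using l(2)[OF x] l(2)[of "k \<triangleright> x"] l(2)[of "x \<triangleleft> k"] kc x by simp
  qed
  then show "left_invariant (H_fix e) l" "right_invariant (H_fix e) l"
    by (auto simp: left_invariant_def right_invariant_def)
qed

end

end

section \<open>Supercharacters from bi-invariant forms\<close>

context triangular_type
begin

lemma conv_delta:
  fixes f :: "'h \<Rightarrow> 'k"
  assumes k: "k \<in> carrier H" and h: "h \<in> carrier H"
  shows "(\<Sum>v\<in>carrier H. f v * (if k \<otimes> v = h then 1 else 0)) = f (inv k \<otimes> h)"
proof -
  have "(\<Sum>v\<in>carrier H. f v * (if k \<otimes> v = h then 1 else (0::'k))) =
      (\<Sum>v\<in>carrier H. if v = inv k \<otimes> h then f v else 0)"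
    using k h by (intro sum.cong refl) (auto simp: H.inv_solve_left H.m_assoc[symmetric])
  then show ?thesis using k h H_finite by simp
qed

lemma sandwich_one: "x \<in> J \<Longrightarrow> sandwich \<one>\<^bsub>A\<^esub> x \<one>\<^bsub>A\<^esub> = x"
  by (simp add: A_one sandwich_el lact_one ract_one)

text \<open>The idempotent is the mean of the elements of \<open>K\<close> in \<open>kH\<close>; a
  form invariant under \<open>K\<close> on both sides does not notice averaging its
  argument.\<close>

lemma exists_fixing_idempotent:
  assumes K: "subgroup K H"
  obtains e where "e \<in> idempotents" "K \<subseteq> H_fix e"
    "\<And>\<nu> x. \<nu> \<in> dual \<Longrightarrow> left_invariant K \<nu> \<Longrightarrow> right_invariant K \<nu> \<Longrightarrow> x \<in> J \<Longrightarrow> \<nu> (sandwich e x e) = \<nu> x"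
proof -
  have Kc: "k \<in> carrier H" if "k \<in> K" for k using that K subgroup.mem_carrier by metis
  define c where "c = inverse (of_nat (card K) :: 'k)"
  have cK: "of_nat (card K) * c = 1" using card_K_nonzero[OF K] by (simp add: c_def)
  define f where "f h = (if h \<in> K then c else 0)" for h
  have f_shift: "f (inv k \<otimes> h) = f h" if "k \<in> K" "h \<in> carrier H" for k h
  proof -
    have "h = k \<otimes> (inv k \<otimes> h)" using that Kc by (simp add: H.m_assoc[symmetric])
    then have "inv k \<otimes> h \<in> K \<longleftrightarrow> h \<in> K"
      using that K by (metis subgroup.m_closed subgroup.m_inv_closed)
    then show ?thesis by (simp add: f_def)
  qed
  have sumK: "(\<Sum>u\<in>carrier H. f u * F u) = (\<Sum>u\<in>K. c * F u)" for F
    using Kc H_finite by (intro sum.mono_neutral_cong_right) (auto simp: f_def)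
  have sumKs: "(\<Sum>u\<in>carrier H. f u *s F u) = (\<Sum>u\<in>K. c *s F u)" for F :: "'h \<Rightarrow> 'a"
    using Kc H_finite by (intro sum.mono_neutral_cong_right) (auto simp: f_def)
  have f: "f \<in> supp_H" using Kc by (auto simp: supp_H_def f_def)
  define e where "e = (f, 0 :: 'a)"
  have ekH: "e \<in> kH" using f by (simp add: e_def kH_def A_carrier)
  have "conv f f = f"
  proof
    fix h
    show "conv f f h = f h"
    proof (cases "h \<in> carrier H")
      case True
      have "conv f f h = (\<Sum>u\<in>carrier H. f u * (\<Sum>v\<in>carrier H. f v * (if u \<otimes> v = h then 1 else 0)))"
        by (simp add: conv_def sum_distrib_left mult.assoc)
      also have "\<dots> = (\<Sum>u\<in>K. c * (\<Sum>v\<in>carrier H. f v * (if u \<otimes> v = h then 1 else 0)))"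
        by (rule sumK)
      also have "\<dots> = (\<Sum>u\<in>K. c * f h)"
        using True Kc by (intro sum.cong refl) (simp add: conv_delta f_shift)
      also have "\<dots> = f h" using cK by (simp add: mult.assoc[symmetric])
      finally show ?thesis .
    next
      case False
      then show ?thesis using f conv_supp[of f f] by (simp add: supp_H_def)
    qed
  qed
  then have idem: "e \<in> idempotents" using ekH by (simp add: idempotents_def e_def A_mult)
  have "of_H k \<otimes>\<^bsub>A\<^esub> e = e" if k: "k \<in> K" for k
  proof -
    have "conv (\<lambda>u. if u = k then 1 else 0) f = f"
    proof
      fix h
      show "conv (\<lambda>u. if u = k then 1 else 0) f h = f h"
      proof (cases "h \<in> carrier H")
        case True
        have "conv (\<lambda>u. if u = k then 1 else 0) f h =
          (\<Sum>u\<in>carrier H. if u = k then (\<Sum>v\<in>carrier H. f v * (if u \<otimes> v = h then 1 else 0)) else 0)"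
          unfolding conv_def by (intro sum.cong refl) auto
        also have "\<dots> = f h" using k Kc True H_finite by (simp add: conv_delta f_shift)
        finally show ?thesis .
      next
        case False
        then show ?thesis using f conv_supp by (simp add: supp_H_def)
      qed
    qed
    then show ?thesis using k Kc by (simp add: of_H_def e_def A_mult)
  qed
  then have KF: "K \<subseteq> H_fix e" using Kc by (auto simp: H_fix_def)
  have "\<nu> (sandwich e x e) = \<nu> x"
    if \<nu>: "\<nu> \<in> dual" "left_invariant K \<nu>" "right_invariant K \<nu>" and x: "x \<in> J" for \<nu> x
  proof -
    have L: "\<nu> (Lk f y) = \<nu> y" if y: "y \<in> J" for y
    proof -
      have "\<nu> (Lk f y) = (\<Sum>k\<in>K. c * \<nu> (k \<triangleright> y))"
        using y Kc \<nu>(1) by (simp add: Lk_def sumKs dual_sum dual_scale)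
      also have "\<dots> = (\<Sum>k\<in>K. c * \<nu> y)" using \<nu>(2) y by (simp add: left_invariant_def)
      also have "\<dots> = \<nu> y" using cK by (simp add: mult.assoc[symmetric])
      finally show ?thesis .
    qed
    have R: "\<nu> (Rk y f) = \<nu> y" if y: "y \<in> J" for y
    proof -
      have "\<nu> (Rk y f) = (\<Sum>k\<in>K. c * \<nu> (y \<triangleleft> k))"
        using y Kc \<nu>(1) by (simp add: Rk_def sumKs dual_sum dual_scale)
      also have "\<dots> = (\<Sum>k\<in>K. c * \<nu> y)" using \<nu>(3) y by (simp add: right_invariant_def)
      also have "\<dots> = \<nu> y" using cK by (simp add: mult.assoc[symmetric])
      finally show ?thesis .
    qed
    have "sandwich e x e = Rk (Lk f x) f" by (simp add: sandwich_def e_def of_J_def A_mult)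
    then show ?thesis using L R x by simp
  qed
  then show thesis using that idem KF by blast
qed

end

context triangular_type_character
begin

text \<open>The two characters are conjugate under \<open>c\<close>.\<close>

lemma induced_sandwich:
  assumes K: "K \<subseteq> carrier H" and l: "l \<in> dual" "l' \<in> dual"
    and c: "c \<in> carrier G" and d: "d \<in> carrier G" and cd: "hpart d = inv (hpart c)"
    and comm: "\<And>k. k \<in> K \<Longrightarrow> c \<otimes>\<^bsub>A\<^esub> of_H k = of_H k \<otimes>\<^bsub>A\<^esub> c"
    and l': "\<And>x. x \<in> J \<Longrightarrow> l' x = l (sandwich c x d)" and g: "g \<in> carrier G"
  shows "induced_character G (els K (J_right l')) (xi \<epsilon> \<theta> l') g =
    induced_character G (els K (J_right l)) (xi \<epsilon> \<theta> l) g"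
proof -
  obtain h u where hu: "h \<in> carrier H" "u \<in> J" "c = el h u" using c by (rule G_cases)
  obtain h' v where dv: "h' \<in> carrier H" "v \<in> J" "d = el h' v" using d by (rule G_cases)
  have h': "h' = inv h" using cd hu dv by simp
  have cA: "c \<in> carrier A" "d \<in> carrier A" using c d G_in_A by auto
  \<comment> \<open>Since w to cwd is onto \<open>J\<close>, testing z against all cwd is testing it
    against \<open>J\<close>.\<close>
  have surj: "\<exists>w\<in>J. sandwich c w d = x" if x: "x \<in> J" for x
  proof (rule bexI)
    have iA: "inv\<^bsub>G\<^esub> c \<in> carrier A" "inv\<^bsub>G\<^esub> d \<in> carrier A" using c d G_in_A by auto
    show "sandwich (inv\<^bsub>G\<^esub> c) x (inv\<^bsub>G\<^esub> d) \<in> J" using of_J_sandwich(2)[OF iA x] .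
    have "c \<otimes>\<^bsub>A\<^esub> inv\<^bsub>G\<^esub> c = \<one>\<^bsub>A\<^esub>" "inv\<^bsub>G\<^esub> d \<otimes>\<^bsub>A\<^esub> d = \<one>\<^bsub>A\<^esub>"
      using G.r_inv[OF c] G.l_inv[OF d] by (simp_all add: G_mult one_G A_one)
    then show "sandwich c (sandwich (inv\<^bsub>G\<^esub> c) x (inv\<^bsub>G\<^esub> d)) d = x"
      using x iA cA by (simp add: sandwich_sandwich sandwich_one)
  qed
  have key: "\<exists>z\<in>J. c \<otimes>\<^bsub>G\<^esub> el k y \<otimes>\<^bsub>G\<^esub> inv\<^bsub>G\<^esub> c = el k z \<and>
      (k \<in> K \<longrightarrow> (z \<in> J_right l \<longleftrightarrow> y \<in> J_right l') \<and> (z \<in> J_right l \<longrightarrow> l z = l' y))"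
    if k: "k \<in> carrier H" and y: "y \<in> J" for k y
  proof -
    obtain z where z: "z \<in> J" "c \<otimes>\<^bsub>G\<^esub> el k y \<otimes>\<^bsub>G\<^esub> inv\<^bsub>G\<^esub> c = el k z"
      "z \<triangleleft> h + z * u = u \<triangleleft> k - k \<triangleright> u + h \<triangleright> y + u * y"
      using conj_el[OF hu(1,2) k y] unfolding hu(3)[symmetric] by blast
    have "(z \<in> J_right l \<longleftrightarrow> y \<in> J_right l') \<and> (z \<in> J_right l \<longrightarrow> l z = l' y)" if kK: "k \<in> K"
    proof -
      \<comment> \<open>As c commutes with k, the terms uk - ku in \<open>conj_el\<close> cancel,
        which leaves cy = zc.\<close>
      have "el h u \<otimes>\<^bsub>A\<^esub> el k 0 = el k 0 \<otimes>\<^bsub>A\<^esub> el h u" using comm[OF kK] hu by (simp add: of_H_eq)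
      then have "u \<triangleleft> k = k \<triangleright> u" using hu k by (simp add: el_mult_A)
      then have e: "h \<triangleright> y + u * y = z \<triangleleft> h + z * u" using z(3) by simp
      have prod: "l' (y * w) = l (z * sandwich c w d)" if w: "w \<in> J" for w
      proof -
        have "sandwich c (y * w) d = (h \<triangleright> y + u * y) * (w \<triangleleft> inv h + w * v)"
          using hu dv w y by (simp add: h' sandwich_el lact_times ract_times ract_add distrib_left distrib_right mult.assoc)
        also have "\<dots> = z * sandwich c w d"
          unfolding e using hu dv w z(1)
          by (simp add: h' sandwich_el J_simps algebra_simps)
            (simp add: middle_times[symmetric] J_simps algebra_simps)
        finally show ?thesis using l'[of "y * w"] y w by simp
      qed
      have "z \<in> J_right l \<longleftrightarrow> y \<in> J_right l'"
      proof
        assume "z \<in> J_right l"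
        then show "y \<in> J_right l'"
          using prod y of_J_sandwich(2)[OF cA] by (simp add: J_right_def)
      next
        assume y': "y \<in> J_right l'"
        have "l (z * x) = 0" if x: "x \<in> J" for x
        proof -
          obtain w where "w \<in> J" "sandwich c w d = x" using surj[OF x] by blast
          then show ?thesis using prod[of w] y' by (simp add: J_right_def)
        qed
        then show "z \<in> J_right l" using z(1) by (simp add: J_right_def)
      qed
      moreover have "l z = l' y" if zR: "z \<in> J_right l"
      proof -
        \<comment> \<open>Here cyd = zcd, and cd is 1 plus an element of \<open>J\<close> because
          the \<open>H\<close>-parts cancel; l vanishes on the correction, since z is in the right
          annihilator.\<close>
        have "sandwich c y d = (z \<triangleleft> h + z * u) \<triangleleft> inv h + (z \<triangleleft> h + z * u) * v"
          using hu dv y by (simp add: h' sandwich_el e)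
        also have "\<dots> = z + z * (u \<triangleleft> inv h + h \<triangleright> v + u * v)"
          using hu dv z(1) by (simp add: ract_add ract_times middle_times algebra_simps)
        finally have "l' y = l z + l (z * (u \<triangleleft> inv h + h \<triangleright> v + u * v))"
          using l'[OF y] hu dv z(1) l(1) by (simp add: dual_add)
        also have "l (z * (u \<triangleleft> inv h + h \<triangleright> v + u * v)) = 0"
          using zR hu dv by (simp add: J_right_def)
        finally show ?thesis by simp
      qed
      ultimately show ?thesis by blast
    qed
    then show ?thesis using z(1,2) by blast
  qed
  show ?thesis
  proof (rule G.induced_character_conj[OF finite_G c _ g])
    show "els K (J_right l) \<subseteq> carrier G"
      unfolding els_carrier by (rule els_mono[OF K]) (auto simp: J_right_def)
    show "els K (J_right l') = {t \<in> carrier G. c \<otimes>\<^bsub>G\<^esub> t \<otimes>\<^bsub>G\<^esub> inv\<^bsub>G\<^esub> c \<in> els K (J_right l)}"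
    proof (intro equalityI subsetI)
      fix t assume "t \<in> els K (J_right l')"
      then obtain k y where t: "k \<in> K" "y \<in> J_right l'" "t = el k y" by (auto simp: els_def)
      have ky: "k \<in> carrier H" "y \<in> J" using t K by (auto simp: J_right_def)
      then show "t \<in> {t \<in> carrier G. c \<otimes>\<^bsub>G\<^esub> t \<otimes>\<^bsub>G\<^esub> inv\<^bsub>G\<^esub> c \<in> els K (J_right l)}"
        using key[OF ky] t by auto
    next
      fix t assume t: "t \<in> {t \<in> carrier G. c \<otimes>\<^bsub>G\<^esub> t \<otimes>\<^bsub>G\<^esub> inv\<^bsub>G\<^esub> c \<in> els K (J_right l)}"
      then obtain k y where ky: "k \<in> carrier H" "y \<in> J" "t = el k y" by (auto simp: carrier_G)
      then show "t \<in> els K (J_right l')" using key[OF ky(1,2)] t by auto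
    qed
    fix t assume "t \<in> els K (J_right l')"
    then obtain k y where t: "k \<in> K" "y \<in> J_right l'" "t = el k y" by (auto simp: els_def)
    have ky: "k \<in> carrier H" "y \<in> J" using t K by (auto simp: J_right_def)
    show "xi \<epsilon> \<theta> l' t = xi \<epsilon> \<theta> l (c \<otimes>\<^bsub>G\<^esub> t \<otimes>\<^bsub>G\<^esub> inv\<^bsub>G\<^esub> c)"
      using key[OF ky] t ky by (auto simp: xi_el)
  qed
qed

lemma character_on_sub: "character_on (H\<lparr>carrier := F\<rparr>) K \<theta> = character_on H K \<theta>"
  by (simp add: character_on_def)

text \<open>Extended by zero, the character of \<open>K + J_right l\<close> is
  \<open>card K / card F\<close> times the sum of its extensions to \<open>F + J_right l\<close>, by
  \<open>sum_extensions\<close>; this factor is the quotient of the two denominators.\<close>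

lemma induced_extensions:
  assumes F: "subgroup F H" and K: "subgroup K H" "K \<subseteq> F" and \<theta>: "character_on H K \<theta>"
  obtains E where "finite E" "\<And>\<psi>. \<psi> \<in> E \<Longrightarrow> character_on H F \<psi>"
    "\<And>l g. g \<in> carrier G \<Longrightarrow> induced_character G (els K (J_right l)) (xi \<epsilon> \<theta> l) g =
      (\<Sum>\<psi>\<in>E. induced_character G (els F (J_right l)) (xi \<epsilon> \<psi> l) g)"
proof -
  have Fc: "k \<in> carrier H" if "k \<in> F" for k using that F subgroup.mem_carrier by metis
  have finF: "finite F" using Fc H_finite by (meson finite_subset subsetI)
  interpret F: comm_group "H\<lparr>carrier := F\<rparr>"
    by (rule group.group_comm_groupI[OF H.subgroup_imp_group[OF F]]) (use Fc H.m_comm in auto)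
  have KF: "subgroup K (H\<lparr>carrier := F\<rparr>)"
    using H.subgroup_incl[OF K(1) F K(2)] .
  define E where "E = F.extensions K \<theta>"
  have sumE: "(\<Sum>\<psi>\<in>E. \<psi> h) = (if h \<in> K then of_nat (card F) / of_nat (card K) * \<theta> h else 0)"
    if "h \<in> F" for h
    using F.sum_extensions[OF _ KF, of \<theta> h] that finF \<theta> by (simp add: E_def character_on_sub order_def)
  have pos: "card F \<noteq> 0" "card K \<noteq> 0"
    using finF finite_subset[OF K(2) finF] subgroup.one_closed[OF F] subgroup.one_closed[OF K(1)] by auto
  show thesis
  proof (rule that[of E])
    show "finite E" unfolding E_def using F.finite_extensions finF by simp
    show "character_on H F \<psi>" if "\<psi> \<in> E" for \<psi>
      using that by (simp add: E_def F.extensions_def character_on_sub)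
    fix l g assume g: "g \<in> carrier G"
    let ?R = "J_right l"
    have pt: "(if s \<in> els K ?R then xi \<epsilon> \<theta> l s else 0) =
      of_nat (card K) / of_nat (card F) * (\<Sum>\<psi>\<in>E. if s \<in> els F ?R then xi \<epsilon> \<psi> l s else 0)"
      if s: "s \<in> carrier G" for s
    proof -
      obtain k z where s: "k \<in> carrier H" "z \<in> J" "s = el k z" using s by (rule G_cases)
      show ?thesis
      proof (cases "k \<in> F \<and> z \<in> ?R")
        case True
        then have "(\<Sum>\<psi>\<in>E. if s \<in> els F ?R then xi \<epsilon> \<psi> l s else 0) = (\<Sum>\<psi>\<in>E. \<psi> k) * \<epsilon> (l z)"
          using s by (simp add: xi_el sum_distrib_right)
        then show ?thesis using True s pos sumE by (simp add: xi_el)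
      qed (use s K in auto)
    qed
    have "(\<Sum>x\<in>carrier G. if x \<otimes>\<^bsub>G\<^esub> g \<otimes>\<^bsub>G\<^esub> inv\<^bsub>G\<^esub> x \<in> els K ?R then xi \<epsilon> \<theta> l (x \<otimes>\<^bsub>G\<^esub> g \<otimes>\<^bsub>G\<^esub> inv\<^bsub>G\<^esub> x) else 0) =
      (\<Sum>x\<in>carrier G. of_nat (card K) / of_nat (card F) *
        (\<Sum>\<psi>\<in>E. if x \<otimes>\<^bsub>G\<^esub> g \<otimes>\<^bsub>G\<^esub> inv\<^bsub>G\<^esub> x \<in> els F ?R then xi \<epsilon> \<psi> l (x \<otimes>\<^bsub>G\<^esub> g \<otimes>\<^bsub>G\<^esub> inv\<^bsub>G\<^esub> x) else 0))"
      using g by (intro sum.cong refl pt) auto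
    also have "\<dots> = of_nat (card K) / of_nat (card F) * (\<Sum>\<psi>\<in>E. \<Sum>x\<in>carrier G.
        if x \<otimes>\<^bsub>G\<^esub> g \<otimes>\<^bsub>G\<^esub> inv\<^bsub>G\<^esub> x \<in> els F ?R then xi \<epsilon> \<psi> l (x \<otimes>\<^bsub>G\<^esub> g \<otimes>\<^bsub>G\<^esub> inv\<^bsub>G\<^esub> x) else 0)"
      unfolding sum_distrib_left[symmetric] by (subst sum.swap) (rule refl)
    finally show "induced_character G (els K ?R) (xi \<epsilon> \<theta> l) g =
      (\<Sum>\<psi>\<in>E. induced_character G (els F ?R) (xi \<epsilon> \<psi> l) g)"
      unfolding G.induced_character_alt[OF finite_G] card_els sum_divide_distrib[symmetric]
      using pos by simp
  qed
qed

text \<open>The size of the ideal \<open>kHe\<close> measures minimality. If the orbit met the forms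
  of a corner f in \<open>kHe\<close> other than e, then f would still be fixed by \<open>K\<close>,
  because kf = (ke)f = f, and by \<open>move\<close> the induced function would be the same. But
  \<open>kHf\<close> lies strictly inside \<open>kHe\<close>: if e were in \<open>kHf\<close>, then
  e = ef = f.\<close>

lemma nat_combination_bi_invariant:
  assumes K: "subgroup K H" and \<theta>: "character_on H K \<theta>"
    and \<nu>: "\<nu> \<in> dual" "left_invariant K \<nu>" "right_invariant K \<nu>"
  shows "nat_combination \<epsilon> (induced_character G (els K (J_right \<nu>)) (xi \<epsilon> \<theta> \<nu>))"
proof -
  let ?I = "\<lambda>l. induced_character G (els K (J_right l)) (xi \<epsilon> \<theta> l)"
  have Kc: "K \<subseteq> carrier H" using subgroup.subset[OF K] .
  define P where "P e \<longleftrightarrow> e \<in> idempotents \<and> K \<subseteq> H_fix e \<and>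
    (\<exists>l\<in>dual_e e. \<forall>g\<in>carrier G. ?I l g = ?I \<nu> g)" for e
  define size where "size e = card ((\<lambda>z. z \<otimes>\<^bsub>A\<^esub> e) ` kH)" for e
  obtain e0 where e0: "e0 \<in> idempotents" "K \<subseteq> H_fix e0"
    "\<And>\<nu> x. \<nu> \<in> dual \<Longrightarrow> left_invariant K \<nu> \<Longrightarrow> right_invariant K \<nu> \<Longrightarrow> x \<in> J \<Longrightarrow> \<nu> (sandwich e0 x e0) = \<nu> x"
    using exists_fixing_idempotent[OF K] by blast
  have "P e0" unfolding P_def using e0 \<nu> dual_e_iff[OF e0(1)] by blast
  then obtain e where e: "P e" "\<And>f. P f \<Longrightarrow> size e \<le> size f"
    using ex_has_least_nat[of P e0 size] by blast
  have ei: "e \<in> idempotents" and KF: "K \<subseteq> H_fix e" using e(1) by (simp_all add: P_def)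
  note eA = idempotentD[OF ei]
  obtain l where l: "l \<in> dual_e e" "\<And>g. g \<in> carrier G \<Longrightarrow> ?I l g = ?I \<nu> g"
    using e(1) unfolding P_def by blast
  have ld: "l \<in> dual" using l(1) dual_e_iff[OF ei] by blast
  \<comment> \<open>The lifts c and d lie in \<open>G\<close>, and c commutes with H(e), hence with
    \<open>K\<close>, as \<open>induced_sandwich\<close> demands.\<close>
  have move: "?I (rho_dual e \<tau> l) g = ?I \<nu> g" if \<tau>: "\<tau> \<in> carrier (triples e)" and g: "g \<in> carrier G" for \<tau> g
  proof -
    obtain c d where c: "c \<in> cent e" and d: "d \<in> cent e" and cd: "hpart d = inv (hpart c)"
      and r: "\<And>x. x \<in> J \<Longrightarrow> rho_dual e \<tau> l x = l (sandwich c x d)"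
      using rho_dual_eq[OF ei \<tau> l(1)] by metis
    have "?I (rho_dual e \<tau> l) g = ?I l g"
      by (rule induced_sandwich[OF Kc ld rho_dual_dual[OF ei \<tau> l(1)] cent_in_G[OF c] cent_in_G[OF d] cd _ r g])
        (use c KF in \<open>auto simp: cent_def\<close>)
    then show ?thesis using l(2)[OF g] by simp
  qed
  define \<Omega> where "\<Omega> = {rho_dual e \<tau> l | \<tau>. \<tau> \<in> carrier (triples e)}"
  have "\<Omega> \<inter> dual_e f = {}" if f: "f \<in> idempotents" "f \<in> {z \<otimes>\<^bsub>A\<^esub> e | z. z \<in> kH}" "f \<noteq> e" for f
  proof (rule ccontr)
    assume "\<Omega> \<inter> dual_e f \<noteq> {}"
    then obtain \<tau> where \<tau>: "\<tau> \<in> carrier (triples e)" "rho_dual e \<tau> l \<in> dual_e f"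
      unfolding \<Omega>_def by blast
    obtain z where z: "z \<in> kH" "f = z \<otimes>\<^bsub>A\<^esub> e" using f by blast
    note fA = idempotentD[OF f(1)]
    have fe: "f \<otimes>\<^bsub>A\<^esub> e = f" "e \<otimes>\<^bsub>A\<^esub> f = f"
    proof -
      show "f \<otimes>\<^bsub>A\<^esub> e = f" using z kH_in_A[OF z(1)] eA by (simp add: A.m_assoc)
      then show "e \<otimes>\<^bsub>A\<^esub> f = f" using kH_comm[OF eA(1) fA(1)] by simp
    qed
    have "of_H k \<otimes>\<^bsub>A\<^esub> f = f" if k: "k \<in> K" for k
    proof -
      have kc: "k \<in> carrier H" "of_H k \<otimes>\<^bsub>A\<^esub> e = e" using k KF by (auto simp: H_fix_def)
      have "of_H k \<otimes>\<^bsub>A\<^esub> f = (of_H k \<otimes>\<^bsub>A\<^esub> e) \<otimes>\<^bsub>A\<^esub> f"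
        using kc(1) eA(2) fA(2) fe by (simp add: A.m_assoc)
      then show ?thesis using kc fe by simp
    qed
    then have "K \<subseteq> H_fix f" using Kc by (auto simp: H_fix_def)
    then have "P f" unfolding P_def using f(1) \<tau> move by blast
    then have le: "size e \<le> size f" by (rule e(2))
    have "(\<lambda>y. y \<otimes>\<^bsub>A\<^esub> f) ` kH \<subset> (\<lambda>y. y \<otimes>\<^bsub>A\<^esub> e) ` kH"
    proof
      show "(\<lambda>y. y \<otimes>\<^bsub>A\<^esub> f) ` kH \<subseteq> (\<lambda>y. y \<otimes>\<^bsub>A\<^esub> e) ` kH"
      proof
        fix x assume "x \<in> (\<lambda>y. y \<otimes>\<^bsub>A\<^esub> f) ` kH"
        then obtain y where y: "y \<in> kH" "x = y \<otimes>\<^bsub>A\<^esub> f" by blast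
        then have "x = (y \<otimes>\<^bsub>A\<^esub> z) \<otimes>\<^bsub>A\<^esub> e" using z kH_in_A eA by (simp add: A.m_assoc)
        then show "x \<in> (\<lambda>y. y \<otimes>\<^bsub>A\<^esub> e) ` kH" using kH_mult[OF y(1) z(1)] by blast
      qed
      show "(\<lambda>y. y \<otimes>\<^bsub>A\<^esub> f) ` kH \<noteq> (\<lambda>y. y \<otimes>\<^bsub>A\<^esub> e) ` kH"
      proof
        assume eq: "(\<lambda>y. y \<otimes>\<^bsub>A\<^esub> f) ` kH = (\<lambda>y. y \<otimes>\<^bsub>A\<^esub> e) ` kH"
        have "e \<in> (\<lambda>y. y \<otimes>\<^bsub>A\<^esub> e) ` kH" using eA by (metis imageI)
        then obtain y where y: "y \<in> kH" "e = y \<otimes>\<^bsub>A\<^esub> f" using eq by blast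
        then have "e \<otimes>\<^bsub>A\<^esub> f = e" using kH_in_A fA by (simp add: A.m_assoc)
        then show False using fe f(3) by simp
      qed
    qed
    then have "size f < size e" unfolding size_def using finite_kH by (intro psubset_card_mono) auto
    then show False using le by simp
  qed
  then have "\<Omega> \<in> regular_orbits e"
    using l(1) by (auto simp: regular_orbits_def dual_orbits_def \<Omega>_def)
  obtain E where E: "finite E" "\<And>\<psi>. \<psi> \<in> E \<Longrightarrow> character_on H (H_fix e) \<psi>"
    "\<And>l g. g \<in> carrier G \<Longrightarrow> ?I l g =
      (\<Sum>\<psi>\<in>E. induced_character G (els (H_fix e) (J_right l)) (xi \<epsilon> \<psi> l) g)"
    using induced_extensions[OF subgroup_H_fix[OF ei] K KF \<theta>] by metis
  obtain \<tau> where \<tau>: "\<tau> \<in> carrier (triples e)" using triples_nonempty[OF ei] by blast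
  \<comment> \<open>A member of the orbit, obtained from an arbitrary triple; by \<open>move\<close>
    it induces the same function as \<nu>.\<close>
  define l0 where "l0 = rho_dual e \<tau> l"
  have "l0 \<in> \<Omega>" unfolding l0_def \<Omega>_def using \<tau> by blast
  then have "induced_character G (els (H_fix e) (J_right l0)) (xi \<epsilon> \<psi> l0) \<in> supercharacters \<epsilon>"
    if "\<psi> \<in> E" for \<psi>
    using ei E(2)[OF that] \<open>\<Omega> \<in> regular_orbits e\<close>
    unfolding supercharacters_def index_set_def linear_character_eq G_sub_eq els_def by blast
  then have "nat_combination \<epsilon> (\<lambda>g. \<Sum>\<psi>\<in>E. induced_character G (els (H_fix e) (J_right l0)) (xi \<epsilon> \<psi> l0) g)"
    by (intro nat_combination_sum nat_combination_supercharacter)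
  then show ?thesis
    by (rule nat_combination_cong) (use E(3) move[OF \<tau>] in \<open>simp add: l0_def\<close>)
qed

end

context right_ideal_character
begin

text \<open>Each stabilizer has the form L + J_left; it is exchanged for L + J_right, to which the
  bi-invariant case applies.\<close>

lemma nat_combination_right_ideal:
  assumes \<theta>: "character_on H K \<theta>"
  shows "nat_combination \<epsilon> (induced_character G (els K R) (xi \<epsilon> \<theta> \<mu>))"
proof -
  obtain D where D: "D \<subseteq> agree R \<mu>" "\<And>\<nu>. \<nu> \<in> D \<Longrightarrow> split_stabilizer \<nu>"
    "\<And>g. g \<in> carrier G \<Longrightarrow> induced_character G (els K R) (xi \<epsilon> \<theta> \<mu>) g =
      (\<Sum>\<nu>\<in>D. induced_character G (stab \<nu>) (xi \<epsilon> \<theta> \<nu>) g)"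
    by (rule induced_decomposition) (rule that)
  have "nat_combination \<epsilon> (induced_character G (stab \<nu>) (xi \<epsilon> \<theta> \<nu>))" if \<nu>: "\<nu> \<in> D" for \<nu>
  proof -
    obtain L where L: "subgroup L H" "L \<subseteq> K" "stab \<nu> = els L (J_left \<nu>)"
      "left_invariant L \<nu>" "right_invariant L \<nu>"
      using D(2)[OF \<nu>] unfolding split_stabilizer_def by blast
    have \<nu>d: "\<nu> \<in> dual" using D(1) \<nu> agree_dual by blast
    have \<theta>L: "character_on H L \<theta>" using \<theta> L(2) by (auto simp: character_on_def)
    show ?thesis
      by (rule nat_combination_cong[OF nat_combination_bi_invariant[OF L(1) \<theta>L \<nu>d L(4,5)]])
        (simp add: L(3) induced_left_eq_right[OF L(1) \<nu>d L(4,5)])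
  qed
  then have "nat_combination \<epsilon> (\<lambda>g. \<Sum>\<nu>\<in>D. induced_character G (stab \<nu>) (xi \<epsilon> \<theta> \<nu>) g)"
    by (rule nat_combination_sum)
  then show ?thesis by (rule nat_combination_cong) (simp add: D(3))
qed

end

section \<open>Restriction to subgroups of triangular type\<close>

context triangular_type_character
begin

text \<open>For w = j + u this is x to l(w x j^-1). The factor j^-1 is there to make its value at y
  equal to l(z) when w(k + y)w^-1 = k + z lies in \<open>F + J_right l\<close>: z w j^-1 is z + z u
  j^-1, and l vanishes on the second term.\<close>

definition twist :: "('a \<Rightarrow> 'k) \<Rightarrow> ('h \<Rightarrow> 'k) \<times> 'a \<Rightarrow> 'a \<Rightarrow> 'k" where
  "twist l w = (\<lambda>x. if x \<in> J then l (sandwich w x (el (inv (hpart w)) 0)) else 0)"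

lemma twist_el:
  "j \<in> carrier H \<Longrightarrow> u \<in> J \<Longrightarrow> x \<in> J \<Longrightarrow> twist l (el j u) x = l ((j \<triangleright> x + u * x) \<triangleleft> inv j)"
  by (simp add: twist_def sandwich_el)

lemma twist_dual:
  assumes l: "l \<in> dual" and w: "w \<in> carrier G" shows "twist l w \<in> dual"
proof -
  have A: "w \<in> carrier A" "el (inv (hpart w)) 0 \<in> carrier A"
    using w G_in_A hpart_closed by auto
  show ?thesis unfolding twist_def
    by (rule dualI) (simp_all add: sandwich_add[OF A] sandwich_scale[OF A] of_J_sandwich(2)[OF A]
        dual_add[OF l] dual_scale[OF l])
qed

lemma ract_comm: "h \<in> carrier H \<Longrightarrow> k \<in> carrier H \<Longrightarrow> x \<in> J \<Longrightarrow> (x \<triangleleft> h) \<triangleleft> k = (x \<triangleleft> k) \<triangleleft> h"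
  and lact_comm: "h \<in> carrier H \<Longrightarrow> k \<in> carrier H \<Longrightarrow> x \<in> J \<Longrightarrow> h \<triangleright> (k \<triangleright> x) = k \<triangleright> (h \<triangleright> x)"
  by (simp_all add: ract_mult[symmetric] lact_mult[symmetric] H.m_comm)

text \<open>Right multiplication by \<open>F\<close> passes the factor j^-1 because \<open>H\<close>
  is abelian.\<close>

lemma twist_right_invariant:
  assumes F: "F \<subseteq> carrier H" and l: "right_invariant F l" and w: "w \<in> carrier G"
  shows "right_invariant F (twist l w)"
proof -
  obtain j u where j: "j \<in> carrier H" "u \<in> J" "w = el j u" using w by (rule G_cases)
  have "twist l w (x \<triangleleft> k) = twist l w x" if k: "k \<in> F" and x: "x \<in> J" for k x
  proof -
    have kc: "k \<in> carrier H" using k F by blast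
    have "(j \<triangleright> (x \<triangleleft> k) + u * (x \<triangleleft> k)) \<triangleleft> inv j = ((j \<triangleright> x + u * x) \<triangleleft> k) \<triangleleft> inv j"
      using j kc x by (simp add: ract_add actions_commute ract_times)
    also have "\<dots> = ((j \<triangleright> x + u * x) \<triangleleft> inv j) \<triangleleft> k"
      using j kc x by (intro ract_comm) auto
    finally show ?thesis
      using j kc x k l by (simp add: twist_el right_invariant_def)
  qed
  then show ?thesis by (simp add: right_invariant_def)
qed

text \<open>With \<open>w\<^sup>-\<^sup>1\<close> in the role of a double coset representative, membership of \<open>wqw\<^sup>-\<^sup>1\<close> in \<open>F + J\<^sub>\<lambda>\<close> says
  that \<open>twist \<lambda> w\<close> is invariant under left multiplication by \<open>q\<close>.\<close>

lemma conj_twist: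
  assumes F: "F \<subseteq> carrier H" and l: "l \<in> dual" "left_invariant F l" "right_invariant F l"
    and w: "w \<in> carrier G" and k: "k \<in> F" and y: "y \<in> J"
  obtains z where "z \<in> J" "w \<otimes>\<^bsub>G\<^esub> el k y \<otimes>\<^bsub>G\<^esub> inv\<^bsub>G\<^esub> w = el k z"
    "z \<in> J_right l \<longleftrightarrow> (\<forall>x\<in>J. twist l w (k \<triangleright> x + y * x) = twist l w x)"
    "z \<in> J_right l \<Longrightarrow> l z = twist l w y"
proof -
  obtain j u where j: "j \<in> carrier H" "u \<in> J" "w = el j u" using w by (rule G_cases)
  have kc: "k \<in> carrier H" using k F by blast
  have linv: "l (k \<triangleright> x) = l x" "l (x \<triangleleft> k) = l x" if "x \<in> J" for x
    using that l k by (auto simp: left_invariant_def right_invariant_def)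
  obtain z where z: "z \<in> J" "w \<otimes>\<^bsub>G\<^esub> el k y \<otimes>\<^bsub>G\<^esub> inv\<^bsub>G\<^esub> w = el k z"
    "z \<triangleleft> j + z * u = u \<triangleleft> k - k \<triangleright> u + j \<triangleright> y + u * y"
    using conj_el[OF j(1,2) kc y] unfolding j(3)[symmetric] by blast
  define s where "s x = (j \<triangleright> x + u * x) \<triangleleft> inv j" for x
  have sJ: "s x \<in> J" if "x \<in> J" for x using that j by (simp add: s_def)
  have s_sandwich: "s x = sandwich w x (el (inv j) 0)" if "x \<in> J" for x
    using that j by (simp add: s_def sandwich_el)
  \<comment> \<open>\<open>s\<close> maps \<open>J\<close> onto itself, so z annihilates all s x
    only if it annihilates \<open>J\<close>.\<close>
  have surj: "\<exists>x\<in>J. s x = x'" if x': "x' \<in> J" for x'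
  proof (rule bexI)
    have A: "w \<in> carrier A" "inv\<^bsub>G\<^esub> w \<in> carrier A" "el j 0 \<in> carrier A" "el (inv j) 0 \<in> carrier A"
      using w G_in_A j by auto
    show J: "sandwich (inv\<^bsub>G\<^esub> w) x' (el j 0) \<in> J" using of_J_sandwich(2)[OF A(2,3) x'] .
    have "w \<otimes>\<^bsub>A\<^esub> inv\<^bsub>G\<^esub> w = \<one>\<^bsub>A\<^esub>" using G.r_inv[OF w] by (simp add: G_mult one_G A_one)
    moreover have "el j 0 \<otimes>\<^bsub>A\<^esub> el (inv j) 0 = \<one>\<^bsub>A\<^esub>" using j by (simp add: el_mult_A A_one)
    ultimately show "s (sandwich (inv\<^bsub>G\<^esub> w) x' (el j 0)) = x'"
      using x' A by (simp add: s_sandwich[OF J] sandwich_sandwich sandwich_one)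
  qed
  have twist_s: "twist l w x = l (s x)" if "x \<in> J" for x
    using that j by (simp add: twist_el s_def)
  \<comment> \<open>This is w(k + y) = (k + z)w, multiplied on the right by x j^-1; left invariance
    of l removes k.\<close>
  have val: "twist l w (k \<triangleright> x + y * x) = twist l w x + l (z * s x)" if x: "x \<in> J" for x
  proof -
    have "j \<triangleright> (k \<triangleright> x + y * x) + u * (k \<triangleright> x + y * x) = k \<triangleright> (j \<triangleright> x) + (u \<triangleleft> k + j \<triangleright> y + u * y) * x"
      using j kc x y by (simp add: lact_add lact_times middle_times lact_comm[of j k] distrib_left distrib_right mult.assoc)
    also have "u \<triangleleft> k + j \<triangleright> y + u * y = k \<triangleright> u + (z \<triangleleft> j + z * u)" unfolding z(3) by simp
    also have "k \<triangleright> (j \<triangleright> x) + (k \<triangleright> u + (z \<triangleleft> j + z * u)) * x = k \<triangleright> (j \<triangleright> x + u * x) + z * (j \<triangleright> x + u * x)"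
      using j kc x z(1) by (simp add: lact_add lact_times middle_times distrib_left distrib_right mult.assoc)
    finally have "s (k \<triangleright> x + y * x) = k \<triangleright> s x + z * s x"
      using j kc x z(1) by (simp add: s_def ract_add[of _ "k \<triangleright> (j \<triangleright> x + u * x)"] actions_commute ract_times)
    then show ?thesis
      using x y z(1) kc sJ[OF x] l(1) by (simp add: twist_s linv dual_add)
  qed
  have "z \<in> J_right l \<longleftrightarrow> (\<forall>x\<in>J. l (z * s x) = 0)"
  proof
    show "z \<in> J_right l \<Longrightarrow> \<forall>x\<in>J. l (z * s x) = 0" using sJ by (simp add: J_right_def)
    assume a: "\<forall>x\<in>J. l (z * s x) = 0"
    have "l (z * x') = 0" if "x' \<in> J" for x' using surj[OF that] a by blast
    then show "z \<in> J_right l" using z(1) by (simp add: J_right_def)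
  qed
  then have 1: "z \<in> J_right l \<longleftrightarrow> (\<forall>x\<in>J. twist l w (k \<triangleright> x + y * x) = twist l w x)"
    by (simp add: val)
  \<comment> \<open>Solving the same identity for w y j^-1 leaves z, a commutator with k on which l
    vanishes by invariance, and z u j^-1 with z in the right annihilator.\<close>
  have 2: "l z = twist l w y" if zR: "z \<in> J_right l"
  proof -
    have "j \<triangleright> y + u * y = k \<triangleright> u - u \<triangleleft> k + (z \<triangleleft> j + z * u)" unfolding z(3) by simp
    then have "s y = k \<triangleright> (u \<triangleleft> inv j) - (u \<triangleleft> inv j) \<triangleleft> k + (z + z * (u \<triangleleft> inv j))"
      using j kc z(1) by (simp add: s_def ract_add ract_diff ract_times actions_commute ract_comm[of k "inv j"])
    moreover have "l (z * (u \<triangleleft> inv j)) = 0" using zR j by (simp add: J_right_def)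
    ultimately have "l (s y) = l z"
      using y j(1,2) kc z(1) l(1) by (simp add: dual_add dual_diff linv)
    then show ?thesis using twist_s[OF y] by simp
  qed
  show thesis using that[OF z(1,2) 1] 2 by blast
qed

text \<open>A Mackey representative w may be changed within wQ. A factor from 1 + J' makes the
  twisted form left invariant under the projection \<open>K w\<close>, while right invariance is
  inherited from l. The component is then an instance of \<open>right_ideal_character\<close> over
  \<open>J'\<close>.\<close>

lemma restrict_nat_combination:
  assumes sub: "triangular_subgroup H' J'"
    and F: "subgroup F H" and l: "l \<in> dual" "left_invariant F l" "right_invariant F l"
    and \<theta>: "character_on H F \<theta>"
  shows "triangular_type.nat_combination scale (H\<lparr>carrier := H'\<rparr>) J' lact ract \<epsilon>
    (induced_character G (els F (J_right l)) (xi \<epsilon> \<theta> l))"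
proof -
  interpret sub: triangular_type_character scale "H\<lparr>carrier := H'\<rparr>" J' lact ract \<epsilon>
    by (intro triangular_type_character.intro triangular_type_triangular_subgroup[OF sub]
        additive_character_axioms)
  have H': "subgroup H' H" and J': "J' \<subseteq> J" "subspace J'"
    using sub by (auto simp: triangular_subgroup_def)
  have H'c: "h \<in> carrier H" if "h \<in> H'" for h using that H' subgroup.mem_carrier by metis
  have J'J: "x \<in> J" if "x \<in> J'" for x using that J' by blast
  have Fc: "F \<subseteq> carrier H" using subgroup.subset[OF F] .
  let ?R = "J_right l" and ?\<xi> = "xi \<epsilon> \<theta> l"
  define S where "S = els F ?R"
  define Q where "Q = els H' J'"
  have \<theta>m: "\<theta> (h \<otimes> k) = \<theta> h * \<theta> k" "\<theta> h \<noteq> 0" if "h \<in> F" "k \<in> F" for h k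
    using that \<theta> by (auto simp: character_on_def)
  have RJ: "?R \<subseteq> J" by (auto simp: J_right_def)
  have R_closed: "k \<triangleright> y + x \<triangleleft> h + x * y \<in> ?R" if "k \<in> F" "h \<in> F" "x \<in> ?R" "y \<in> ?R" for h k x y
  proof -
    have c: "k \<in> carrier H" "h \<in> carrier H" "x \<in> J" "y \<in> J" using that Fc RJ by auto
    have "l ((k \<triangleright> y + x \<triangleleft> h + x * y) * w) = l (k \<triangleright> (y * w)) + l (x * (h \<triangleright> w)) + l (x * (y * w))"
      if w: "w \<in> J" for w
      using c w l(1) by (simp add: distrib_right dual_add lact_times middle_times mult.assoc)
    then show ?thesis
      using that c l(2) by (simp add: J_right_def left_invariant_def)
  qed
  have S: "subgroup S G"
    unfolding S_def by (rule subgroup_els[OF F RJ _ R_closed]) (use l(1) in \<open>auto simp: J_right_def dual_zero intro!: exI[of _ 0]\<close>)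
  have Q: "subgroup Q G"
    unfolding Q_def
    by (rule subgroup_els[OF H' J'(1)]) (use sub.J_zero sub.J_closed in auto)
  have \<xi>_mult: "?\<xi> (s \<otimes>\<^bsub>G\<^esub> t) = ?\<xi> s * ?\<xi> t" "?\<xi> s \<noteq> 0" if "s \<in> S" "t \<in> S" for s t
  proof -
    obtain h x where s: "h \<in> F" "x \<in> ?R" "s = el h x" using \<open>s \<in> S\<close> by (auto simp: S_def els_def)
    obtain k y where t: "k \<in> F" "y \<in> ?R" "t = el k y" using \<open>t \<in> S\<close> by (auto simp: S_def els_def)
    have c: "h \<in> carrier H" "k \<in> carrier H" "x \<in> J" "y \<in> J" using s t Fc RJ by auto
    have "l (h \<triangleright> y + x \<triangleleft> k + x * y) = l y + l x"
      using c s t l by (simp add: dual_add left_invariant_def right_invariant_def J_right_def)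
    then show "?\<xi> (s \<otimes>\<^bsub>G\<^esub> t) = ?\<xi> s * ?\<xi> t"
      using s t c by (simp add: xi_el \<theta>m eps_add mult_ac)
    show "?\<xi> s \<noteq> 0" using s t c \<theta>m by (simp add: xi_el)
  qed
  have \<xi>_conj: "?\<xi> (s \<otimes>\<^bsub>G\<^esub> t \<otimes>\<^bsub>G\<^esub> inv\<^bsub>G\<^esub> s) = ?\<xi> t" if s: "s \<in> S" and t: "t \<in> S" for s t
  proof -
    have c: "s \<in> carrier G" "t \<in> carrier G" using s t S subgroup.mem_carrier by metis+
    have m: "s \<otimes>\<^bsub>G\<^esub> t \<otimes>\<^bsub>G\<^esub> inv\<^bsub>G\<^esub> s \<in> S"
      using s t S by (simp add: subgroup.m_closed subgroup.m_inv_closed)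
    have "?\<xi> (s \<otimes>\<^bsub>G\<^esub> t \<otimes>\<^bsub>G\<^esub> inv\<^bsub>G\<^esub> s) * ?\<xi> s = ?\<xi> (s \<otimes>\<^bsub>G\<^esub> t \<otimes>\<^bsub>G\<^esub> inv\<^bsub>G\<^esub> s \<otimes>\<^bsub>G\<^esub> s)"
      using \<xi>_mult(1)[OF m s] by simp
    also have "\<dots> = ?\<xi> s * ?\<xi> t" using c \<xi>_mult(1)[OF s t] by (simp add: G.m_assoc)
    finally show ?thesis using \<xi>_mult(2)[OF s s] by simp
  qed
  \<comment> \<open>The intersection of \<open>Q\<close> with w^-1 S w; \<open>K w\<close> is its
    projection to \<open>H\<close>.\<close>
  define T where "T w = {q \<in> Q. w \<otimes>\<^bsub>G\<^esub> q \<otimes>\<^bsub>G\<^esub> inv\<^bsub>G\<^esub> w \<in> S}" for w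
  define K where "K w = {k. \<exists>y. el k y \<in> T w}" for w
  have T_iff: "el k y \<in> T w \<longleftrightarrow> k \<in> H' \<and> k \<in> F \<and> y \<in> J' \<and> (\<forall>x\<in>J. twist l w (k \<triangleright> x + y * x) = twist l w x)"
    if w: "w \<in> carrier G" for k y w
  proof (cases "k \<in> H' \<and> y \<in> J'")
    case True
    then have c: "k \<in> carrier H" "y \<in> J" using H'c J'J by auto
    show ?thesis
    proof (cases "k \<in> F")
      case kF: True
      obtain z where "w \<otimes>\<^bsub>G\<^esub> el k y \<otimes>\<^bsub>G\<^esub> inv\<^bsub>G\<^esub> w = el k z"
        "z \<in> ?R \<longleftrightarrow> (\<forall>x\<in>J. twist l w (k \<triangleright> x + y * x) = twist l w x)"
        using conj_twist[OF Fc l w kF c(2)] by blast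
      then show ?thesis using True kF by (simp add: T_def Q_def S_def)
    next
      \<comment> \<open>Conjugation keeps the \<open>H\<close>-part, so an element with k outside
        \<open>F\<close> cannot be moved into \<open>S\<close>.\<close>
      case False
      obtain j u where j: "j \<in> carrier H" "u \<in> J" "w = el j u" using w by (rule G_cases)
      obtain z where "w \<otimes>\<^bsub>G\<^esub> el k y \<otimes>\<^bsub>G\<^esub> inv\<^bsub>G\<^esub> w = el k z"
        using conj_el[OF j(1,2) c] unfolding j(3) by blast
      then show ?thesis using False by (simp add: T_def S_def)
    qed
  qed (auto simp: T_def Q_def)
  have T_val: "?\<xi> (w \<otimes>\<^bsub>G\<^esub> el k y \<otimes>\<^bsub>G\<^esub> inv\<^bsub>G\<^esub> w) = \<theta> k * \<epsilon> (twist l w y)"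
    if w: "w \<in> carrier G" and q: "el k y \<in> T w" for k y w
  proof -
    have c: "k \<in> H'" "k \<in> F" "y \<in> J'" using q T_iff[OF w] by auto
    obtain z where z: "w \<otimes>\<^bsub>G\<^esub> el k y \<otimes>\<^bsub>G\<^esub> inv\<^bsub>G\<^esub> w = el k z" "z \<in> ?R \<Longrightarrow> l z = twist l w y"
      using conj_twist[OF Fc l w c(2) J'J[OF c(3)]] by blast
    have "z \<in> ?R" using q z(1) by (simp add: T_def S_def)
    then show ?thesis using z H'c[OF c(1)] by (simp add: xi_el)
  qed
  have T_closed: "p \<otimes>\<^bsub>G\<^esub> q \<in> T w" if w: "w \<in> carrier G" and p: "p \<in> T w" and q: "q \<in> T w" for p q w
  proof -
    have c: "p \<in> carrier G" "q \<in> carrier G" using p q Q subgroup.mem_carrier[OF Q] by (auto simp: T_def)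
    have "w \<otimes>\<^bsub>G\<^esub> (p \<otimes>\<^bsub>G\<^esub> q) \<otimes>\<^bsub>G\<^esub> inv\<^bsub>G\<^esub> w =
        (w \<otimes>\<^bsub>G\<^esub> p \<otimes>\<^bsub>G\<^esub> (inv\<^bsub>G\<^esub> w \<otimes>\<^bsub>G\<^esub> w)) \<otimes>\<^bsub>G\<^esub> q \<otimes>\<^bsub>G\<^esub> inv\<^bsub>G\<^esub> w"
      using w c by (simp add: G.m_assoc del: el_mult)
    also have "\<dots> = (w \<otimes>\<^bsub>G\<^esub> p \<otimes>\<^bsub>G\<^esub> inv\<^bsub>G\<^esub> w) \<otimes>\<^bsub>G\<^esub> (w \<otimes>\<^bsub>G\<^esub> q \<otimes>\<^bsub>G\<^esub> inv\<^bsub>G\<^esub> w)"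
      using w c by (simp only: G.m_assoc G.m_closed G.inv_closed)
    finally show ?thesis
      using p q subgroup.m_closed[OF S] subgroup.m_closed[OF Q] by (simp add: T_def)
  qed
  have K_sub: "K w \<subseteq> H'" "K w \<subseteq> F" if "w \<in> carrier G" for w
    using T_iff[OF that] by (auto simp: K_def)
  have K_subgroup: "subgroup (K w) H" if w: "w \<in> carrier G" for w
  proof (rule H.finite_mult_closed_subgroup[OF H_finite])
    show "K w \<subseteq> carrier H" using K_sub[OF w] H'c by blast
    have "el \<one> 0 \<in> T w"
      using T_iff[OF w] subgroup.one_closed[OF H'] subgroup.one_closed[OF F] sub.J_zero by (simp add: lact_one)
    then show "K w \<noteq> {}" by (auto simp: K_def)
    fix h k assume "h \<in> K w" "k \<in> K w"
    then obtain x y where "el h x \<in> T w" "el k y \<in> T w" by (auto simp: K_def)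
    moreover have "h \<in> carrier H" "k \<in> carrier H" using K_sub[OF w] \<open>h \<in> K w\<close> \<open>k \<in> K w\<close> H'c by blast+
    ultimately show "h \<otimes> k \<in> K w" using T_closed[OF w, of "el h x" "el k y"] unfolding K_def by auto
  qed
  have choice: "\<exists>q\<in>Q. left_invariant (K (w \<otimes>\<^bsub>G\<^esub> q)) (twist l (w \<otimes>\<^bsub>G\<^esub> q))" if w: "w \<in> carrier G" for w
  proof -
    let ?K = "K w" and ?\<mu> = "twist l w"
    obtain j u where j: "j \<in> carrier H" "u \<in> J" "w = el j u" using w by (rule G_cases)
    have \<mu>: "?\<mu> \<in> dual" by (rule twist_dual[OF l(1) w])
    have Kc: "k \<in> carrier H" if "k \<in> ?K" for k using that K_sub[OF w] H'c by blast
    have KH': "k \<in> H'" if "k \<in> ?K" for k using that K_sub[OF w] by blast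
    have "\<forall>k\<in>?K. \<exists>y. el k y \<in> T w" by (auto simp: K_def)
    from bchoice[OF this] obtain f where f: "\<And>k. k \<in> ?K \<Longrightarrow> el k (f k) \<in> T w" by blast
    have fJ: "f k \<in> J'" "f k \<in> J" if "k \<in> ?K" for k using f[OF that] T_iff[OF w] J'J by auto
    define c where "c = inverse (of_nat (card ?K) :: 'k)"
    have cK: "c * of_nat (card ?K) = 1" using card_K_nonzero[OF K_subgroup[OF w]] by (simp add: c_def)

    have fkJ': "f k \<triangleleft> inv k \<in> J'" if "k \<in> ?K" for k
      using fJ[OF that] KH'[OF that] subgroup.m_inv_closed[OF H'] by (intro sub.ract_closed) auto
    define s where "s = (\<Sum>k\<in>?K. f k \<triangleleft> inv k)"
    have s: "s \<in> J'" unfolding s_def by (rule sub.J_sum) (rule fkJ')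
    then have sJ: "s \<in> J" by (rule J'J)
    note s = s sJ
    \<comment> \<open>The mean of the elements (k + f(k)) k^-1 = 1 + f(k) k^-1. It lies in 1 + J',
      so wq is in the same coset wQ.\<close>
    define q where "q = el \<one> (c *s s)"
    have qQ: "q \<in> Q"
      unfolding q_def Q_def using subgroup.one_closed[OF H'] sub.J_scale[OF s(1)] by simp
    have qG: "q \<in> carrier G" using subgroup.mem_carrier[OF Q qQ] .
    have wq: "w \<otimes>\<^bsub>G\<^esub> q = el j (j \<triangleright> (c *s s) + u + u * (c *s s))"
      using j s by (simp add: q_def ract_one)
    have tw_q: "twist l (w \<otimes>\<^bsub>G\<^esub> q) x = ?\<mu> (x + (c *s s) * x)" if x: "x \<in> J" for x
    proof -
      have "j \<triangleright> x + (j \<triangleright> (c *s s) + u + u * (c *s s)) * x = j \<triangleright> (x + (c *s s) * x) + u * (x + (c *s s) * x)"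
        using j s x by (simp add: lact_add lact_times distrib_left distrib_right mult.assoc)
      then show ?thesis unfolding wq unfolding j(3) using j(1,2) s x by (simp add: twist_el)
    qed
    \<comment> \<open>Each k + f(k) leaves the twisted form unchanged from the left, so the new form
      is the mean of \<mu>(k^-1 x) over k, and left invariance becomes a reindexing.\<close>
    have tw: "twist l (w \<otimes>\<^bsub>G\<^esub> q) x = c * (\<Sum>k\<in>?K. ?\<mu> (inv k \<triangleright> x))" if x: "x \<in> J" for x
    proof -
      have t: "?\<mu> ((f k \<triangleleft> inv k) * x) = ?\<mu> (inv k \<triangleright> x) - ?\<mu> x" if k: "k \<in> ?K" for k
      proof -
        have "?\<mu> (k \<triangleright> (inv k \<triangleright> x) + f k * (inv k \<triangleright> x)) = ?\<mu> (inv k \<triangleright> x)"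
          using f[OF k] T_iff[OF w] Kc[OF k] x by (meson H.inv_closed lact_closed)
        then show ?thesis
          using Kc[OF k] x fJ[OF k] \<mu> by (simp add: middle_times dual_add algebra_simps)
      qed
      have "twist l (w \<otimes>\<^bsub>G\<^esub> q) x = ?\<mu> x + c * ?\<mu> (s * x)"
        using x s \<mu> by (simp add: tw_q J_scale_left dual_add dual_scale)
      also have "?\<mu> (s * x) = (\<Sum>k\<in>?K. ?\<mu> ((f k \<triangleleft> inv k) * x))"
        using x fJ Kc by (simp add: s_def sum_distrib_right dual_sum[OF \<mu>])
      also have "\<dots> = (\<Sum>k\<in>?K. ?\<mu> (inv k \<triangleright> x)) - of_nat (card ?K) * ?\<mu> x"
        by (simp add: t sum_subtractf)
      also have "?\<mu> x + c * ((\<Sum>k\<in>?K. ?\<mu> (inv k \<triangleright> x)) - of_nat (card ?K) * ?\<mu> x) =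
          c * (\<Sum>k\<in>?K. ?\<mu> (inv k \<triangleright> x)) + (1 - c * of_nat (card ?K)) * ?\<mu> x"
        by (simp add: algebra_simps)
      finally show ?thesis by (simp add: cK)
    qed
    have inv: "twist l (w \<otimes>\<^bsub>G\<^esub> q) (h \<triangleright> x) = twist l (w \<otimes>\<^bsub>G\<^esub> q) x" if h: "h \<in> ?K" and x: "x \<in> J" for h x
    proof -
      have hc: "h \<in> carrier H" using Kc[OF h] .
      have "(\<Sum>k\<in>?K. ?\<mu> (inv k \<triangleright> (h \<triangleright> x))) = (\<Sum>k\<in>?K. ?\<mu> (inv k \<triangleright> x))"
      proof (rule sum.reindex_bij_witness[of _ "\<lambda>k. h \<otimes> k" "\<lambda>k. inv h \<otimes> k"])
        fix k assume k: "k \<in> ?K"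
        then have kc: "k \<in> carrier H" using Kc by blast
        show "h \<otimes> (inv h \<otimes> k) = k" "inv h \<otimes> (h \<otimes> k) = k"
          using kc hc by (simp_all add: H.m_assoc[symmetric])
        show "inv h \<otimes> k \<in> ?K" "h \<otimes> k \<in> ?K"
          using k h K_subgroup[OF w] by (auto intro: subgroup.m_closed subgroup.m_inv_closed)
        have "inv (inv h \<otimes> k) \<triangleright> x = inv k \<triangleright> (h \<triangleright> x)"
          using kc hc x by (simp add: H.inv_mult_group lact_mult[symmetric])
        then show "?\<mu> (inv (inv h \<otimes> k) \<triangleright> x) = ?\<mu> (inv k \<triangleright> (h \<triangleright> x))" by simp
      qed
      then show ?thesis using hc x by (simp add: tw)
    qed
    \<comment> \<open>Invariance is demanded under the projection belonging to wq. Conjugation by q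
      keeps \<open>H\<close>-parts, so that projection lies in the old one.\<close>
    have "K (w \<otimes>\<^bsub>G\<^esub> q) \<subseteq> ?K"
    proof
      fix k assume "k \<in> K (w \<otimes>\<^bsub>G\<^esub> q)"
      then obtain y where y: "el k y \<in> T (w \<otimes>\<^bsub>G\<^esub> q)" by (auto simp: K_def)
      then have yQ: "el k y \<in> Q" by (simp add: T_def)
      then have yG: "el k y \<in> carrier G" using subgroup.mem_carrier[OF Q] by blast
      have "w \<otimes>\<^bsub>G\<^esub> (q \<otimes>\<^bsub>G\<^esub> el k y \<otimes>\<^bsub>G\<^esub> inv\<^bsub>G\<^esub> q) \<otimes>\<^bsub>G\<^esub> inv\<^bsub>G\<^esub> w =
          (w \<otimes>\<^bsub>G\<^esub> q) \<otimes>\<^bsub>G\<^esub> el k y \<otimes>\<^bsub>G\<^esub> inv\<^bsub>G\<^esub> (w \<otimes>\<^bsub>G\<^esub> q)"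
        using w qG yG by (simp add: G.m_assoc G.inv_mult_group del: el_mult)
      moreover have "q \<otimes>\<^bsub>G\<^esub> el k y \<otimes>\<^bsub>G\<^esub> inv\<^bsub>G\<^esub> q \<in> Q"
        using qQ yQ Q by (simp add: subgroup.m_closed subgroup.m_inv_closed del: el_mult)
      ultimately have "q \<otimes>\<^bsub>G\<^esub> el k y \<otimes>\<^bsub>G\<^esub> inv\<^bsub>G\<^esub> q \<in> T w"
        using y by (simp add: T_def del: el_mult)
      moreover have "\<exists>z. q \<otimes>\<^bsub>G\<^esub> el k y \<otimes>\<^bsub>G\<^esub> inv\<^bsub>G\<^esub> q = el k z"
        using conj_el[of \<one> "c *s s" k y] s yG unfolding q_def by (metis H.one_closed J_scale el_in_G)
      ultimately show "k \<in> ?K" unfolding K_def by auto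
    qed
    then show ?thesis using inv qQ unfolding left_invariant_def by blast
  qed
  obtain D where D: "finite D" "D \<subseteq> carrier G" "\<And>w. w \<in> D \<Longrightarrow> left_invariant (K w) (twist l w)"
    "\<And>g. g \<in> Q \<Longrightarrow> induced_character G S ?\<xi> g = (\<Sum>w\<in>D. induced_character (G\<lparr>carrier := Q\<rparr>)
      {q \<in> Q. w \<otimes>\<^bsub>G\<^esub> q \<otimes>\<^bsub>G\<^esub> inv\<^bsub>G\<^esub> w \<in> S} (\<lambda>q. ?\<xi> (w \<otimes>\<^bsub>G\<^esub> q \<otimes>\<^bsub>G\<^esub> inv\<^bsub>G\<^esub> w)) g)"
    by (rule G.induced_character_restrict[OF finite_G Q S \<xi>_conj choice]) (assumption+, rule that)
  have carrier_sub: "carrier sub.G = Q" by (simp add: sub.els_carrier Q_def)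
  have part: "sub.nat_combination \<epsilon> (induced_character (G\<lparr>carrier := Q\<rparr>) (T w) (\<lambda>q. ?\<xi> (w \<otimes>\<^bsub>G\<^esub> q \<otimes>\<^bsub>G\<^esub> inv\<^bsub>G\<^esub> w)))"
    if wD: "w \<in> D" for w
  proof -
    have w: "w \<in> carrier G" using wD D(2) by blast
    let ?\<mu> = "twist l w"
    have \<mu>: "?\<mu> \<in> dual" by (rule twist_dual[OF l(1) w])
    have linv: "?\<mu> (k \<triangleright> x) = ?\<mu> x" if "k \<in> K w" "x \<in> J" for k x
      using D(3)[OF wD] that by (simp add: left_invariant_def)
    have rinv: "?\<mu> (x \<triangleleft> k) = ?\<mu> x" if "k \<in> K w" "x \<in> J" for k x
      using twist_right_invariant[OF Fc l(3) w] that K_sub[OF w] by (auto simp: right_invariant_def)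
    have Kc: "k \<in> carrier H" "k \<in> H'" if "k \<in> K w" for k using that K_sub[OF w] H'c by blast+
    \<comment> \<open>Products with all of \<open>J\<close> are tested, as in \<open>T_iff\<close>;
      hence \<open>R\<close> may be a proper part of the right annihilator formed in
      \<open>J'\<close>.\<close>
    define R where "R = {y \<in> J'. \<forall>x\<in>J. ?\<mu> (y * x) = 0}"
    \<comment> \<open>Forms for the subgroup are normalised to 0 outside \<open>J'\<close>.\<close>
    define \<mu>' where "\<mu>' x = (if x \<in> J' then ?\<mu> x else 0)" for x
    interpret r: right_ideal_character scale "H\<lparr>carrier := H'\<rparr>" J' lact ract \<epsilon> "K w" \<theta> R \<mu>'
    proof (intro right_ideal_character.intro right_ideal_character_axioms.intro)
      show "triangular_type_character scale (H\<lparr>carrier := H'\<rparr>) J' lact ract \<epsilon>"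
        by (rule sub.triangular_type_character_axioms)
      show "subgroup (K w) (H\<lparr>carrier := H'\<rparr>)"
        using H.subgroup_incl[OF K_subgroup[OF w] H' K_sub(1)[OF w]] .
      show "subspace R"
        by (rule subspaceI) (use \<mu> J'J in \<open>auto simp: R_def dual_zero distrib_right dual_add J_scale_left dual_scale sub.J_zero sub.J_add sub.J_scale\<close>)
      show "R \<subseteq> J'" by (auto simp: R_def)
      show "x * y \<in> R" "\<mu>' (x * y) = 0" if "x \<in> R" "y \<in> J'" for x y
        using that J'J by (simp_all add: R_def \<mu>'_def mult.assoc sub.J_mult)
      show "x \<triangleleft> k \<in> R" if x: "x \<in> R" and k: "k \<in> K w" for x k
      proof -
        have "x \<triangleleft> k \<in> J'" using x Kc[OF k] sub.ract_closed by (simp add: R_def)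
        moreover have "?\<mu> ((x \<triangleleft> k) * y) = 0" if "y \<in> J" for y
          using x Kc[OF k] that J'J by (simp add: R_def middle_times[symmetric])
        ultimately show ?thesis by (simp add: R_def)
      qed
      \<comment> \<open>Here (kx - x)y = k(xy) - xy, and \<mu> is left invariant on all of
        \<open>J\<close>, not only on \<open>J'\<close>.\<close>
      show "k \<triangleright> x - x \<in> R" if x: "x \<in> J'" and k: "k \<in> K w" for x k
      proof -
        have "k \<triangleright> x \<in> J'" using x Kc[OF k] sub.lact_closed by simp
        then have "k \<triangleright> x - x \<in> J'" using x sub.J_diff by blast
        moreover have "?\<mu> ((k \<triangleright> x - x) * y) = 0" if "y \<in> J" for y
          using J'J[OF x] Kc[OF k] that linv[OF k, of "x * y"] \<mu>
          by (simp add: left_diff_distrib dual_diff lact_times)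
        ultimately show ?thesis by (simp add: R_def)
      qed
      show "\<mu>' \<in> sub.dual" unfolding \<mu>'_def
        by (rule sub.dualI) (use \<mu> J'J in \<open>auto simp: dual_add dual_scale\<close>)
      show "sub.left_invariant (K w) \<mu>'" "sub.right_invariant (K w) \<mu>'"
        using linv rinv J'J Kc sub.lact_closed sub.ract_closed
        by (auto simp: sub.left_invariant_def sub.right_invariant_def \<mu>'_def)
    qed
    have RJ': "R \<subseteq> J'" by (auto simp: R_def)
    have T_eq: "T w = els (K w) R"
    proof -
      have "el k y \<in> T w \<longleftrightarrow> k \<in> K w \<and> y \<in> R" for k y
      proof
        assume a: "el k y \<in> T w"
        then have k: "k \<in> K w" by (auto simp: K_def)
        have y: "y \<in> J'" "\<And>x. x \<in> J \<Longrightarrow> ?\<mu> (k \<triangleright> x + y * x) = ?\<mu> x" using a T_iff[OF w] by auto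
        have "?\<mu> (y * x) = 0" if "x \<in> J" for x
          using y(2)[OF that] that linv[OF k that] J'J[OF y(1)] Kc[OF k] \<mu> by (simp add: dual_add)
        then show "k \<in> K w \<and> y \<in> R" using k y by (simp add: R_def)
      next
        assume a: "k \<in> K w \<and> y \<in> R"
        then have "y \<in> J'" "k \<in> H'" "k \<in> F" using K_sub[OF w] by (auto simp: R_def)
        moreover have "?\<mu> (k \<triangleright> x + y * x) = ?\<mu> x" if "x \<in> J" for x
          using a that linv[of k x] J'J \<mu> Kc by (simp add: dual_add R_def)
        ultimately show "el k y \<in> T w" using T_iff[OF w] by blast
      qed
      moreover have "\<exists>k y. q = el k y" if "q \<in> T w" for q
        using that by (auto simp: T_def Q_def els_def)
      ultimately show ?thesis unfolding els_def by blast
    qed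
    have \<theta>K: "character_on (H\<lparr>carrier := H'\<rparr>) (K w) \<theta>"
      using \<theta> K_sub[OF w] unfolding character_on_def by (simp add: subset_iff)
    show ?thesis
    proof (rule sub.nat_combination_cong[OF r.nat_combination_right_ideal[OF \<theta>K]])
      fix g assume "g \<in> carrier sub.G"
      then have g: "g \<in> Q" using carrier_sub by simp
      have "induced_character (G\<lparr>carrier := Q\<rparr>) (T w) (\<lambda>q. ?\<xi> (w \<otimes>\<^bsub>G\<^esub> q \<otimes>\<^bsub>G\<^esub> inv\<^bsub>G\<^esub> w)) g =
          induced_character (G\<lparr>carrier := Q\<rparr>) (els (K w) R) (sub.xi \<epsilon> \<theta> \<mu>') g"
        unfolding T_eq
      proof (rule induced_character_cong[OF refl])
        fix q assume q: "q \<in> els (K w) R"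
        then obtain k y where ky: "k \<in> K w" "y \<in> R" "q = el k y" by (auto simp: els_def)
        then have "?\<xi> (w \<otimes>\<^bsub>G\<^esub> q \<otimes>\<^bsub>G\<^esub> inv\<^bsub>G\<^esub> w) = \<theta> k * \<epsilon> (?\<mu> y)"
          using T_val[OF w, of k y] q T_eq by simp
        also have "\<dots> = sub.xi \<epsilon> \<theta> \<mu>' q"
          using ky Kc RJ' by (auto simp: sub.xi_el \<mu>'_def)
        finally show "?\<xi> (w \<otimes>\<^bsub>G\<^esub> q \<otimes>\<^bsub>G\<^esub> inv\<^bsub>G\<^esub> w) = sub.xi \<epsilon> \<theta> \<mu>' q" .
      qed
      also have "\<dots> = induced_character sub.G (els (K w) R) (sub.xi \<epsilon> \<theta> \<mu>') g"
      proof (rule induced_character_group_cong)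
        show "group (G\<lparr>carrier := Q\<rparr>)" using Q by (rule G.subgroup_imp_group)
        show "group sub.G" by (rule sub.group_G)
        show "carrier (G\<lparr>carrier := Q\<rparr>) = carrier sub.G" by (simp add: carrier_sub)
        show "g \<in> carrier (G\<lparr>carrier := Q\<rparr>)" using g by simp
        fix p q assume "p \<in> carrier (G\<lparr>carrier := Q\<rparr>)" "q \<in> carrier (G\<lparr>carrier := Q\<rparr>)"
        then obtain h x k y where "h \<in> H'" "x \<in> J'" "p = el h x" "k \<in> H'" "y \<in> J'" "q = el k y"
          by (auto simp: Q_def els_def)
        then show "p \<otimes>\<^bsub>G\<lparr>carrier := Q\<rparr>\<^esub> q = p \<otimes>\<^bsub>sub.G\<^esub> q"
          using H'c by simp
      qed
      finally show "induced_character (G\<lparr>carrier := Q\<rparr>) (T w) (\<lambda>q. ?\<xi> (w \<otimes>\<^bsub>G\<^esub> q \<otimes>\<^bsub>G\<^esub> inv\<^bsub>G\<^esub> w)) g =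
        induced_character sub.G (els (K w) R) (sub.xi \<epsilon> \<theta> \<mu>') g" .
    qed
  qed
  show ?thesis
  proof (rule sub.nat_combination_cong)
    show "sub.nat_combination \<epsilon> (\<lambda>g. \<Sum>w\<in>D. induced_character (G\<lparr>carrier := Q\<rparr>) (T w)
        (\<lambda>q. ?\<xi> (w \<otimes>\<^bsub>G\<^esub> q \<otimes>\<^bsub>G\<^esub> inv\<^bsub>G\<^esub> w)) g)"
      using part by (rule sub.nat_combination_sum)
    fix g assume "g \<in> carrier sub.G"
    then show "induced_character G (els F ?R) ?\<xi> g = (\<Sum>w\<in>D. induced_character (G\<lparr>carrier := Q\<rparr>) (T w)
        (\<lambda>q. ?\<xi> (w \<otimes>\<^bsub>G\<^esub> q \<otimes>\<^bsub>G\<^esub> inv\<^bsub>G\<^esub> w)) g)"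
      using D(4) by (simp add: carrier_sub S_def[symmetric] T_def)
  qed
qed

end

theorem theorem4p5:
  fixes scale :: "'k::{field,finite} \<Rightarrow> 'a::ring \<Rightarrow> 'a"
    and H :: "'h monoid" and J :: "'a set"
    and lact :: "'h \<Rightarrow> 'a \<Rightarrow> 'a" and ract :: "'a \<Rightarrow> 'h \<Rightarrow> 'a"
    and H' :: "'h set" and J' :: "'a set"
    and \<epsilon> :: "'k \<Rightarrow> complex"
    and \<chi> :: "('h \<Rightarrow> 'k) \<times> 'a \<Rightarrow> complex"
  assumes "triangular_type scale H J lact ract"
    and "triangular_type.triangular_subgroup scale H J lact ract H' J'"
    and "nontrivial_additive_character \<epsilon>"
    and "\<chi> \<in> triangular_type.supercharacters scale H J lact ract \<epsilon>"
  shows "\<exists>S (m :: (('h \<Rightarrow> 'k) \<times> 'a \<Rightarrow> complex) \<Rightarrow> nat). finite S \<and>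
    S \<subseteq> triangular_type.supercharacters scale (H\<lparr>carrier := H'\<rparr>) J' lact ract \<epsilon> \<and>
    (\<forall>g \<in> carrier (triangular_type.G scale (H\<lparr>carrier := H'\<rparr>) J' lact ract).
      \<chi> g = (\<Sum>\<psi>\<in>S. of_nat (m \<psi>) * \<psi> g))"
proof -
  interpret triangular_type_character scale H J lact ract \<epsilon>
    by (intro triangular_type_character.intro additive_character.intro assms(1,3))
  obtain e \<theta> \<Omega> l where \<chi>: "\<chi> = induced_character G (G_sub e l) (xi \<epsilon> \<theta> l)"
    and idx: "(e, \<theta>, \<Omega>) \<in> index_set" and l\<Omega>: "l \<in> \<Omega>"
    using assms(4) unfolding supercharacters_def by blast
  have e: "e \<in> idempotents" and \<theta>: "character_on H (H_fix e) \<theta>" and \<Omega>: "\<Omega> \<in> regular_orbits e"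
    using idx by (simp_all add: index_set_def linear_character_eq)
  obtain l0 where l0: "l0 \<in> dual_e e" "\<Omega> = {rho_dual e \<tau> l0 | \<tau>. \<tau> \<in> carrier (triples e)}"
    using \<Omega> unfolding regular_orbits_def dual_orbits_def by blast
  obtain \<tau> where \<tau>: "\<tau> \<in> carrier (triples e)" "l = rho_dual e \<tau> l0" using l\<Omega> l0(2) by blast
  note eA = idempotentD[OF e]
  have l: "l \<in> dual" unfolding \<tau>(2) by (rule rho_dual_dual[OF e \<tau>(1) l0(1)])
  \<comment> \<open>A transformed form evaluates its argument through exe, and e is idempotent. The
    form is therefore invariant under H(e) on both sides.\<close>
  have "l (sandwich e x e) = l x" if x: "x \<in> J" for x
    using x eA of_J_sandwich(2)[OF eA(2) eA(2) x] by (simp add: \<tau>(2) rho_dual_def sandwich_sandwich)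
  then have inv: "left_invariant (H_fix e) l" "right_invariant (H_fix e) l"
    using dual_e_invariant[OF e l] by blast+
  have "triangular_type.nat_combination scale (H\<lparr>carrier := H'\<rparr>) J' lact ract \<epsilon> \<chi>"
    unfolding \<chi> G_sub_eq els_def[symmetric]
    by (rule restrict_nat_combination[OF assms(2) subgroup_H_fix[OF e] l inv \<theta>])
  then show ?thesis
    unfolding triangular_type.nat_combination_def[OF triangular_type_triangular_subgroup[OF assms(2)]] .
qed

end
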